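(* Assume $s<\frac{N(p-1)+p+pa}{N-p}$ and $m<\frac{N(q-1)+q+qb}{N-q}$. If the system $$-\Delta_p u=|x|^a u^s v^\delta,\qquad -\Delta_q v=|x|^b u^\mu v^m$$ has no ground state (G.S.), then: (i) there exist regular radial solutions $(u,v)$ such that $X(T)=\frac{N-p}{p-1}$ and $Y(T)=\frac{N-q}{q-1}$ for some $T>0$, with $0<X<\frac{N-p}{p-1}$ and $0<Y<\frac{N-q}{q-1}$ on $(-\infty,T)$; (ii) there exists a positive radial solution $(u,v)$ of the Dirichlet problem for this system in a ball $B(0,R)$.
   Context: Here $N$ is the space dimension, $\Delta_p u=\operatorname{div}(|\nabla u|^{p-2}\nabla u)$, and the parameters are real numbers with $1<p,q<N$, $\min(p+a,q+b)>0$, $s,m\ge 0$, $\delta,\mu>0$ and $D=\delta\mu-(p-1-s)(q-1-m)>0$. Radial positive solutions $r=|x|\mapsto(u(r),v(r))$ satisfy $$-r^{1-N}\big(r^{N-1}|u'|^{p-2}u'\big)'=r^a u^s v^\delta,\qquad -r^{1-N}\big(r^{N-1}|v'|^{q-2}v'\big)'=r^b u^\mu v^m .$$ A positive solution $(u,v)$ on $(0,R)$ is regular (at $0$) if $u,v\in C^2(0,R)\cap C([0,R))$; such a solution has $u',v'<0$ on $(0,R)$. A ground state (G.S.) is a solution $(u,v)$, positive on $(0,\infty)$, and regular at $0$. ("Trivial" solutions $(0,C)$, $(C,0)$ with $C$ constant are excluded.) To a radial positive solution one associates, with $t=\ln r$, $$X(t)=-\frac{r u'(r)}{u(r)},\qquad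 Y(t)=-\frac{r v'(r)}{v(r)} .$$ A positive radial solution of the Dirichlet problem in $B(0,R)$ is a radial solution, regular at $0$, positive on $[0,R)$, with $u(R)=v(R)=0$. *)

theory Defs
  imports "HOL-Analysis.Analysis"
begin

definition C2_on :: "real set \<Rightarrow> (real \<Rightarrow> real) \<Rightarrow> bool" where
  "C2_on S f \<longleftrightarrow>
     (\<forall>r\<in>S. f differentiable (at r)) \<and>
     (\<forall>r\<in>S. deriv f differentiable (at r)) \<and>
     continuous_on S (deriv (deriv f))"

text \<open>At a zero of the derivative of \<open>u\<close> the flux is \<open>0\<close> for every \<open>p\<close>, since
  \<open>0 powr x = 0\<close>; this is the continuous extension of \<open>\<bar>u'\<bar>\<^sup>p\<^sup>-\<^sup>2 u'\<close> for \<open>p > 1\<close>.\<close>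

definition radial_flux :: "nat \<Rightarrow> real \<Rightarrow> (real \<Rightarrow> real) \<Rightarrow> real \<Rightarrow> real" where
  "radial_flux N p u r = r ^ (N - 1) * (\<bar>deriv u r\<bar> powr (p - 2) * deriv u r)"

definition radial_p_Laplacian :: "nat \<Rightarrow> real \<Rightarrow> (real \<Rightarrow> real) \<Rightarrow> real \<Rightarrow> real" where
  "radial_p_Laplacian N p u r = r powr (1 - real N) * deriv (radial_flux N p u) r"

text \<open>The outer radius \<open>R\<close> is extended, so that \<open>R = \<infinity>\<close> gives \<open>(0,\<infinity>)\<close> and \<open>[0,\<infinity>)\<close>. In the
  system, differentiability of the fluxes is demanded explicitly because \<^const>\<open>deriv\<close> is
  total and unspecified where no derivative exists.\<close>

definition open_range :: "ereal \<Rightarrow> real set" where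
  "open_range R = {r. 0 < r \<and> ereal r < R}"

definition half_open_range :: "ereal \<Rightarrow> real set" where
  "half_open_range R = {r. 0 \<le> r \<and> ereal r < R}"

definition solves_radial_system ::
  "nat \<Rightarrow> real \<Rightarrow> real \<Rightarrow> real \<Rightarrow> real \<Rightarrow> real \<Rightarrow> real \<Rightarrow> real \<Rightarrow> real \<Rightarrow>
   ereal \<Rightarrow> (real \<Rightarrow> real) \<Rightarrow> (real \<Rightarrow> real) \<Rightarrow> bool" where
  "solves_radial_system N p q a b s m \<delta> \<mu> R u v \<longleftrightarrow>
     (\<forall>r\<in>open_range R.
        radial_flux N p u differentiable (at r) \<and>
        radial_flux N q v differentiable (at r) \<and>
        - radial_p_Laplacian N p u r = r powr a * u r powr s * v r powr \<delta> \<and>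
        - radial_p_Laplacian N q v r = r powr b * u r powr \<mu> * v r powr m)"

definition regular_radial_solution ::
  "nat \<Rightarrow> real \<Rightarrow> real \<Rightarrow> real \<Rightarrow> real \<Rightarrow> real \<Rightarrow> real \<Rightarrow> real \<Rightarrow> real \<Rightarrow>
   ereal \<Rightarrow> (real \<Rightarrow> real) \<Rightarrow> (real \<Rightarrow> real) \<Rightarrow> bool" where
  "regular_radial_solution N p q a b s m \<delta> \<mu> R u v \<longleftrightarrow>
     0 < R \<and>
     (\<forall>r\<in>open_range R. 0 < u r \<and> 0 < v r) \<and>
     solves_radial_system N p q a b s m \<delta> \<mu> R u v \<and>
     C2_on (open_range R) u \<and> C2_on (open_range R) v \<and>
     continuous_on (half_open_range R) u \<and> continuous_on (half_open_range R) v"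

definition ground_state ::
  "nat \<Rightarrow> real \<Rightarrow> real \<Rightarrow> real \<Rightarrow> real \<Rightarrow> real \<Rightarrow> real \<Rightarrow> real \<Rightarrow> real \<Rightarrow>
   (real \<Rightarrow> real) \<Rightarrow> (real \<Rightarrow> real) \<Rightarrow> bool" where
  "ground_state N p q a b s m \<delta> \<mu> u v \<longleftrightarrow>
     regular_radial_solution N p q a b s m \<delta> \<mu> \<infinity> u v"

text \<open>The solution is also continuous up to \<open>R\<close>, so that the boundary values at \<open>R\<close> are
  attained and not merely assigned.\<close>

definition radial_Dirichlet_solution ::
  "nat \<Rightarrow> real \<Rightarrow> real \<Rightarrow> real \<Rightarrow> real \<Rightarrow> real \<Rightarrow> real \<Rightarrow> real \<Rightarrow> real \<Rightarrow>
   real \<Rightarrow> (real \<Rightarrow> real) \<Rightarrow> (real \<Rightarrow> real) \<Rightarrow> bool" where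
  "radial_Dirichlet_solution N p q a b s m \<delta> \<mu> R u v \<longleftrightarrow>
     regular_radial_solution N p q a b s m \<delta> \<mu> (ereal R) u v \<and>
     (\<forall>r\<in>{0..<R}. 0 < u r \<and> 0 < v r) \<and>
     continuous_on {0..R} u \<and> continuous_on {0..R} v \<and>
     u R = 0 \<and> v R = 0"

text \<open>The common form of \<open>X\<close> (for \<open>w = u\<close>) and \<open>Y\<close> (for \<open>w = v\<close>), with \<open>t = ln r\<close>.\<close>

definition log_slope :: "(real \<Rightarrow> real) \<Rightarrow> real \<Rightarrow> real" where
  "log_slope w t = - (exp t * deriv w (exp t)) / w (exp t)"

end

theory Submission
  imports Defs "HOL-Complex_Analysis.Great_Picard"
begin

text \<open>
  The proof is a shooting argument whose limit is either the desired solution or a solution that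
  the hypotheses exclude.

  Normalise \<open>u(0) = v(0) = 1\<close>. Integrating the two equations twice, with constants in front of
  the right-hand sides, gives \<open>u = 1 - \<alpha> \<Phi>(u,v)\<close> and \<open>v = 1 - \<beta> \<Psi>(u,v)\<close> with increasing functions
  \<open>\<Phi>(u,v)\<close> and \<open>\<Psi>(u,v)\<close> of the radius (\<open>descent\<close> below). Since \<open>D \<noteq> 0\<close>, multiplying \<open>u\<close> and \<open>v\<close> by
  constants turns any two positive constants in the equations into \<open>1\<close> (\<open>normalising_factors\<close>). So
  the segment \<open>\<alpha> = 1 - k\<close>, \<open>\<beta> = k\<close> with \<open>0 < k < 1\<close> consists, up to such constants, of solutions of the
  system, and at its end points one component is the constant \<open>1\<close> while the other solves a scalar equation.

  A component exits at the radius where \<open>u = \<eta> r |u'|\<close>. For \<open>\<eta> = 0\<close> this is a zero of \<open>u\<close>, for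
  \<open>\<eta> = (p-1)/(N-p)\<close> it is \<open>X = (N-p)/(p-1)\<close>; for all \<open>\<eta>\<close> in between \<open>u - \<eta> r |u'|\<close> is strictly
  decreasing, because the flux \<open>r\<^sup>N\<^sup>-\<^sup>1 |u'|\<^sup>p\<^sup>-\<^sup>1\<close> increases. At \<open>k = 0\<close> only \<open>u\<close> exits and at \<open>k = 1\<close> only
  \<open>v\<close>, so by connectedness of \<open>[0,1]\<close> both exit at the same radius for some \<open>k\<close>
  (\<open>simultaneous_crossing\<close>). The case of two zeros leads to the Dirichlet problem, the other
  case to \<open>X(T) = (N-p)/(p-1)\<close> and \<open>Y(T) = (N-q)/(q-1)\<close>.

  This needs solutions that depend continuously on \<open>k\<close>, although \<open>u\<^sup>s\<close> is for \<open>s < 1\<close> not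
  Lipschitz at \<open>u = 0\<close>. Therefore the right-hand sides are first evaluated at the delayed radius \<open>r - \<tau>\<close> and
  with both components raised to at least \<open>\<epsilon> > 0\<close>; on a bounded interval such a system is solved
  exactly by finitely many iterations, which are continuous in \<open>k\<close>. Then \<open>\<epsilon>\<close> and \<open>\<tau>\<close> tend to \<open>0\<close>
  (\<open>limit_profile\<close>). The profiles are equicontinuous, and since the flux increases, \<open>u(r)\<close> is away
  from the origin at least \<open>\<alpha> K (r\<^sup>-\<^sup>A - \<rho>\<^sup>-\<^sup>A)\<close>, where \<open>\<rho>\<close> is the common exit radius,
  \<open>A = (N-p)/(p-1)\<close>, and \<open>K > 0\<close> does not depend on \<open>\<epsilon>\<close> and \<open>\<tau>\<close>. Hence the limit is positive up
  to the limit of the exit radii and solves the exact equations there.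

  If the exit radii stay bounded, neither multiplier can tend to \<open>0\<close>, and the limit yields the
  conclusion. If they tend to infinity, the limit is positive on the whole half-line: a ground
  state when both multipliers are positive, which is excluded by hypothesis, and otherwise an
  entire positive solution of one scalar equation, which Pohozaev's identity excludes in the
  subcritical range (\<open>not_subcritical\<close>).\<close>

section \<open>Weighted radial means\<close>

lemma continuous_on_powr_const_exponent:
  fixes g :: "'a::topological_space \<Rightarrow> real"
  assumes "e > 0" "continuous_on S g" "\<And>x. x \<in> S \<Longrightarrow> 0 \<le> g x"
  shows "continuous_on S (\<lambda>x. g x powr e)"
  by (rule continuous_on_powr') (use assms in auto)

text \<open>The mean of \<open>f\<close> over \<open>[0,r]\<close> for the density \<open>c x\<^sup>c\<^sup>-\<^sup>1 / r\<^sup>c\<close>. The substitution \<open>y = (x/r)\<^sup>c\<close> makes the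
  integrand continuous also for \<open>c < 1\<close>, where the density is singular at \<open>0\<close>, and moves the
  radius out of the domain of integration, so that continuity in further parameters is that of
  the integrand.\<close>

definition radial_mean :: "real \<Rightarrow> (real \<Rightarrow> real) \<Rightarrow> real \<Rightarrow> real" where
  "radial_mean c f r = integral {0..1} (\<lambda>y. f (r * y powr (1 / c)))"

lemma scaled_radius_in_interval:
  fixes c r y :: real
  assumes "c > 0" "0 \<le> r" "y \<in> {0..1}"
  shows "0 \<le> r * y powr (1 / c)" "r * y powr (1 / c) \<le> r"
proof -
  have "y powr (1 / c) \<le> 1 powr (1/c)"
    using assms by (intro powr_mono2) auto
  then show "r * y powr (1 / c) \<le> r"
    using assms(2) by (simp add: mult_left_le)
qed (use assms in auto)

lemma continuous_on_root_powr:
  fixes c :: real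
  assumes "c > 0" "S \<subseteq> {0..}"
  shows "continuous_on S (\<lambda>z. z powr (1 / c))"
  by (rule continuous_on_powr_const_exponent) (use assms in \<open>auto intro: continuous_on_id'\<close>)

lemma continuous_on_radial_mean_param:
  fixes f :: "'a::topological_space \<Rightarrow> real \<Rightarrow> real"
  assumes c: "c > 0"
    and f: "continuous_on (S \<times> {0..R}) (\<lambda>(k, r). f k r)"
  shows "continuous_on (S \<times> {0..R}) (\<lambda>(k, r). radial_mean c (f k) r)"
proof -
  have "continuous_on ((S \<times> {0..R}) \<times> cbox 0 1)
          (\<lambda>z. (fst (fst z), snd (fst z) * snd z powr (1 / c)))"
    using c by (intro continuous_on_powr_const_exponent continuous_on_mult continuous_on_Pair
      continuous_on_fst continuous_on_snd continuous_on_id continuous_on_const) (auto intro!: continuous_intros)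
  moreover have "(\<lambda>z. (fst (fst z), snd (fst z) * snd z powr (1 / c))) ` ((S \<times> {0..R}) \<times> cbox 0 1)
      \<subseteq> S \<times> {0..R}"
  proof safe
    fix k r y assume "(k::'a) \<in> S" and r: "r \<in> {0..R}" and y: "y \<in> cbox 0 (1::real)"
    show "snd (fst ((k, r), y)) * snd ((k, r), y) powr (1 / c) \<in> {0..R}"
      using scaled_radius_in_interval[OF c, of r y] r y by auto
  qed auto
  ultimately have "continuous_on ((S \<times> {0..R}) \<times> cbox 0 1)
      (\<lambda>z. (\<lambda>(k, r). f k r) (fst (fst z), snd (fst z) * snd z powr (1 / c)))"
    using continuous_on_compose2[OF f] by blast
  then have "continuous_on ((S \<times> {0..R}) \<times> cbox 0 1)
      (\<lambda>(x, y). f (fst x) (snd x * y powr (1 / c)))"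
    by (simp add: split_beta)
  from integral_continuous_on_param[OF this]
  show ?thesis
    by (simp add: radial_mean_def split_beta)
qed

lemma continuous_on_radial_mean:
  assumes c: "c > 0" and f: "continuous_on {0..R} f"
  shows "continuous_on {0..R} (radial_mean c f)"
proof -
  have "continuous_on ({0::real} \<times> {0..R}) (\<lambda>(k, r). f r)"
    unfolding split_beta by (rule continuous_on_compose2[OF f]) (auto intro!: continuous_intros)
  from continuous_on_radial_mean_param[OF c this]
  have *: "continuous_on ({0::real} \<times> {0..R}) (\<lambda>(k, r). radial_mean c f r)" .
  have "continuous_on {0..R} (\<lambda>r. (\<lambda>(k, r). radial_mean c f r) (0::real, r))"
    by (rule continuous_on_compose2[OF *]) (auto intro!: continuous_intros)
  then show ?thesis by simp
qed

lemma radial_mean_integrand_continuous: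
  fixes f :: "real \<Rightarrow> real" and c r :: real
  assumes c: "c > 0" and f: "continuous_on {0..r} f" and r: "0 \<le> r"
  shows "continuous_on {0..1} (\<lambda>y. f (r * y powr (1 / c)))"
proof (rule continuous_on_compose2[OF f])
  show "continuous_on {0..1} (\<lambda>y. r * y powr (1 / c))"
    using continuous_on_root_powr[OF c, of "{0..1}"] by (intro continuous_on_mult_left) auto
  show "(\<lambda>y. r * y powr (1 / c)) ` {0..1} \<subseteq> {0..r}"
    using scaled_radius_in_interval[OF c r] by auto
qed

lemma radial_mean_integrable:
  fixes f :: "real \<Rightarrow> real" and c r :: real
  assumes "c > 0" "continuous_on {0..r} f" "0 \<le> r"
  shows "(\<lambda>y. f (r * y powr (1 / c))) integrable_on {0..1}"
  by (rule integrable_continuous_real[OF radial_mean_integrand_continuous[OF assms]])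

lemma radial_mean_cong:
  assumes "c > 0" "0 \<le> r" "\<And>x. 0 \<le> x \<Longrightarrow> x \<le> r \<Longrightarrow> f x = g x"
  shows "radial_mean c f r = radial_mean c g r"
  unfolding radial_mean_def
  by (intro integral_cong assms scaled_radius_in_interval)

lemma radial_mean_mono:
  assumes "c > 0" "continuous_on {0..r} f" "continuous_on {0..r} g" "0 \<le> r"
    "\<And>x. 0 \<le> x \<Longrightarrow> x \<le> r \<Longrightarrow> f x \<le> g x"
  shows "radial_mean c f r \<le> radial_mean c g r"
  unfolding radial_mean_def
  by (intro integral_le radial_mean_integrable assms scaled_radius_in_interval)

lemma radial_mean_const [simp]: "radial_mean c (\<lambda>_. k) r = k"
  by (simp add: radial_mean_def)

lemma radial_mean_bounds:
  assumes "c > 0" "continuous_on {0..r} f" "0 \<le> r"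
    "\<And>x. 0 \<le> x \<Longrightarrow> x \<le> r \<Longrightarrow> lo \<le> f x" "\<And>x. 0 \<le> x \<Longrightarrow> x \<le> r \<Longrightarrow> f x \<le> hi"
  shows "lo \<le> radial_mean c f r" "radial_mean c f r \<le> hi"
  using radial_mean_mono[of c r "\<lambda>_. lo" f] radial_mean_mono[of c r f "\<lambda>_. hi"] assms by auto

lemma radial_mean_nonneg:
  assumes c: "c > 0" and r: "0 \<le> r" and f: "\<And>x. 0 \<le> x \<Longrightarrow> x \<le> r \<Longrightarrow> 0 \<le> f x"
  shows "0 \<le> radial_mean c f r"
proof (cases "(\<lambda>y. f (r * y powr (1 / c))) integrable_on {0..1}")
  case True
  then show ?thesis unfolding radial_mean_def
    by (rule integral_nonneg) (intro f scaled_radius_in_interval c r)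
qed (simp add: radial_mean_def not_integrable_integral)

lemma radial_mean_tendsto:
  fixes f :: "nat \<Rightarrow> real \<Rightarrow> real"
  assumes c: "c > 0" and r: "0 \<le> r" and f: "\<And>n. continuous_on {0..r} (f n)"
    and bnd: "\<And>n x. 0 \<le> x \<Longrightarrow> x \<le> r \<Longrightarrow> \<bar>f n x\<bar> \<le> B"
    and lim: "\<And>x. 0 \<le> x \<Longrightarrow> x \<le> r \<Longrightarrow> (\<lambda>n. f n x) \<longlonglongrightarrow> g x"
  shows "(\<lambda>n. radial_mean c (f n) r) \<longlonglongrightarrow> radial_mean c g r"
  unfolding radial_mean_def
proof (rule dominated_convergence(2)[where h = "\<lambda>_. B"])
  show "(\<lambda>_::real. B) integrable_on {0..1}"
    by (rule integrable_continuous_real) (rule continuous_on_const)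
  show "norm (f k (r * x powr (1 / c))) \<le> B" if "x \<in> {0..1}" for k x
    using bnd[OF scaled_radius_in_interval[OF c r that]] by simp
  show "(\<lambda>k. f k (r * x powr (1 / c))) \<longlonglongrightarrow> g (r * x powr (1 / c))" if "x \<in> {0..1}" for x
    using that lim scaled_radius_in_interval[OF c r] by blast
qed (use radial_mean_integrable c f r in auto)

text \<open>In this form the radius occurs only in the upper limit, which gives access to the fundamental
  theorem of calculus.\<close>

lemma radial_mean_as_integral:
  assumes c: "c > 0" and r: "0 < r"
  shows "r powr c * radial_mean c f r = integral {0..r powr c} (\<lambda>z. f (z powr (1 / c)))"
proof -
  let ?m = "r powr c"
  have m: "?m > 0" using r by simp
  have "integral ((\<lambda>x. x / ?m) ` {0..?m}) (\<lambda>x. f ((?m * x) powr (1 / c)))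
      = (1 / \<bar>?m\<bar>) *\<^sub>R integral {0..?m} (\<lambda>z. f (z powr (1 / c)))"
    using m integral_stretch_real[of ?m 0 ?m "\<lambda>z. f (z powr (1 / c))"] by simp
  moreover have "(\<lambda>x. x / ?m) ` {0..?m} = {0..1}"
    using m by (subst image_divide_atLeastAtMost) auto
  moreover have "integral {0..1} (\<lambda>x. f ((?m * x) powr (1 / c))) = radial_mean c f r"
    unfolding radial_mean_def
    by (intro integral_cong) (use c r in \<open>simp add: powr_mult powr_powr\<close>)
  ultimately show ?thesis using m by simp
qed

lemma has_real_derivative_radial_mean:
  assumes c: "c > 0" and r: "0 < r" "r < R" and f: "continuous_on {0..R} f"
  shows "((\<lambda>r. r powr c * radial_mean c f r) has_real_derivative c * r powr (c - 1) * f r) (at r)"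
proof -
  let ?g = "\<lambda>z. f (z powr (1 / c))"
  have "continuous_on {0..R powr c} ?g"
  proof (rule continuous_on_compose2[OF f])
    show "continuous_on {0..R powr c} (\<lambda>z. z powr (1 / c))"
      by (rule continuous_on_root_powr[OF c]) (simp add: subset_iff)
    show "(\<lambda>z. z powr (1 / c)) ` {0..R powr c} \<subseteq> {0..R}"
    proof safe
      fix z assume z: "z \<in> {0..R powr c}"
      then have "z powr (1/c) \<le> (R powr c) powr (1/c)" using c by (intro powr_mono2) auto
      then show "z powr (1/c) \<in> {0..R}" using c r by (simp add: powr_powr)
    qed
  qed
  moreover have rc: "0 < r powr c" "r powr c < R powr c"
    using r c by (auto intro: powr_less_mono2)
  ultimately have "((\<lambda>x. integral {0..x} ?g) has_real_derivative ?g (r powr c))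
      (at (r powr c) within {0..R powr c})"
    by (intro integral_has_real_derivative) auto
  moreover have "at (r powr c) within {0..R powr c} = at (r powr c)"
    using rc by (intro at_within_interior) (simp add: interior_atLeastAtMost_real)
  ultimately have g: "((\<lambda>x. integral {0..x} ?g) has_real_derivative ?g (r powr c)) (at (r powr c))"
    by metis
  have "((\<lambda>r. integral {0..r powr c} ?g) has_real_derivative
      ?g (r powr c) * (c * r powr (c - 1))) (at r)"
    by (rule DERIV_chain2[where f = "\<lambda>x. integral {0..x} ?g", OF g has_real_derivative_powr[OF r(1)]])
  moreover have "?g (r powr c) = f r" using c r by (simp add: powr_powr)
  ultimately have "((\<lambda>r. integral {0..r powr c} ?g) has_real_derivative
      c * r powr (c - 1) * f r) (at r)"
    by (simp add: mult_ac)
  then show ?thesis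
    by (rule has_field_derivative_transform_within_open[of _ _ _ "{0<..}"])
       (use r radial_mean_as_integral[OF c] in auto)
qed

section \<open>The profile generated by a given source\<close>

text \<open>For \<open>c = N + a\<close>, \<open>d = (p + a)/(p - 1)\<close> and \<open>\<theta> = 1/(p - 1)\<close>, the regular solutions of
  \<open>-\<Delta>\<^sub>p u = C r\<^sup>a h\<close> with \<open>u(0) = 1\<close> are the functions \<open>1 - \<alpha> descent\<close>, where \<open>\<alpha>\<close> is a constant multiple
  of \<open>C\<^sup>\<theta>\<close>: the inner mean is the integrated source, the outer one integrates \<open>u'\<close>.\<close>

definition descent :: "real \<Rightarrow> real \<Rightarrow> real \<Rightarrow> (real \<Rightarrow> real) \<Rightarrow> real \<Rightarrow> real" where
  "descent c d \<theta> h r = r powr d * radial_mean d (\<lambda>x. radial_mean c h x powr \<theta>) r"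

text \<open>Up to a constant factor this is the flux \<open>r\<^sup>N\<^sup>-\<^sup>1 |u'|\<^sup>p\<^sup>-\<^sup>1\<close> of the solution with source \<open>h\<close>.\<close>

definition mass :: "real \<Rightarrow> (real \<Rightarrow> real) \<Rightarrow> real \<Rightarrow> real" where
  "mass c h r = r powr c * radial_mean c h r"

text \<open>Chosen such that \<open>u(r) - \<eta> r |u'(r)| = 1 - \<alpha> exit_function(r)\<close> for \<open>u = 1 - \<alpha> descent\<close>. The exit
  condition \<open>u = \<eta> r |u'|\<close> thus reads \<open>\<alpha> exit_function = 1\<close>.\<close>

definition exit_function :: "real \<Rightarrow> real \<Rightarrow> real \<Rightarrow> real \<Rightarrow> (real \<Rightarrow> real) \<Rightarrow> real \<Rightarrow> real" where
  "exit_function c d \<theta> \<eta> h r =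
     descent c d \<theta> h r + \<eta> * (d * r powr d * radial_mean c h r powr \<theta>)"

text \<open>For the exponents of the \<open>p\<close>-Laplacian, \<open>c \<theta> - d = (N - p)/(p - 1)\<close>, so the last condition is
  \<open>p < N\<close>, and \<open>r powr (d - c \<theta>)\<close> is the decaying radial \<open>p\<close>-harmonic function.\<close>

locale radial_exponents =
  fixes c d \<theta> :: real
  assumes c_pos: "c > 0" and d_pos: "d > 0" and theta_pos: "\<theta> > 0" and decay_pos: "d < c * \<theta>"
begin

lemma mean_continuous: "continuous_on {0..} h \<Longrightarrow> continuous_on {0..R} (radial_mean c h)"
  by (rule continuous_on_radial_mean[OF c_pos continuous_on_subset]) auto

lemma mean_bounds:
  assumes "continuous_on {0..} h" "0 \<le> r"
    "\<And>x. 0 \<le> x \<Longrightarrow> x \<le> r \<Longrightarrow> lo \<le> h x" "\<And>x. 0 \<le> x \<Longrightarrow> x \<le> r \<Longrightarrow> h x \<le> 1"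
  shows "lo \<le> radial_mean c h r" "radial_mean c h r \<le> 1"
  using radial_mean_bounds[OF c_pos, of r h lo 1] continuous_on_subset[OF assms(1), of "{0..r}"] assms
  by auto

lemma mean_powr_continuous:
  assumes "continuous_on {0..} h" "\<And>x. 0 \<le> x \<Longrightarrow> 0 \<le> h x" "\<And>x. 0 \<le> x \<Longrightarrow> h x \<le> 1"
  shows "continuous_on {0..R} (\<lambda>x. radial_mean c h x powr \<theta>)"
  by (rule continuous_on_powr_const_exponent[OF theta_pos mean_continuous])
     (use mean_bounds[of h _ 0] assms in auto)

lemma descent_0 [simp]: "descent c d \<theta> h 0 = 0"
  by (simp add: descent_def)

lemma descent_continuous:
  assumes "continuous_on {0..} h" "\<And>x. 0 \<le> x \<Longrightarrow> 0 \<le> h x" "\<And>x. 0 \<le> x \<Longrightarrow> h x \<le> 1"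
  shows "continuous_on {0..R} (descent c d \<theta> h)"
  unfolding descent_def
  by (intro continuous_on_mult continuous_on_radial_mean mean_powr_continuous
        continuous_on_powr_const_exponent d_pos continuous_on_id) (use assms in auto)

lemma descent_nonneg:
  "0 \<le> r \<Longrightarrow> 0 \<le> descent c d \<theta> h r"
  unfolding descent_def by (intro mult_nonneg_nonneg radial_mean_nonneg d_pos) auto

lemma descent_cong:
  assumes "0 \<le> r" "\<And>x. 0 \<le> x \<Longrightarrow> x \<le> r \<Longrightarrow> h x = g x"
  shows "descent c d \<theta> h r = descent c d \<theta> g r"
proof -
  have "radial_mean c h x powr \<theta> = radial_mean c g x powr \<theta>" if "0 \<le> x" "x \<le> r" for x
    using radial_mean_cong[OF c_pos that(1), of h g] that assms by auto
  then have "radial_mean d (\<lambda>x. radial_mean c h x powr \<theta>) r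
      = radial_mean d (\<lambda>x. radial_mean c g x powr \<theta>) r"
    by (intro radial_mean_cong[OF d_pos assms(1)])
  then show ?thesis by (simp add: descent_def)
qed

lemma continuous_on_descent_param:
  fixes h :: "'a::topological_space \<Rightarrow> real \<Rightarrow> real"
  assumes h: "continuous_on (S \<times> {0..R}) (\<lambda>(k, r). h k r)"
    and h0: "\<And>k x. k \<in> S \<Longrightarrow> 0 \<le> x \<Longrightarrow> x \<le> R \<Longrightarrow> 0 \<le> h k x"
  shows "continuous_on (S \<times> {0..R}) (\<lambda>(k, r). descent c d \<theta> (h k) r)"
proof -
  have mean0: "0 \<le> radial_mean c (h k) r" if "k \<in> S" "0 \<le> r" "r \<le> R" for k r
    using h0 that by (intro radial_mean_nonneg c_pos) auto
  have "continuous_on (S \<times> {0..R}) (\<lambda>x. (\<lambda>(k, r). radial_mean c (h k) r) x powr \<theta>)"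
    by (rule continuous_on_powr_const_exponent[OF theta_pos continuous_on_radial_mean_param[OF c_pos h]])
       (use mean0 in auto)
  then have "continuous_on (S \<times> {0..R}) (\<lambda>(k, r). (\<lambda>k x. radial_mean c (h k) x powr \<theta>) k r)"
    by (simp add: split_beta)
  from continuous_on_radial_mean_param[OF d_pos this]
  have "continuous_on (S \<times> {0..R})
     (\<lambda>z. snd z powr d * radial_mean d (\<lambda>x. radial_mean c (h (fst z)) x powr \<theta>) (snd z))"
    by (intro continuous_on_mult continuous_on_powr_const_exponent[OF d_pos])
       (auto simp: split_beta intro!: continuous_intros)
  then show ?thesis
    by (simp add: descent_def split_beta)
qed

lemma continuous_on_exit_function_param:
  fixes h :: "'a::topological_space \<Rightarrow> real \<Rightarrow> real"
  assumes h: "continuous_on (S \<times> {0..R}) (\<lambda>(k, r). h k r)"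
    and h0: "\<And>k x. k \<in> S \<Longrightarrow> 0 \<le> x \<Longrightarrow> x \<le> R \<Longrightarrow> 0 \<le> h k x"
  shows "continuous_on (S \<times> {0..R}) (\<lambda>(k, r). exit_function c d \<theta> \<eta> (h k) r)"
proof -
  have mean0: "0 \<le> radial_mean c (h k) r" if "k \<in> S" "0 \<le> r" "r \<le> R" for k r
    using h0 that by (intro radial_mean_nonneg c_pos) auto
  have 1: "continuous_on (S \<times> {0..R}) (\<lambda>x. (\<lambda>(k, r). radial_mean c (h k) r) x powr \<theta>)"
    by (rule continuous_on_powr_const_exponent[OF theta_pos continuous_on_radial_mean_param[OF c_pos h]])
       (use mean0 in auto)
  have 2: "continuous_on (S \<times> {0..R}) (\<lambda>z. snd z powr d)"
    by (rule continuous_on_powr_const_exponent[OF d_pos]) (auto intro!: continuous_intros)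
  have "continuous_on (S \<times> {0..R}) (\<lambda>z. (\<lambda>(k, r). descent c d \<theta> (h k) r) z
      + \<eta> * (d * snd z powr d * (\<lambda>(k, r). radial_mean c (h k) r) z powr \<theta>))"
    by (intro continuous_on_add continuous_on_mult continuous_on_const 1 2
        continuous_on_descent_param h h0)
  then show ?thesis by (simp add: exit_function_def split_beta)
qed

lemma has_real_derivative_mass:
  assumes "continuous_on {0..} h" "0 < r"
  shows "(mass c h has_real_derivative c * r powr (c - 1) * h r) (at r)"
  using has_real_derivative_radial_mean[OF c_pos assms(2), of "r + 1" h]
    continuous_on_subset[OF assms(1), of "{0..r + 1}"]
  by (auto simp: mass_def[abs_def])

lemma has_real_derivative_descent:
  assumes "continuous_on {0..} h" "\<And>x. 0 \<le> x \<Longrightarrow> 0 \<le> h x" "\<And>x. 0 \<le> x \<Longrightarrow> h x \<le> 1" "0 < r"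
  shows "(descent c d \<theta> h has_real_derivative d * r powr (d - 1) * radial_mean c h r powr \<theta>) (at r)"
  using has_real_derivative_radial_mean[OF d_pos assms(4) _ mean_powr_continuous[OF assms(1-3)], of "r + 1"]
  by (auto simp: descent_def[abs_def])

lemma mass_0 [simp]: "mass c h 0 = 0"
  by (simp add: mass_def)

lemma mass_pos:
  assumes "continuous_on {0..} h" "\<And>x. 0 \<le> x \<Longrightarrow> lo \<le> h x" "\<And>x. 0 \<le> x \<Longrightarrow> h x \<le> 1" "0 < r" "lo > 0"
  shows "0 < mass c h r"
  using mean_bounds(1)[OF assms(1), of r lo] assms by (simp add: mass_def)

lemma mean_powr_eq_mass:
  assumes "0 \<le> radial_mean c h r" "0 < r"
  shows "radial_mean c h r powr \<theta> = r powr (- (c * \<theta>)) * mass c h r powr \<theta>"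
  using assms by (simp add: mass_def powr_mult powr_powr powr_add[symmetric] mult.assoc[symmetric])

lemma mass_continuous:
  assumes "continuous_on {0..} h"
  shows "continuous_on {0..R} (mass c h)"
  unfolding mass_def
  by (intro continuous_on_mult mean_continuous continuous_on_powr_const_exponent c_pos
      continuous_on_id assms) auto

lemma mass_increment:
  assumes h: "continuous_on {0..} h" "\<And>x. 0 \<le> x \<Longrightarrow> 0 \<le> h x" "\<And>x. 0 \<le> x \<Longrightarrow> h x \<le> 1"
    and r: "0 \<le> r" "r \<le> r'"
  shows "mass c h r \<le> mass c h r'" "mass c h r' - mass c h r \<le> r' powr c - r powr c"
proof -
  show "mass c h r \<le> mass c h r'"
  proof (rule DERIV_nonneg_imp_increasing_open[OF r(2)])
    show "continuous_on {r..r'} (mass c h)"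
      by (rule continuous_on_subset[OF mass_continuous[OF h(1), of r']]) (use r in auto)
    show "\<exists>y. (mass c h has_real_derivative y) (at x) \<and> 0 \<le> y" if "r < x" "x < r'" for x
      using has_real_derivative_mass[OF h(1), of x] h(2)[of x] that r c_pos by fastforce
  qed
  have "r powr c - mass c h r \<le> r' powr c - mass c h r'"
  proof (rule DERIV_nonneg_imp_increasing_open[OF r(2)])
    show "continuous_on {r..r'} (\<lambda>r. r powr c - mass c h r)"
      by (intro continuous_on_diff continuous_on_powr_const_exponent[OF c_pos] continuous_on_id
            continuous_on_subset[OF mass_continuous[OF h(1), of r']]) (use r in auto)
    show "\<exists>y. ((\<lambda>r. r powr c - mass c h r) has_real_derivative y) (at x) \<and> 0 \<le> y"
      if "r < x" "x < r'" for x
    proof (intro exI conjI)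
      show "((\<lambda>r. r powr c - mass c h r) has_real_derivative
         c * x powr (c - 1) - c * x powr (c - 1) * h x) (at x)"
        using has_real_derivative_mass[OF h(1), of x] that r
        by (intro DERIV_diff has_real_derivative_powr) auto
      have "c * x powr (c - 1) * h x \<le> c * x powr (c - 1) * 1"
        using h(3)[of x] that r c_pos by (intro mult_left_mono) auto
      then show "0 \<le> c * x powr (c - 1) - c * x powr (c - 1) * h x" by simp
    qed
  qed
  then show "mass c h r' - mass c h r \<le> r' powr c - r powr c" by simp
qed

lemma descent_increment:
  assumes h: "continuous_on {0..} h" "\<And>x. 0 \<le> x \<Longrightarrow> 0 \<le> h x" "\<And>x. 0 \<le> x \<Longrightarrow> h x \<le> 1"
    and r: "0 \<le> r" "r \<le> r'"
  shows "descent c d \<theta> h r \<le> descent c d \<theta> h r'"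
    "descent c d \<theta> h r' - descent c d \<theta> h r \<le> r' powr d - r powr d"
proof -
  show "descent c d \<theta> h r \<le> descent c d \<theta> h r'"
  proof (rule DERIV_nonneg_imp_increasing_open[OF r(2)])
    show "continuous_on {r..r'} (descent c d \<theta> h)"
      by (rule continuous_on_subset[OF descent_continuous[OF h, of r']]) (use r in auto)
    show "\<exists>y. (descent c d \<theta> h has_real_derivative y) (at x) \<and> 0 \<le> y" if "r < x" "x < r'" for x
    proof (intro exI conjI)
      show "(descent c d \<theta> h has_real_derivative d * x powr (d - 1) * radial_mean c h x powr \<theta>) (at x)"
        by (rule has_real_derivative_descent) (use h that r in auto)
    qed (use d_pos in auto)
  qed
  have "r powr d - descent c d \<theta> h r \<le> r' powr d - descent c d \<theta> h r'"
  proof (rule DERIV_nonneg_imp_increasing_open[OF r(2)])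
    show "continuous_on {r..r'} (\<lambda>r. r powr d - descent c d \<theta> h r)"
      by (intro continuous_on_diff continuous_on_powr_const_exponent[OF d_pos] continuous_on_id
            continuous_on_subset[OF descent_continuous[OF h, of r']]) (use r in auto)
    show "\<exists>y. ((\<lambda>r. r powr d - descent c d \<theta> h r) has_real_derivative y) (at x) \<and> 0 \<le> y"
      if "r < x" "x < r'" for x
    proof (intro exI conjI)
      show "((\<lambda>r. r powr d - descent c d \<theta> h r) has_real_derivative
         d * x powr (d - 1) - d * x powr (d - 1) * radial_mean c h x powr \<theta>) (at x)"
        using h that r by (intro DERIV_diff has_real_derivative_powr has_real_derivative_descent) auto
      have "radial_mean c h x powr \<theta> \<le> 1"
        using mean_bounds[of h x 0] h that r theta_pos powr_mono2[of \<theta> "radial_mean c h x" 1] by auto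
      then have "d * x powr (d - 1) * radial_mean c h x powr \<theta> \<le> d * x powr (d - 1) * 1"
        using that r d_pos by (intro mult_left_mono) auto
      then show "0 \<le> d * x powr (d - 1) - d * x powr (d - 1) * radial_mean c h x powr \<theta>" by simp
    qed
  qed
  then show "descent c d \<theta> h r' - descent c d \<theta> h r \<le> r' powr d - r powr d" by simp
qed

lemma descent_modulus:
  assumes h: "continuous_on {0..} h" "\<And>x. 0 \<le> x \<Longrightarrow> 0 \<le> h x" "\<And>x. 0 \<le> x \<Longrightarrow> h x \<le> 1"
    and \<alpha>: "0 \<le> \<alpha>" "\<alpha> \<le> 1" and xy: "0 \<le> x" "0 \<le> y"
  shows "\<bar>\<alpha> * descent c d \<theta> h y - \<alpha> * descent c d \<theta> h x\<bar> \<le> \<bar>x powr d - y powr d\<bar>"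
proof -
  have *: "\<bar>\<alpha> * descent c d \<theta> h y - \<alpha> * descent c d \<theta> h x\<bar> \<le> \<bar>x powr d - y powr d\<bar>"
    if "0 \<le> x" "x \<le> y" for x y
  proof -
    have "0 \<le> descent c d \<theta> h y - descent c d \<theta> h x"
      "descent c d \<theta> h y - descent c d \<theta> h x \<le> y powr d - x powr d"
      using descent_increment[OF h that] by auto
    then have "\<alpha> * (descent c d \<theta> h y - descent c d \<theta> h x) \<le> 1 * (y powr d - x powr d)"
      "0 \<le> \<alpha> * (descent c d \<theta> h y - descent c d \<theta> h x)"
      using \<alpha> by (intro mult_mono mult_nonneg_nonneg; simp)+
    then show ?thesis by (simp add: algebra_simps)
  qed
  show ?thesis
    using *[OF xy(1), of y] *[OF xy(2), of x] by (cases "x \<le> y") (auto simp: abs_minus_commute)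
qed

text \<open>The slope of the descent is \<open>d x\<^sup>d\<^sup>-\<^sup>1\<^sup>-\<^sup>c\<^sup>\<theta>\<close> times a power of the mass, and the mass does not decrease.
  So beyond \<open>r\<close> the descent grows at least like the \<open>p\<close>-harmonic function with the same flux at
  \<open>r\<close>.\<close>

lemma descent_increment_lower:
  assumes h: "continuous_on {0..} h" "\<And>x. 0 \<le> x \<Longrightarrow> 0 \<le> h x" "\<And>x. 0 \<le> x \<Longrightarrow> h x \<le> 1"
    and r: "0 < r" "r \<le> \<rho>"
  shows "d / (c * \<theta> - d) * mass c h r powr \<theta> * (r powr (d - c * \<theta>) - \<rho> powr (d - c * \<theta>))
    \<le> descent c d \<theta> h \<rho> - descent c d \<theta> h r"
proof -
  let ?A = "c * \<theta> - d" and ?K = "mass c h r powr \<theta>"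
  let ?f = "\<lambda>x. descent c d \<theta> h x + d / ?A * ?K * x powr (- ?A)"
  have A: "?A > 0" using decay_pos by simp
  have "?f r \<le> ?f \<rho>"
  proof (rule DERIV_nonneg_imp_nondecreasing[OF r(2)])
    fix x assume x: "r \<le> x" "x \<le> \<rho>"
    have x0: "0 < x" using x r by simp
    have mean0: "0 \<le> radial_mean c h x" using mean_bounds[of h x 0] h x0 by auto
    have "d * x powr (d - 1) * radial_mean c h x powr \<theta> = d * x powr (- ?A - 1) * mass c h x powr \<theta>"
      using mean_powr_eq_mass[OF mean0 x0] by (simp add: powr_add[symmetric] mult_ac algebra_simps)
    moreover have "?K \<le> mass c h x powr \<theta>"
      using mass_increment(1)[OF h, of r x] mass_increment(1)[OF h, of 0 r] r x theta_pos
      by (intro powr_mono2) auto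
    moreover have "0 \<le> d * x powr (- ?A - 1)" using d_pos by simp
    ultimately have ge: "d * x powr (- ?A - 1) * ?K \<le> d * x powr (d - 1) * radial_mean c h x powr \<theta>"
      using mult_left_mono by metis
    have "(?f has_real_derivative d * x powr (d - 1) * radial_mean c h x powr \<theta>
        + d / ?A * ?K * (- ?A * x powr (- ?A - 1))) (at x)"
      using h x0 by (intro DERIV_add DERIV_cmult has_real_derivative_powr has_real_derivative_descent) auto
    moreover have "d / ?A * ?K * (- ?A * x powr (- ?A - 1)) = - (d * x powr (- ?A - 1) * ?K)"
      using A by (simp add: field_simps)
    ultimately have "(?f has_real_derivative d * x powr (d - 1) * radial_mean c h x powr \<theta>
        + - (d * x powr (- ?A - 1) * ?K)) (at x)" by (simp only:)
    then show "\<exists>y. (?f has_real_derivative y) (at x) \<and> 0 \<le> y"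
      using ge by (intro exI conjI) auto
  qed
  then show ?thesis by (simp add: algebra_simps)
qed

lemma exit_function_0: "exit_function c d \<theta> \<eta> h 0 = 0"
  by (simp add: exit_function_def)

lemma exit_function_bounds:
  assumes h: "continuous_on {0..} h" "\<And>x. 0 \<le> x \<Longrightarrow> 0 \<le> h x" "\<And>x. 0 \<le> x \<Longrightarrow> h x \<le> 1"
    and \<eta>: "0 \<le> \<eta>" and r: "0 \<le> r"
  shows "descent c d \<theta> h r \<le> exit_function c d \<theta> \<eta> h r"
    "exit_function c d \<theta> \<eta> h r \<le> (1 + \<eta> * d) * r powr d"
proof -
  have "radial_mean c h r powr \<theta> \<le> 1"
    using mean_bounds[of h r 0] h r theta_pos powr_mono2[of \<theta> "radial_mean c h r" 1] by auto
  then have "\<eta> * (d * r powr d * radial_mean c h r powr \<theta>) \<le> \<eta> * (d * r powr d * 1)"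
    using \<eta> d_pos by (intro mult_left_mono) auto
  moreover have "descent c d \<theta> h r \<le> r powr d"
    using descent_increment(2)[OF h, of 0 r] r by simp
  ultimately show "exit_function c d \<theta> \<eta> h r \<le> (1 + \<eta> * d) * r powr d"
    unfolding exit_function_def by (simp add: algebra_simps)
  show "descent c d \<theta> h r \<le> exit_function c d \<theta> \<eta> h r"
    unfolding exit_function_def using \<eta> d_pos by simp
qed

lemma descent_lower:
  assumes h: "continuous_on {0..} h" "\<And>x. 0 \<le> x \<Longrightarrow> lo \<le> h x" "\<And>x. 0 \<le> x \<Longrightarrow> h x \<le> 1"
    and r: "0 \<le> r" and lo: "0 < lo"
  shows "lo powr \<theta> * r powr d \<le> descent c d \<theta> h r"
proof -
  have h0: "0 \<le> h x" if "0 \<le> x" for x using h(2)[OF that] lo by simp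
  have "lo powr \<theta> \<le> radial_mean d (\<lambda>x. radial_mean c h x powr \<theta>) r"
  proof (rule radial_mean_bounds(1)[OF d_pos mean_powr_continuous[OF h(1) h0 h(3)] r])
    show "lo powr \<theta> \<le> radial_mean c h x powr \<theta>" if "0 \<le> x" "x \<le> r" for x
      using mean_bounds[OF h(1) that(1), of lo] h lo theta_pos by (intro powr_mono2) auto
    show "radial_mean c h x powr \<theta> \<le> 1" if "0 \<le> x" "x \<le> r" for x
      using mean_bounds[of h x 0] h h0 that theta_pos powr_mono2[of \<theta> "radial_mean c h x" 1] by auto
  qed
  from mult_left_mono[OF this, of "r powr d"] show ?thesis
    by (simp add: descent_def mult.commute)
qed

text \<open>The derivative is \<open>(1 - \<eta> (c \<theta> - d)) P + \<eta> Q\<close> with \<open>P\<close> the slope of the descent and \<open>Q\<close> coming from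
  the growth of the mass, both positive.\<close>

lemma exit_function_strict_increasing:
  assumes h: "continuous_on {0..} h" "\<And>x. 0 \<le> x \<Longrightarrow> lo \<le> h x" "\<And>x. 0 \<le> x \<Longrightarrow> h x \<le> 1"
    and lo: "0 < lo" and \<eta>: "0 \<le> \<eta>" "\<eta> * (c * \<theta> - d) \<le> 1" and r: "0 < r" "r < r'"
  shows "exit_function c d \<theta> \<eta> h r < exit_function c d \<theta> \<eta> h r'"
proof -
  let ?A = "c * \<theta> - d"
  have h0: "0 \<le> h x" if "0 \<le> x" for x using h(2)[OF that] lo by simp
  let ?g = "\<lambda>x. descent c d \<theta> h x + \<eta> * (d * (x powr (- ?A) * mass c h x powr \<theta>))"
  have eq: "exit_function c d \<theta> \<eta> h x = ?g x" if "0 < x" for x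
  proof -
    have "0 \<le> radial_mean c h x" using mean_bounds[of h x 0] h h0 that by auto
    from mean_powr_eq_mass[OF this that] show ?thesis
      by (simp add: exit_function_def powr_add[symmetric] mult.assoc[symmetric])
  qed
  have "?g r < ?g r'"
  proof (rule DERIV_pos_imp_increasing[OF r(2)])
    fix x assume x: "r \<le> x" "x \<le> r'"
    have x0: "0 < x" using x r by simp
    have mean0: "0 \<le> radial_mean c h x" using mean_bounds[of h x 0] h h0 x0 by auto
    have M: "0 < mass c h x" using mass_pos[OF h x0 lo] .
    have hx: "0 < h x" using h(2)[of x] x0 lo by simp
    define F where "F = mass c h x"
    have e1: "d * x powr (d - 1) * radial_mean c h x powr \<theta> = d * x powr (- ?A - 1) * F powr \<theta>"
      unfolding F_def using mean_powr_eq_mass[OF mean0 x0]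
      by (simp add: powr_add[symmetric] mult_ac algebra_simps)
    have D1: "(descent c d \<theta> h has_real_derivative d * x powr (- ?A - 1) * F powr \<theta>) (at x)"
      using has_real_derivative_descent[OF h(1) h0 h(3) x0] e1 by simp
    have D2: "((\<lambda>x. mass c h x powr \<theta>) has_real_derivative
         (\<theta> * F powr (\<theta> - 1)) * (c * x powr (c - 1) * h x)) (at x)"
      unfolding F_def
      by (rule DERIV_chain2[where f = "\<lambda>z. z powr \<theta>",
            OF has_real_derivative_powr[OF M] has_real_derivative_mass[OF h(1) x0]])
    have D: "(?g has_real_derivative d * x powr (- ?A - 1) * F powr \<theta> +
        \<eta> * (d * ((- ?A * x powr (- ?A - 1)) * F powr \<theta>
          + ((\<theta> * F powr (\<theta> - 1)) * (c * x powr (c - 1) * h x)) * x powr (- ?A)))) (at x)"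
      unfolding F_def
      by (intro DERIV_add D1[unfolded F_def] DERIV_cmult DERIV_mult D2[unfolded F_def]
            has_real_derivative_powr[OF x0])
    define P where "P = d * x powr (- ?A - 1) * F powr \<theta>"
    define Q where "Q = d * (((\<theta> * F powr (\<theta> - 1)) * (c * x powr (c - 1) * h x)) * x powr (- ?A))"
    have P: "P > 0" unfolding P_def F_def using d_pos x0 M by simp
    have Q: "Q > 0" unfolding Q_def F_def using d_pos x0 M hx theta_pos c_pos by simp
    have "d * x powr (- ?A - 1) * F powr \<theta> +
        \<eta> * (d * ((- ?A * x powr (- ?A - 1)) * F powr \<theta>
          + ((\<theta> * F powr (\<theta> - 1)) * (c * x powr (c - 1) * h x)) * x powr (- ?A)))
       = (1 - \<eta> * ?A) * P + \<eta> * Q" (is "?d = _")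
      unfolding P_def Q_def by (simp add: algebra_simps)
    moreover have "(1 - \<eta> * ?A) * P + \<eta> * Q > 0"
    proof (cases "\<eta> = 0")
      case True then show ?thesis using P by simp
    next
      case False
      then have "\<eta> * Q > 0" using \<eta> Q by simp
      then show ?thesis using \<eta> P by (simp add: add_nonneg_pos)
    qed
    ultimately have "?d > 0" by simp
    with D show "\<exists>y. (?g has_real_derivative y) (at x) \<and> 0 < y" by blast
  qed
  then show ?thesis using eq r by simp
qed

lemma exit_function_unbounded:
  assumes h: "continuous_on {0..} h" "\<And>x. 0 \<le> x \<Longrightarrow> lo \<le> h x" "\<And>x. 0 \<le> x \<Longrightarrow> h x \<le> 1"
    and lo: "0 < lo" and \<eta>: "0 \<le> \<eta>"
  shows "\<exists>r>0. M < exit_function c d \<theta> \<eta> h r"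
proof -
  define r where "r = ((\<bar>M\<bar> + 1) / lo powr \<theta>) powr (1 / d)"
  have h0: "0 \<le> h x" if "0 \<le> x" for x using h(2)[OF that] lo by simp
  have "0 < r" using lo by (simp add: r_def)
  moreover have "lo powr \<theta> * r powr d = \<bar>M\<bar> + 1"
    using lo d_pos by (simp add: r_def powr_powr)
  then have "\<bar>M\<bar> + 1 \<le> exit_function c d \<theta> \<eta> h r"
    using descent_lower[OF h _ lo, of r] exit_function_bounds(1)[OF h(1) h0 h(3) \<eta>, of r] \<open>0 < r\<close>
    by simp
  ultimately show ?thesis by (intro exI[of _ r]) auto
qed

lemma mean_tendsto:
  assumes r: "0 \<le> r" and h: "\<And>n. continuous_on {0..} (h n)"
    and bnd: "\<And>n x. 0 \<le> x \<Longrightarrow> 0 \<le> h n x" "\<And>n x. 0 \<le> x \<Longrightarrow> h n x \<le> 1"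
    and lim: "\<And>x. 0 \<le> x \<Longrightarrow> x \<le> r \<Longrightarrow> (\<lambda>n. h n x) \<longlonglongrightarrow> g x"
  shows "(\<lambda>n. radial_mean c (h n) r) \<longlonglongrightarrow> radial_mean c g r"
  by (rule radial_mean_tendsto[OF c_pos r, where B = 1])
     (use assms continuous_on_subset[OF h, of "{0..r}"] in auto)

lemma descent_tendsto:
  assumes r: "0 \<le> r" and h: "\<And>n. continuous_on {0..} (h n)"
    and bnd: "\<And>n x. 0 \<le> x \<Longrightarrow> 0 \<le> h n x" "\<And>n x. 0 \<le> x \<Longrightarrow> h n x \<le> 1"
    and lim: "\<And>x. 0 \<le> x \<Longrightarrow> x \<le> r \<Longrightarrow> (\<lambda>n. h n x) \<longlonglongrightarrow> g x"
  shows "(\<lambda>n. descent c d \<theta> (h n) r) \<longlonglongrightarrow> descent c d \<theta> g r"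
proof -
  have mb: "0 \<le> radial_mean c (h n) x" "radial_mean c (h n) x \<le> 1" if "0 \<le> x" for n x
    using mean_bounds[of "h n" x 0] h bnd that by auto
  have "(\<lambda>n. radial_mean d (\<lambda>x. radial_mean c (h n) x powr \<theta>) r)
      \<longlonglongrightarrow> radial_mean d (\<lambda>x. radial_mean c g x powr \<theta>) r"
  proof (rule radial_mean_tendsto[OF d_pos r, where B = 1])
    show "continuous_on {0..r} (\<lambda>x. radial_mean c (h n) x powr \<theta>)" for n
      by (rule mean_powr_continuous) (use h bnd in auto)
    show "\<bar>radial_mean c (h n) x powr \<theta>\<bar> \<le> 1" if "0 \<le> x" "x \<le> r" for n x
      using mb[OF that(1), of n] theta_pos powr_mono2[of \<theta> "radial_mean c (h n) x" 1] by simp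
    show "(\<lambda>n. radial_mean c (h n) x powr \<theta>) \<longlonglongrightarrow> radial_mean c g x powr \<theta>"
      if x: "0 \<le> x" "x \<le> r" for x
    proof (rule tendsto_powr'[OF mean_tendsto[OF x(1) h bnd] tendsto_const])
      show "(\<lambda>n. h n y) \<longlonglongrightarrow> g y" if "0 \<le> y" "y \<le> x" for y using lim that x by simp
    qed (use theta_pos mb[OF x(1)] in auto)
  qed
  then show ?thesis unfolding descent_def by (rule tendsto_mult_left)
qed

end

section \<open>Simultaneous exit of a truncated and delayed system\<close>

lemma continuous_on_nonneg_reals:
  fixes f :: "real \<Rightarrow> real"
  assumes "\<And>R. continuous_on {0..R} f"
  shows "continuous_on {0..} f"
  unfolding continuous_on_eq_continuous_within
proof
  fix x :: real assume "x \<in> {0..}"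
  have "at x within {0..} = at x within {0..x + 1}"
    by (rule at_within_nhd[of x "{..<x + 1}"]) auto
  then show "continuous (at x within {0..}) f"
    using assms[of "x + 1"] \<open>x \<in> {0..}\<close> by (simp add: continuous_on_eq_continuous_within)
qed

lemma continuous_on_slice:
  fixes F :: "real \<Rightarrow> real \<Rightarrow> real"
  assumes F: "continuous_on ({0..1} \<times> {0..R}) (\<lambda>(k, r). F k r)"
  shows "k \<in> {0..1} \<Longrightarrow> continuous_on {0..R} (F k)"
    "0 \<le> r \<Longrightarrow> r \<le> R \<Longrightarrow> continuous_on {0..1} (\<lambda>k. F k r)"
proof -
  assume "k \<in> {0..1}"
  then have "continuous_on {0..R} (\<lambda>r. (\<lambda>(k, r). F k r) (k, r))"
    by (intro continuous_on_compose2[OF F]) (auto intro!: continuous_intros)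
  then show "continuous_on {0..R} (F k)" by simp
next
  assume "0 \<le> r" "r \<le> R"
  then have "continuous_on {0..1} (\<lambda>k. (\<lambda>(k, r). F k r) (k, r))"
    by (intro continuous_on_compose2[OF F]) (auto intro!: continuous_intros)
  then show "continuous_on {0..1} (\<lambda>k. F k r)" by simp
qed

text \<open>If the curves \<open>(1 - k) p\<close> and \<open>k q\<close> never reached \<open>1\<close> at the same radius, then \<open>[0,1]\<close> would be the
  disjoint union of the relatively open sets \<open>U\<close> and \<open>V\<close> of parameters for which the first,
  respectively the second, is the earlier to pass \<open>1\<close>; these contain \<open>0\<close> and \<open>1\<close>.\<close>

lemma simultaneous_crossing:
  fixes p q :: "real \<Rightarrow> real \<Rightarrow> real"
  assumes cont_k: "\<And>r. 0 < r \<Longrightarrow> continuous_on {0..1} (\<lambda>k. p k r)"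
      "\<And>r. 0 < r \<Longrightarrow> continuous_on {0..1} (\<lambda>k. q k r)"
    and cont_r: "\<And>k R. k \<in> {0..1} \<Longrightarrow> continuous_on {0..R} (p k)"
      "\<And>k R. k \<in> {0..1} \<Longrightarrow> continuous_on {0..R} (q k)"
    and zero: "\<And>k. k \<in> {0..1} \<Longrightarrow> p k 0 = 0" "\<And>k. k \<in> {0..1} \<Longrightarrow> q k 0 = 0"
    and strict: "\<And>k r r'. k \<in> {0..1} \<Longrightarrow> 0 < r \<Longrightarrow> r < r' \<Longrightarrow> p k r < p k r'"
      "\<And>k r r'. k \<in> {0..1} \<Longrightarrow> 0 < r \<Longrightarrow> r < r' \<Longrightarrow> q k r < q k r'"
    and unbounded: "\<And>k M. k \<in> {0..1} \<Longrightarrow> \<exists>r>0. M < p k r" "\<And>k M. k \<in> {0..1} \<Longrightarrow> \<exists>r>0. M < q k r"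
  obtains k \<rho> where "0 < k" "k < 1" "0 < \<rho>" "(1 - k) * p k \<rho> = 1" "k * q k \<rho> = 1"
proof -
  define U where "U = (\<Union>r\<in>{0<..}. ({0..1} \<inter> (\<lambda>k. (1 - k) * p k r) -` {1<..}) \<inter>
                                    ({0..1} \<inter> (\<lambda>k. k * q k r) -` {..<1}))"
  define V where "V = (\<Union>r\<in>{0<..}. ({0..1} \<inter> (\<lambda>k. (1 - k) * p k r) -` {..<1}) \<inter>
                                    ({0..1} \<inter> (\<lambda>k. k * q k r) -` {1<..}))"
  have cP: "continuous_on {0..1} (\<lambda>k. (1 - k) * p k r)" if "0 < r" for r
    by (intro continuous_intros cont_k that)
  have cQ: "continuous_on {0..1} (\<lambda>k. k * q k r)" if "0 < r" for r
    by (intro continuous_intros cont_k that)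
  have opU: "openin (top_of_set {0..1}) U"
    unfolding U_def
    by (intro openin_Union ballI openin_Int)
       (auto intro!: continuous_openin_preimage_gen cP cQ)
  have opV: "openin (top_of_set {0..1}) V"
    unfolding V_def
    by (intro openin_Union ballI openin_Int)
       (auto intro!: continuous_openin_preimage_gen cP cQ)
  have "0 \<in> U" using unbounded(1)[of 0 1] unfolding U_def by auto
  moreover have "1 \<in> V" using unbounded(2)[of 1 1] unfolding V_def by auto
  moreover have "U \<inter> V = {}"
  proof (rule ccontr)
    assume "U \<inter> V \<noteq> {}"
    then obtain k where "k \<in> U" "k \<in> V" by blast
    then obtain r r' where k: "k \<in> {0..1}" and r: "0 < r" "0 < r'"
      and 1: "(1 - k) * p k r > 1" "k * q k r < 1" and 2: "(1 - k) * p k r' < 1" "k * q k r' > 1"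
      unfolding U_def V_def by blast
    have mP: "(1 - k) * p k x \<le> (1 - k) * p k y" if "0 < x" "x \<le> y" for x y
      using strict(1)[OF k that(1), of y] that k by (cases "x = y") (auto intro!: mult_left_mono)
    have mQ: "k * q k x \<le> k * q k y" if "0 < x" "x \<le> y" for x y
      using strict(2)[OF k that(1), of y] that k by (cases "x = y") (auto intro!: mult_left_mono)
    show False
      using mP[OF r(1), of r'] mQ[OF r(2), of r] 1 2 by linarith
  qed
  moreover have "connected {0..1::real}" by simp
  ultimately have "\<not> {0..1} \<subseteq> U \<union> V"
    using opU opV unfolding connected_openin by auto
  then obtain k where k: "k \<in> {0..1}" "k \<notin> U" "k \<notin> V" by blast
  have "k \<noteq> 0" "k \<noteq> 1" using \<open>0 \<in> U\<close> \<open>1 \<in> V\<close> k by auto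
  then have k01: "0 < k" "k < 1" using k by auto
  obtain r1 where r1: "0 < r1" "1 / (1 - k) < p k r1" using unbounded(1)[OF k(1)] by blast
  have "\<exists>x. 0 \<le> x \<and> x \<le> r1 \<and> p k x = 1 / (1 - k)"
    using r1 zero(1)[OF k(1)] k01 cont_r(1)[OF k(1)] by (intro IVT') auto
  then obtain \<rho> where rho: "0 \<le> \<rho>" "p k \<rho> = 1 / (1 - k)" by blast
  have rho0: "0 < \<rho>" using rho zero(1)[OF k(1)] k01 by (cases "\<rho> = 0") auto
  have P1: "(1 - k) * p k \<rho> = 1" using rho k01 by simp
  have "k * q k \<rho> = 1"
  proof (cases "k * q k \<rho>" "1 :: real" rule: linorder_cases)
    case less
    have "isCont (\<lambda>r. k * q k r) \<rho>"
      using cont_r(2)[OF k(1), of "\<rho> + 1"] rho0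
      by (intro continuous_intros continuous_on_interior[of "{0..\<rho> + 1}"])
         (auto simp: interior_atLeastAtMost_real)
    then have "eventually (\<lambda>r. k * q k r < 1) (at \<rho>)"
      using less by (auto simp: isCont_def intro: order_tendstoD)
    then obtain e where e: "e > 0" "\<And>r. r \<noteq> \<rho> \<Longrightarrow> dist r \<rho> < e \<Longrightarrow> k * q k r < 1"
      by (auto simp: eventually_at)
    have "k * q k (\<rho> + e/2) < 1" using e by (auto simp: dist_real_def)
    moreover have "(1 - k) * p k (\<rho> + e/2) > 1"
      using strict(1)[OF k(1) rho0, of "\<rho> + e/2"] e P1 k01
      by (metis add_strict_left_mono add.right_neutral diff_gt_0_iff_gt half_gt_zero mult_strict_left_mono)
    ultimately have "k \<in> U" unfolding U_def using k(1) rho0 e(1)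
      by (intro UN_I[of "\<rho> + e/2"]) auto
    with k show ?thesis by simp
  next
    case greater
    have "isCont (\<lambda>r. k * q k r) \<rho>"
      using cont_r(2)[OF k(1), of "\<rho> + 1"] rho0
      by (intro continuous_intros continuous_on_interior[of "{0..\<rho> + 1}"])
         (auto simp: interior_atLeastAtMost_real)
    then have "eventually (\<lambda>r. k * q k r > 1) (at \<rho>)"
      using greater by (auto simp: isCont_def intro: order_tendstoD)
    then obtain e where e: "e > 0" "\<And>r. r \<noteq> \<rho> \<Longrightarrow> dist r \<rho> < e \<Longrightarrow> k * q k r > 1"
      by (auto simp: eventually_at)
    define x where "x = max (\<rho> - e/2) (\<rho>/2)"
    have x: "0 < x" "x < \<rho>" "dist x \<rho> < e" using rho0 e unfolding x_def by (auto simp: dist_real_def)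
    have "k * q k x > 1" using e x by auto
    moreover have "(1 - k) * p k x < 1"
      using strict(1)[OF k(1) x(1,2)] P1 k01 by (metis diff_gt_0_iff_gt mult_strict_left_mono)
    ultimately have "k \<in> V" unfolding V_def using k(1) x
      by (intro UN_I[of x]) auto
    with k show ?thesis by simp
  qed
  with that k01 rho0 P1 show thesis by blast
qed

text \<open>The delay makes the values on \<open>[\<tau> n, \<tau> (n + 1)]\<close> explicit in terms of those on \<open>[0, \<tau> n]\<close>, and
  the bound \<open>\<epsilon>\<close> from below keeps the source positive and continuous when a component vanishes.\<close>

definition delayed_source ::
  "real \<Rightarrow> real \<Rightarrow> real \<Rightarrow> real \<Rightarrow> (real \<Rightarrow> real) \<Rightarrow> (real \<Rightarrow> real) \<Rightarrow> real \<Rightarrow> real" where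
  "delayed_source \<epsilon> \<tau> s \<delta> f g r =
     max \<epsilon> (f (max 0 (r - \<tau>))) powr s * max \<epsilon> (g (max 0 (r - \<tau>))) powr \<delta>"

lemma delayed_source_bounds:
  assumes "0 < \<epsilon>" "\<epsilon> \<le> 1" "s \<ge> 0" "\<delta> \<ge> 0" "0 \<le> \<tau>"
    "\<And>x. 0 \<le> x \<Longrightarrow> f x \<le> 1" "\<And>x. 0 \<le> x \<Longrightarrow> g x \<le> 1"
  shows "\<epsilon> powr s * \<epsilon> powr \<delta> \<le> delayed_source \<epsilon> \<tau> s \<delta> f g r" "delayed_source \<epsilon> \<tau> s \<delta> f g r \<le> 1"
proof -
  show "\<epsilon> powr s * \<epsilon> powr \<delta> \<le> delayed_source \<epsilon> \<tau> s \<delta> f g r"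
    unfolding delayed_source_def using assms by (intro mult_mono powr_mono2) auto
  have "delayed_source \<epsilon> \<tau> s \<delta> f g r \<le> 1 powr s * 1 powr \<delta>"
    unfolding delayed_source_def using assms by (intro mult_mono powr_mono2) auto
  then show "delayed_source \<epsilon> \<tau> s \<delta> f g r \<le> 1" by simp
qed

lemma continuous_on_delayed_source_param:
  fixes f g :: "'a::topological_space \<Rightarrow> real \<Rightarrow> real"
  assumes "0 < \<epsilon>" "0 \<le> \<tau>"
    and f: "continuous_on (S \<times> {0..R}) (\<lambda>(k, r). f k r)"
    and g: "continuous_on (S \<times> {0..R}) (\<lambda>(k, r). g k r)"
  shows "continuous_on (S \<times> {0..R}) (\<lambda>(k, r). delayed_source \<epsilon> \<tau> s \<delta> (f k) (g k) r)"
proof -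
  have *: "continuous_on (S \<times> {0..R}) (\<lambda>z. F (fst z) (max 0 (snd z - \<tau>)))"
    if F: "continuous_on (S \<times> {0..R}) (\<lambda>(k, r). F k r)" for F :: "'a \<Rightarrow> real \<Rightarrow> real"
  proof -
    have "continuous_on (S \<times> {0..R}) (\<lambda>z. (\<lambda>(k, r). F k r) (fst z, max 0 (snd z - \<tau>)))"
      by (rule continuous_on_compose2[OF F])
         (use \<open>0 \<le> \<tau>\<close> in \<open>auto intro!: continuous_intros\<close>)
    then show ?thesis by simp
  qed
  have "continuous_on (S \<times> {0..R}) (\<lambda>z. max \<epsilon> (f (fst z) (max 0 (snd z - \<tau>))) powr s
       * max \<epsilon> (g (fst z) (max 0 (snd z - \<tau>))) powr \<delta>)"
    using \<open>0 < \<epsilon>\<close>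
    by (intro continuous_on_mult continuous_on_powr continuous_on_max continuous_on_const * f g) auto
  then show ?thesis by (simp add: delayed_source_def split_beta)
qed

abbreviation source :: "real \<Rightarrow> real \<Rightarrow> (real \<Rightarrow> real) \<Rightarrow> (real \<Rightarrow> real) \<Rightarrow> real \<Rightarrow> real" where
  "source s \<delta> f g \<equiv> \<lambda>x. f x powr s * g x powr \<delta>"

locale radial_pair =
  X: radial_exponents c1 d1 \<theta>1 + Y: radial_exponents c2 d2 \<theta>2
  for c1 d1 \<theta>1 c2 d2 \<theta>2 :: real +
  fixes s m \<delta> \<mu> :: real
  assumes exponents_nonneg: "0 \<le> s" "0 \<le> m" "0 \<le> \<delta>" "0 \<le> \<mu>"

locale delayed_pair = radial_pair +
  fixes \<epsilon> \<tau> :: real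
  assumes eps: "0 < \<epsilon>" "\<epsilon> \<le> 1" and tau: "0 < \<tau>"
begin

abbreviation "source_u f g \<equiv> delayed_source \<epsilon> \<tau> s \<delta> f g"
abbreviation "source_v f g \<equiv> delayed_source \<epsilon> \<tau> \<mu> m f g"

definition step :: "real \<Rightarrow> (real \<Rightarrow> real) \<times> (real \<Rightarrow> real) \<Rightarrow> (real \<Rightarrow> real) \<times> (real \<Rightarrow> real)" where
  "step k w = (\<lambda>r. 1 - (1 - k) * descent c1 d1 \<theta>1 (source_u (fst w) (snd w)) r,
               \<lambda>r. 1 - k * descent c2 d2 \<theta>2 (source_v (fst w) (snd w)) r)"

definition iter :: "nat \<Rightarrow> real \<Rightarrow> (real \<Rightarrow> real) \<times> (real \<Rightarrow> real)" where
  "iter n k = (step k ^^ n) (\<lambda>_. 1, \<lambda>_. 1)"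

lemma iter_0: "iter 0 k = (\<lambda>_. 1, \<lambda>_. 1)" and iter_Suc: "iter (Suc n) k = step k (iter n k)"
  by (simp_all add: iter_def)

lemma source_nonneg: "0 \<le> delayed_source \<epsilon> \<tau> a b f g r"
  by (simp add: delayed_source_def)

lemma source_continuous:
  assumes f: "continuous_on {0..} f" and g: "continuous_on {0..} g"
  shows "continuous_on {0..} (delayed_source \<epsilon> \<tau> a b f g)"
proof -
  have *: "continuous_on {0..} (\<lambda>r. F (max 0 (r - \<tau>)))"
    if F: "continuous_on {0..} F" for F :: "real \<Rightarrow> real"
    by (rule continuous_on_compose2[OF F]) (auto intro!: continuous_intros)
  show ?thesis unfolding delayed_source_def using eps
    by (intro continuous_on_mult continuous_on_powr continuous_on_max continuous_on_const * f g) auto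
qed

lemma iter_joint_continuous:
  "continuous_on ({0..1} \<times> {0..R}) (\<lambda>(k, r). fst (iter n k) r) \<and>
   continuous_on ({0..1} \<times> {0..R}) (\<lambda>(k, r). snd (iter n k) r)"
proof (induction n)
  case 0
  show ?case by (simp add: iter_0 split_beta)
next
  case (Suc n)
  have fst_cont: "continuous_on ({0..1} \<times> {0..R}) (\<lambda>z::real \<times> real. fst z)"
    by (rule continuous_on_fst[OF continuous_on_id])
  have "continuous_on ({0..1} \<times> {0..R})
      (\<lambda>(k, r). descent c1 d1 \<theta>1 (source_u (fst (iter n k)) (snd (iter n k))) r)"
    by (rule X.continuous_on_descent_param
          [OF continuous_on_delayed_source_param[OF eps(1) less_imp_le[OF tau]] source_nonneg])
       (use Suc in auto)
  then have 1: "continuous_on ({0..1} \<times> {0..R}) (\<lambda>z. 1 - (1 - fst z) *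
      (\<lambda>(k, r). descent c1 d1 \<theta>1 (source_u (fst (iter n k)) (snd (iter n k))) r) z)"
    by (intro continuous_on_diff continuous_on_mult continuous_on_const fst_cont)
  have "continuous_on ({0..1} \<times> {0..R})
      (\<lambda>(k, r). descent c2 d2 \<theta>2 (source_v (fst (iter n k)) (snd (iter n k))) r)"
    by (rule Y.continuous_on_descent_param
          [OF continuous_on_delayed_source_param[OF eps(1) less_imp_le[OF tau]] source_nonneg])
       (use Suc in auto)
  then have 2: "continuous_on ({0..1} \<times> {0..R}) (\<lambda>z. 1 - fst z *
      (\<lambda>(k, r). descent c2 d2 \<theta>2 (source_v (fst (iter n k)) (snd (iter n k))) r) z)"
    by (intro continuous_on_diff continuous_on_mult continuous_on_const fst_cont)
  show ?case using 1 2 by (simp add: iter_Suc step_def split_beta)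
qed

text \<open>With each iteration the profiles become final on a further interval of length \<open>\<tau>\<close>, because
  the new value at \<open>r\<close> depends only on old values up to \<open>r - \<tau>\<close>.\<close>

lemma iter_stable:
  "0 \<le> r \<Longrightarrow> r \<le> real n * \<tau> \<Longrightarrow>
   fst (iter (Suc n) k) r = fst (iter n k) r \<and> snd (iter (Suc n) k) r = snd (iter n k) r"
proof (induction n arbitrary: r)
  case 0
  then have "r = 0" by simp
  then show ?case by (simp add: iter_Suc step_def iter_0)
next
  case (Suc n)
  have "delayed_source \<epsilon> \<tau> a b (fst (iter (Suc n) k)) (snd (iter (Suc n) k)) x
      = delayed_source \<epsilon> \<tau> a b (fst (iter n k)) (snd (iter n k)) x"
    if "0 \<le> x" "x \<le> r" for a b x
  proof -
    have "max 0 (x - \<tau>) \<le> real n * \<tau>"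
      using Suc.prems that tau by (auto simp: algebra_simps)
    then show ?thesis using Suc.IH[of "max 0 (x - \<tau>)"] by (simp add: delayed_source_def)
  qed
  then have
    "descent c1 d1 \<theta>1 (source_u (fst (iter (Suc n) k)) (snd (iter (Suc n) k))) r
      = descent c1 d1 \<theta>1 (source_u (fst (iter n k)) (snd (iter n k))) r"
    "descent c2 d2 \<theta>2 (source_v (fst (iter (Suc n) k)) (snd (iter (Suc n) k))) r
      = descent c2 d2 \<theta>2 (source_v (fst (iter n k)) (snd (iter n k))) r"
    by (intro X.descent_cong[OF Suc.prems(1)] Y.descent_cong[OF Suc.prems(1)]; simp)+
  moreover have "fst (step k w) r = 1 - (1 - k) * descent c1 d1 \<theta>1 (source_u (fst w) (snd w)) r"
    "snd (step k w) r = 1 - k * descent c2 d2 \<theta>2 (source_v (fst w) (snd w)) r" for w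
    by (simp_all add: step_def)
  ultimately show ?case by (simp only: iter_Suc)
qed

lemma iter_stable_le:
  assumes "n \<le> n'" "0 \<le> r" "r \<le> real n * \<tau>"
  shows "fst (iter n' k) r = fst (iter n k) r \<and> snd (iter n' k) r = snd (iter n k) r"
  using assms(1)
proof (induction n' rule: dec_induct)
  case (step j)
  have "real n * \<tau> \<le> real j * \<tau>" using step tau by simp
  then show ?case using iter_stable[of r j k] step assms by auto
qed simp

text \<open>The value at \<open>r\<close> is taken from an iterate that is already final there.\<close>

definition delayed_u :: "real \<Rightarrow> real \<Rightarrow> real" where
  "delayed_u k r = fst (iter (nat \<lceil>r / \<tau>\<rceil>) k) r"

definition delayed_v :: "real \<Rightarrow> real \<Rightarrow> real" where
  "delayed_v k r = snd (iter (nat \<lceil>r / \<tau>\<rceil>) k) r"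

lemma delayed_eq_iter:
  assumes "0 \<le> r" "r \<le> real n * \<tau>"
  shows "delayed_u k r = fst (iter n k) r" "delayed_v k r = snd (iter n k) r"
proof -
  let ?n = "nat \<lceil>r / \<tau>\<rceil>"
  have "r / \<tau> \<le> real n" using assms tau by (simp add: field_simps)
  then have "?n \<le> n" by (simp add: ceiling_le_iff)
  moreover have "r / \<tau> \<le> real ?n" by linarith
  then have "r \<le> real ?n * \<tau>" using tau by (simp add: field_simps)
  ultimately show "delayed_u k r = fst (iter n k) r" "delayed_v k r = snd (iter n k) r"
    using iter_stable_le[of ?n n r k] assms by (auto simp: delayed_u_def delayed_v_def)
qed

lemma delayed_steps_exist: "\<exists>n. R \<le> real n * \<tau>"
  using reals_Archimedean3[OF tau] less_imp_le by blast

lemma delayed_joint_continuous: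
  "continuous_on ({0..1} \<times> {0..R}) (\<lambda>(k, r). delayed_u k r)"
  "continuous_on ({0..1} \<times> {0..R}) (\<lambda>(k, r). delayed_v k r)"
proof -
  obtain n where n: "R \<le> real n * \<tau>" using delayed_steps_exist by blast
  have eq: "delayed_u (fst z) (snd z) = fst (iter n (fst z)) (snd z)"
      "delayed_v (fst z) (snd z) = snd (iter n (fst z)) (snd z)" if "z \<in> {0..1} \<times> {0..R}" for z
    using that delayed_eq_iter[of "snd z" n "fst z"] n by auto
  show "continuous_on ({0..1} \<times> {0..R}) (\<lambda>(k, r). delayed_u k r)"
    by (rule continuous_on_eq[OF conjunct1[OF iter_joint_continuous[of R n]]])
       (simp add: split_beta eq)
  show "continuous_on ({0..1} \<times> {0..R}) (\<lambda>(k, r). delayed_v k r)"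
    by (rule continuous_on_eq[OF conjunct2[OF iter_joint_continuous[of R n]]])
       (simp add: split_beta eq)
qed

lemma delayed_solves:
  assumes "0 \<le> r"
  shows "delayed_u k r = 1 - (1 - k) * descent c1 d1 \<theta>1 (source_u (delayed_u k) (delayed_v k)) r"
    "delayed_v k r = 1 - k * descent c2 d2 \<theta>2 (source_v (delayed_u k) (delayed_v k)) r"
proof -
  obtain n where n: "r \<le> real n * \<tau>" using delayed_steps_exist by blast
  have src: "delayed_source \<epsilon> \<tau> a b (fst (iter n k)) (snd (iter n k)) x
      = delayed_source \<epsilon> \<tau> a b (delayed_u k) (delayed_v k) x"
    if "0 \<le> x" "x \<le> r" for a b x
    using delayed_eq_iter[of "max 0 (x - \<tau>)" n k] that n tau by (auto simp: delayed_source_def)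
  have "r \<le> real (Suc n) * \<tau>" using n tau by (simp add: algebra_simps)
  from delayed_eq_iter[OF assms this]
  show "delayed_u k r = 1 - (1 - k) * descent c1 d1 \<theta>1 (source_u (delayed_u k) (delayed_v k)) r"
    "delayed_v k r = 1 - k * descent c2 d2 \<theta>2 (source_v (delayed_u k) (delayed_v k)) r"
    using X.descent_cong[OF assms src] Y.descent_cong[OF assms src]
    by (simp_all add: iter_Suc step_def)
qed

end

context delayed_pair
begin

lemma delayed_le_1:
  assumes "k \<in> {0..1}" "0 \<le> r"
  shows "delayed_u k r \<le> 1" "delayed_v k r \<le> 1"
  using delayed_solves[OF assms(2), of k] X.descent_nonneg[OF assms(2)] Y.descent_nonneg[OF assms(2)] assms(1)
  by simp_all

lemma simultaneous_exit:
  assumes \<eta>: "0 \<le> \<eta>" "\<eta> * (c1 * \<theta>1 - d1) \<le> 1" and \<zeta>: "0 \<le> \<zeta>" "\<zeta> * (c2 * \<theta>2 - d2) \<le> 1"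
  obtains k \<rho> u v where "0 < k" "k < 1" "0 < \<rho>"
    "continuous_on {0..} u" "continuous_on {0..} v"
    "\<And>r. 0 \<le> r \<Longrightarrow> u r \<le> 1" "\<And>r. 0 \<le> r \<Longrightarrow> v r \<le> 1"
    "\<And>r. 0 \<le> r \<Longrightarrow> u r = 1 - (1 - k) * descent c1 d1 \<theta>1 (source_u u v) r"
    "\<And>r. 0 \<le> r \<Longrightarrow> v r = 1 - k * descent c2 d2 \<theta>2 (source_v u v) r"
    "(1 - k) * exit_function c1 d1 \<theta>1 \<eta> (source_u u v) \<rho> = 1"
    "k * exit_function c2 d2 \<theta>2 \<zeta> (source_v u v) \<rho> = 1"
proof -
  let ?hu = "\<lambda>k. source_u (delayed_u k) (delayed_v k)"
  let ?hv = "\<lambda>k. source_v (delayed_u k) (delayed_v k)"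
  have cont: "continuous_on {0..} (delayed_u k)" "continuous_on {0..} (delayed_v k)" if "k \<in> {0..1}" for k
    using continuous_on_slice(1)[OF delayed_joint_continuous(1) that]
      continuous_on_slice(1)[OF delayed_joint_continuous(2) that]
    by (auto intro!: continuous_on_nonneg_reals)
  have tau0: "0 \<le> \<tau>" using tau by simp
  have le1: "delayed_u k r \<le> 1" "delayed_v k r \<le> 1" if "k \<in> {0..1}" "0 \<le> r" for k r
    using delayed_le_1 that by blast+
  define a where "a = \<epsilon> powr s * \<epsilon> powr \<delta>"
  define b where "b = \<epsilon> powr \<mu> * \<epsilon> powr m"
  have ab: "0 < a" "0 < b" using eps by (auto simp: a_def b_def)
  have hu: "continuous_on {0..} (?hu k)" "\<And>x. 0 \<le> x \<Longrightarrow> a \<le> ?hu k x" "\<And>x. 0 \<le> x \<Longrightarrow> ?hu k x \<le> 1"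
    if "k \<in> {0..1}" for k
    using source_continuous[OF cont[OF that]] delayed_source_bounds[of \<epsilon> s \<delta> \<tau>] eps exponents_nonneg
      tau0 le1[OF that] unfolding a_def by blast+
  have hv: "continuous_on {0..} (?hv k)" "\<And>x. 0 \<le> x \<Longrightarrow> b \<le> ?hv k x" "\<And>x. 0 \<le> x \<Longrightarrow> ?hv k x \<le> 1"
    if "k \<in> {0..1}" for k
    using source_continuous[OF cont[OF that]] delayed_source_bounds[of \<epsilon> \<mu> m \<tau>] eps exponents_nonneg
      tau0 le1[OF that] unfolding b_def by blast+
  have pc: "continuous_on ({0..1} \<times> {0..R}) (\<lambda>(k, r). exit_function c1 d1 \<theta>1 \<eta> (?hu k) r)" for R
    by (rule X.continuous_on_exit_function_param[OF continuous_on_delayed_source_param[OF eps(1) tau0]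
          source_nonneg]) (rule delayed_joint_continuous)+
  have qc: "continuous_on ({0..1} \<times> {0..R}) (\<lambda>(k, r). exit_function c2 d2 \<theta>2 \<zeta> (?hv k) r)" for R
    by (rule Y.continuous_on_exit_function_param[OF continuous_on_delayed_source_param[OF eps(1) tau0]
          source_nonneg]) (rule delayed_joint_continuous)+
  obtain k \<rho> where k: "0 < k" "k < 1" and rho: "0 < \<rho>"
    and ex: "(1 - k) * exit_function c1 d1 \<theta>1 \<eta> (?hu k) \<rho> = 1"
      "k * exit_function c2 d2 \<theta>2 \<zeta> (?hv k) \<rho> = 1"
  proof (rule simultaneous_crossing[of "\<lambda>k. exit_function c1 d1 \<theta>1 \<eta> (?hu k)"
        "\<lambda>k. exit_function c2 d2 \<theta>2 \<zeta> (?hv k)"])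
    show "continuous_on {0..1} (\<lambda>k. exit_function c1 d1 \<theta>1 \<eta> (?hu k) r)" if "0 < r" for r
      by (rule continuous_on_slice(2)[OF pc, of r r]) (use that in auto)
    show "continuous_on {0..1} (\<lambda>k. exit_function c2 d2 \<theta>2 \<zeta> (?hv k) r)" if "0 < r" for r
      by (rule continuous_on_slice(2)[OF qc, of r r]) (use that in auto)
    show "continuous_on {0..R} (exit_function c1 d1 \<theta>1 \<eta> (?hu k))" if "k \<in> {0..1}" for k R
      by (rule continuous_on_slice(1)[OF pc that])
    show "continuous_on {0..R} (exit_function c2 d2 \<theta>2 \<zeta> (?hv k))" if "k \<in> {0..1}" for k R
      by (rule continuous_on_slice(1)[OF qc that])
    show "exit_function c1 d1 \<theta>1 \<eta> (?hu k) r < exit_function c1 d1 \<theta>1 \<eta> (?hu k) r'"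
      if "k \<in> {0..1}" "0 < r" "r < r'" for k r r'
      by (rule X.exit_function_strict_increasing[OF hu[OF that(1)] ab(1) \<eta> that(2,3)])
    show "exit_function c2 d2 \<theta>2 \<zeta> (?hv k) r < exit_function c2 d2 \<theta>2 \<zeta> (?hv k) r'"
      if "k \<in> {0..1}" "0 < r" "r < r'" for k r r'
      by (rule Y.exit_function_strict_increasing[OF hv[OF that(1)] ab(2) \<zeta> that(2,3)])
    show "\<exists>r>0. M < exit_function c1 d1 \<theta>1 \<eta> (?hu k) r" if "k \<in> {0..1}" for k M
      by (rule X.exit_function_unbounded[OF hu[OF that] ab(1) \<eta>(1)])
    show "\<exists>r>0. M < exit_function c2 d2 \<theta>2 \<zeta> (?hv k) r" if "k \<in> {0..1}" for k M
      by (rule Y.exit_function_unbounded[OF hv[OF that] ab(2) \<zeta>(1)])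
  qed (auto simp: X.exit_function_0 Y.exit_function_0)
  then show thesis
    using cont[of k] le1[of k] delayed_solves[of _ k] by (intro that[of k \<rho> "delayed_u k" "delayed_v k"]) auto
qed

end

section \<open>Passage to the limit\<close>

text \<open>Equicontinuity carries convergence from a dense set to all points; the common modulus is that
  of the single function \<open>\<phi>\<close>.\<close>

lemma convergent_from_rationals:
  fixes f :: "nat \<Rightarrow> real \<Rightarrow> real" and \<phi> :: "real \<Rightarrow> real"
  assumes modulus: "\<And>n x y. 0 \<le> x \<Longrightarrow> 0 \<le> y \<Longrightarrow> \<bar>f n x - f n y\<bar> \<le> \<bar>\<phi> x - \<phi> y\<bar>"
    and \<phi>: "continuous_on {0..} \<phi>"
    and rat: "\<And>q. q \<in> \<rat> \<Longrightarrow> 0 \<le> q \<Longrightarrow> convergent (\<lambda>n. f n q)"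
    and r: "0 \<le> r"
  shows "convergent (\<lambda>n. f n r)"
proof -
  have "Cauchy (\<lambda>n. f n r)"
  proof (rule metric_CauchyI)
    fix e :: real assume e: "0 < e"
    have "continuous (at r within {0..}) \<phi>"
      using \<phi> r by (simp add: continuous_on_eq_continuous_within)
    then obtain \<eta> where \<eta>: "\<eta> > 0" "\<And>x. 0 \<le> x \<Longrightarrow> dist x r < \<eta> \<Longrightarrow> dist (\<phi> x) (\<phi> r) < e / 3"
      unfolding continuous_within_eps_delta using e by (metis atLeast_iff divide_pos_pos zero_less_numeral)
    obtain q where q: "q \<in> \<rat>" "r < q" "q < r + \<eta>" using Rats_dense_in_real[of r "r + \<eta>"] \<eta>(1) by auto
    have q0: "0 \<le> q" using q r by simp
    have near: "\<bar>f n r - f n q\<bar> < e / 3" for n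
      using modulus[OF r q0, of n] \<eta>(2)[OF q0] q by (auto simp: dist_real_def abs_minus_commute)
    have "Cauchy (\<lambda>n. f n q)" using rat[OF q(1) q0] by (rule convergent_Cauchy)
    then obtain M where M: "\<And>i j. i \<ge> M \<Longrightarrow> j \<ge> M \<Longrightarrow> dist (f i q) (f j q) < e / 3"
      using e unfolding Cauchy_def by (metis divide_pos_pos zero_less_numeral)
    have "dist (f i r) (f j r) < e" if "i \<ge> M" "j \<ge> M" for i j
      using near[of i] near[of j] M[OF that] unfolding dist_real_def by linarith
    then show "\<exists>M. \<forall>m\<ge>M. \<forall>n\<ge>M. dist (f m r) (f n r) < e" by blast
  qed
  then show ?thesis by (rule Cauchy_convergent)
qed

text \<open>One component of a sequence of approximate solutions. Near the origin the profiles are close to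
  \<open>1\<close> uniformly in \<open>n\<close>, so the sources are bounded below by some \<open>L > 0\<close> on \<open>[0,r0]\<close> even though their
  truncation level tends to \<open>0\<close>. The exit radii enter through their reciprocals, whose limit \<open>\<iota>\<close> is
  \<open>0\<close> when the radii tend to infinity, so that both cases are treated together.\<close>

locale exit_sequence = radial_exponents +
  fixes h :: "nat \<Rightarrow> real \<Rightarrow> real" and \<alpha> \<rho> :: "nat \<Rightarrow> real" and w :: "nat \<Rightarrow> real \<Rightarrow> real"
    and \<eta> r0 L \<alpha>' \<iota> :: real and w' :: "real \<Rightarrow> real"
  assumes source_cont: "\<And>n. continuous_on {0..} (h n)"
    and source_nonneg: "\<And>n x. 0 \<le> x \<Longrightarrow> 0 \<le> h n x" and source_le_1: "\<And>n x. 0 \<le> x \<Longrightarrow> h n x \<le> 1"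
    and coefficient: "\<And>n. 0 < \<alpha> n" "\<And>n. \<alpha> n \<le> 1" and radius_pos: "\<And>n. 0 < \<rho> n"
    and profile: "\<And>n x. 0 \<le> x \<Longrightarrow> w n x = 1 - \<alpha> n * descent c d \<theta> (h n) x"
    and exit: "\<And>n. \<alpha> n * exit_function c d \<theta> \<eta> (h n) (\<rho> n) = 1"
    and eta_nonneg: "0 \<le> \<eta>"
    and source_lower: "0 < r0" "0 < L" "\<And>n x. 0 \<le> x \<Longrightarrow> x \<le> r0 \<Longrightarrow> L \<le> h n x"
    and coefficient_lim: "\<alpha> \<longlonglongrightarrow> \<alpha>'" and inverse_radius_lim: "(\<lambda>n. 1 / \<rho> n) \<longlonglongrightarrow> \<iota>"
    and profile_lim: "\<And>x. 0 \<le> x \<Longrightarrow> (\<lambda>n. w n x) \<longlonglongrightarrow> w' x"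
    and r0_small: "r0 powr d \<le> 1 / 2"
begin

lemma profile_modulus:
  assumes "0 \<le> x" "0 \<le> y"
  shows "\<bar>w n x - w n y\<bar> \<le> \<bar>x powr d - y powr d\<bar>"
  using descent_modulus[OF source_cont source_nonneg source_le_1 less_imp_le[OF coefficient(1)]
      coefficient(2) assms, of n n] profile[OF assms(1), of n] profile[OF assms(2), of n]
  by simp

lemma limit_modulus:
  assumes "0 \<le> x" "0 \<le> y"
  shows "\<bar>w' x - w' y\<bar> \<le> \<bar>x powr d - y powr d\<bar>"
proof (rule LIMSEQ_le_const2)
  show "(\<lambda>n. \<bar>w n x - w n y\<bar>) \<longlonglongrightarrow> \<bar>w' x - w' y\<bar>"
    by (intro tendsto_intros profile_lim assms)
qed (use profile_modulus[OF assms] in auto)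

lemma powr_continuous: "continuous_on {0..} (\<lambda>x::real. x powr d)"
  by (rule continuous_on_powr_const_exponent[OF d_pos continuous_on_id]) auto

lemma modulus_imp_continuous:
  assumes "\<And>x y. 0 \<le> x \<Longrightarrow> 0 \<le> y \<Longrightarrow> \<bar>g x - g y\<bar> \<le> \<bar>x powr d - y powr d\<bar>"
  shows "continuous_on {0..} g"
  unfolding continuous_on_iff
proof (intro ballI allI impI)
  fix x e :: real assume x: "x \<in> {0..}" and e: "0 < e"
  obtain b where "b > 0" and b: "\<And>y. y \<in> {0..} \<Longrightarrow> dist y x < b \<Longrightarrow> dist (y powr d) (x powr d) < e"
    using powr_continuous[unfolded continuous_on_iff] x e by blast
  have "dist (g y) (g x) < e" if "y \<in> {0..}" "dist y x < b" for y
    using assms[of y x] b[OF that] that x by (simp add: dist_real_def)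
  with \<open>b > 0\<close> show "\<exists>b>0. \<forall>y\<in>{0..}. dist y x < b \<longrightarrow> dist (g y) (g x) < e" by blast
qed

lemma limit_continuous: "continuous_on {0..} w'"
  by (rule modulus_imp_continuous[OF limit_modulus])

lemma limit_at_0: "w' 0 = 1"
proof -
  have "(\<lambda>n. w n 0) = (\<lambda>n. 1)" by (auto simp: profile)
  then show ?thesis using profile_lim[of 0] LIMSEQ_unique[OF _ tendsto_const] by fastforce
qed

lemma moving_argument_tendsto:
  assumes x: "\<And>n. 0 \<le> x n" "x \<longlonglongrightarrow> y" "0 \<le> y"
  shows "(\<lambda>n. w n (x n)) \<longlonglongrightarrow> w' y"
proof -
  have "(\<lambda>n. x n powr d) \<longlonglongrightarrow> y powr d"
    using x d_pos by (intro tendsto_powr'[OF x(2) tendsto_const]) auto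
  then have "(\<lambda>n. \<bar>x n powr d - y powr d\<bar>) \<longlonglongrightarrow> 0"
    using tendsto_rabs_zero LIM_zero by blast
  then have "(\<lambda>n. w n (x n) - w n y) \<longlonglongrightarrow> 0"
    by (rule Lim_null_comparison[rotated]) (use profile_modulus x in \<open>auto intro!: always_eventually\<close>)
  from tendsto_add[OF this profile_lim[OF x(3)]] show ?thesis by simp
qed

lemma limit_equation:
  assumes r: "0 \<le> r" and lim: "\<And>x. 0 \<le> x \<Longrightarrow> x \<le> r \<Longrightarrow> (\<lambda>n. h n x) \<longlonglongrightarrow> g x"
  shows "w' r = 1 - \<alpha>' * descent c d \<theta> g r"
proof -
  have "(\<lambda>n. 1 - \<alpha> n * descent c d \<theta> (h n) r) \<longlonglongrightarrow> 1 - \<alpha>' * descent c d \<theta> g r"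
    by (intro tendsto_intros coefficient_lim descent_tendsto[OF r source_cont source_nonneg source_le_1] lim)
  then show ?thesis
    using profile_lim[OF r] profile[OF r] LIMSEQ_unique by simp
qed

lemma limit_coefficient_nonneg: "0 \<le> \<alpha>'"
  by (rule LIMSEQ_le_const[OF coefficient_lim]) (use coefficient less_imp_le in blast)

lemma inverse_limit_nonneg: "0 \<le> \<iota>"
  by (rule LIMSEQ_le_const[OF inverse_radius_lim]) (use radius_pos less_imp_le in \<open>auto intro!: exI[of _ 0]\<close>)

lemma mass_lower: 
  assumes "r0 \<le> x"
  shows "r0 powr c * L \<le> mass c (h n) x"
proof -
  have "L \<le> radial_mean c (h n) r0"
    by (rule mean_bounds(1)) (use source_cont source_lower source_le_1 in auto)
  then have "r0 powr c * L \<le> mass c (h n) r0"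
    by (simp add: mass_def mult_left_mono)
  then show ?thesis
    using mass_increment(1)[OF source_cont source_nonneg source_le_1 less_imp_le[OF source_lower(1)] assms, of n]
    by linarith
qed

text \<open>A bound that does not involve the truncation level: the profile is nonnegative at the exit
  radius, and before it the profile lies above that value by the descent in between, which is
  controlled by the mass gathered on \<open>[0,r0]\<close>.\<close>

lemma profile_lower:
  assumes x: "r0 \<le> x" "x \<le> \<rho> n"
  shows "\<alpha> n * (d / (c * \<theta> - d) * (r0 powr c * L) powr \<theta> * (x powr (d - c * \<theta>) - \<rho> n powr (d - c * \<theta>)))
    \<le> w n x"
proof -
  let ?D = "descent c d \<theta> (h n)"
  have x0: "0 < x" using x source_lower by simp
  have A: "0 < c * \<theta> - d" using decay_pos by simp
  have "(r0 powr c * L) powr \<theta> \<le> mass c (h n) x powr \<theta>"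
    using mass_lower[OF x(1), of n] source_lower theta_pos by (intro powr_mono2) auto
  moreover have "\<rho> n powr (d - c * \<theta>) \<le> x powr (d - c * \<theta>)"
    using A x x0 by (intro powr_mono2') auto
  ultimately have "d / (c * \<theta> - d) * (r0 powr c * L) powr \<theta> * (x powr (d - c * \<theta>) - \<rho> n powr (d - c * \<theta>))
      \<le> d / (c * \<theta> - d) * mass c (h n) x powr \<theta> * (x powr (d - c * \<theta>) - \<rho> n powr (d - c * \<theta>))"
    using A d_pos by (intro mult_right_mono mult_left_mono) auto
  also have "\<dots> \<le> ?D (\<rho> n) - ?D x"
    by (rule descent_increment_lower[OF source_cont source_nonneg source_le_1 x0 x(2)])
  finally have "\<alpha> n * (d / (c * \<theta> - d) * (r0 powr c * L) powr \<theta> *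
      (x powr (d - c * \<theta>) - \<rho> n powr (d - c * \<theta>))) \<le> \<alpha> n * (?D (\<rho> n) - ?D x)"
    using coefficient(1)[of n] by (intro mult_left_mono) auto
  moreover have "?D (\<rho> n) \<le> exit_function c d \<theta> \<eta> (h n) (\<rho> n)"
    by (rule exit_function_bounds(1)[OF source_cont source_nonneg source_le_1 eta_nonneg])
       (use radius_pos[of n] in simp_all)
  then have "\<alpha> n * ?D (\<rho> n) \<le> 1"
    using exit[of n] coefficient(1)[of n] mult_left_mono[of "?D (\<rho> n)" _ "\<alpha> n"] by fastforce
  ultimately show ?thesis using profile[of x n] x0 by (simp add: algebra_simps)
qed

text \<open>A profile with a small coefficient is so flat that it can exit only at a large radius.\<close>

lemma limit_coefficient_pos:
  assumes "0 < \<iota>"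
  shows "0 < \<alpha>'"
proof -
  have rho: "\<rho> \<longlonglongrightarrow> 1 / \<iota>"
    using tendsto_divide[OF tendsto_const[of 1] inverse_radius_lim] assms by simp
  have "(\<lambda>n. \<alpha> n * ((1 + \<eta> * d) * \<rho> n powr d)) \<longlonglongrightarrow> \<alpha>' * ((1 + \<eta> * d) * (1 / \<iota>) powr d)"
    using assms by (intro tendsto_intros coefficient_lim rho) auto
  moreover have "1 \<le> \<alpha> n * ((1 + \<eta> * d) * \<rho> n powr d)" for n
    using exit[of n] coefficient(1)[of n] radius_pos[of n]
      exit_function_bounds(2)[OF source_cont source_nonneg source_le_1 eta_nonneg, of "\<rho> n" n]
      mult_left_mono[of _ "(1 + \<eta> * d) * \<rho> n powr d" "\<alpha> n"] by fastforce
  ultimately have "1 \<le> \<alpha>' * ((1 + \<eta> * d) * (1 / \<iota>) powr d)"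
    by (intro LIMSEQ_le_const) auto
  then show ?thesis using limit_coefficient_nonneg by (cases "\<alpha>' = 0") auto
qed

text \<open>Up to \<open>r0\<close> the profiles are at least \<open>1/2\<close>. Beyond, for \<open>\<alpha>' > 0\<close> their lower bound survives in the
  limit, and for \<open>\<alpha>' = 0\<close> the limit profile is the constant \<open>1\<close>.\<close>

lemma limit_pos:
  assumes r: "0 \<le> r" "r * \<iota> < 1"
  shows "0 < w' r"
proof (cases "r \<le> r0")
  case True
  have "\<bar>w' r - w' 0\<bar> \<le> r powr d" using limit_modulus[OF r(1), of 0] by simp
  moreover have "r powr d \<le> r0 powr d" using True r d_pos by (intro powr_mono2) auto
  ultimately show ?thesis using r0_small limit_at_0 by linarith
next
  case False
  then have rr: "0 < r" "r0 \<le> r" using source_lower by auto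
  have A: "0 < c * \<theta> - d" using decay_pos by simp
  show ?thesis
  proof (cases "\<alpha>' = 0")
    case True
    have "(\<lambda>n. 1 - \<alpha> n * r powr d) \<longlonglongrightarrow> 1 - \<alpha>' * r powr d"
      by (intro tendsto_intros coefficient_lim)
    moreover have "1 - \<alpha> n * r powr d \<le> w n r" for n
      using descent_increment(2)[OF source_cont source_nonneg source_le_1 order_refl r(1), of n]
        profile[OF r(1), of n] coefficient(1)[of n] mult_left_mono[of _ "r powr d" "\<alpha> n"] by fastforce
    ultimately have "1 - \<alpha>' * r powr d \<le> w' r"
      using profile_lim[OF r(1)] by (intro LIMSEQ_le[of _ _ "\<lambda>n. w n r"]) auto
    then show ?thesis using True by simp
  next
    case False
    then have a: "0 < \<alpha>'" using limit_coefficient_nonneg by simp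
    let ?K = "d / (c * \<theta> - d) * (r0 powr c * L) powr \<theta>"
    have K: "0 < ?K" using A d_pos source_lower by simp
    have eq: "\<rho> n powr (d - c * \<theta>) = (1 / \<rho> n) powr (c * \<theta> - d)" for n
      using radius_pos[of n] by (simp add: powr_divide powr_minus_divide[symmetric])
    have "(\<lambda>n. (1 / \<rho> n) powr (c * \<theta> - d)) \<longlonglongrightarrow> \<iota> powr (c * \<theta> - d)"
      using A radius_pos by (intro tendsto_powr'[OF inverse_radius_lim tendsto_const])
        (auto simp: less_imp_le)
    then have "(\<lambda>n. \<rho> n powr (d - c * \<theta>)) \<longlonglongrightarrow> \<iota> powr (c * \<theta> - d)"
      by (simp only: eq)
    then have "(\<lambda>n. \<alpha> n * (?K * (r powr (d - c * \<theta>) - \<rho> n powr (d - c * \<theta>))))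
        \<longlonglongrightarrow> \<alpha>' * (?K * (r powr (d - c * \<theta>) - \<iota> powr (c * \<theta> - d)))"
      by (intro tendsto_mult[OF coefficient_lim] tendsto_mult[OF tendsto_const] tendsto_diff tendsto_const)
    moreover have "eventually (\<lambda>n. 1 / \<rho> n < 1 / r) sequentially"
      using order_tendstoD(2)[OF inverse_radius_lim, of "1 / r"] r rr by (simp add: field_simps)
    then have "eventually (\<lambda>n. \<alpha> n * (?K * (r powr (d - c * \<theta>) - \<rho> n powr (d - c * \<theta>))) \<le> w n r) sequentially"
    proof eventually_elim
      case (elim n)
      then have "r \<le> \<rho> n" using rr radius_pos[of n] by (simp add: field_simps)
      then show ?case using profile_lower[OF rr(2)] by simp
    qed
    ultimately have "\<alpha>' * (?K * (r powr (d - c * \<theta>) - \<iota> powr (c * \<theta> - d))) \<le> w' r"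
      using profile_lim[OF r(1)] tendsto_le[OF sequentially_bot] by blast
    moreover have "\<iota> powr (c * \<theta> - d) < (1 / r) powr (c * \<theta> - d)"
      using A r rr inverse_limit_nonneg by (intro powr_less_mono2) (auto simp: field_simps)
    then have "\<iota> powr (c * \<theta> - d) < r powr (d - c * \<theta>)"
      using rr by (simp add: powr_divide powr_minus_divide[symmetric])
    ultimately show ?thesis using a K by (smt (verit) mult_pos_pos)
  qed
qed

lemma radius_lim: "0 < \<iota> \<Longrightarrow> \<rho> \<longlonglongrightarrow> 1 / \<iota>"
  using tendsto_divide[OF tendsto_const[of 1] inverse_radius_lim] by simp

lemma exit_value: "w n (\<rho> n) = \<eta> * (\<alpha> n * (d * \<rho> n powr d * radial_mean c (h n) (\<rho> n) powr \<theta>))"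
  using profile[of "\<rho> n" n] exit[of n] radius_pos[of n]
  by (simp add: exit_function_def algebra_simps)

lemma limit_vanishes_at_exit:
  assumes "0 < \<iota>" "\<eta> = 0"
  shows "w' (1 / \<iota>) = 0"
proof -
  have "(\<lambda>n. w n (\<rho> n)) \<longlonglongrightarrow> w' (1 / \<iota>)"
    using assms radius_pos less_imp_le by (intro moving_argument_tendsto radius_lim) auto
  then show ?thesis using assms by (simp add: exit_value LIMSEQ_const_iff)
qed

lemma limit_pos_at_exit:
  assumes "0 < \<iota>" "0 < \<eta>"
  shows "0 < w' (1 / \<iota>)"
proof -
  have lim: "(\<lambda>n. w n (\<rho> n)) \<longlonglongrightarrow> w' (1 / \<iota>)"
    using assms radius_pos less_imp_le by (intro moving_argument_tendsto radius_lim) auto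
  define K where "K = (r0 powr c * L) powr \<theta>"
  have K: "0 < K" using source_lower by (simp add: K_def)
  show ?thesis
  proof (cases "1 / \<iota> \<le> r0")
    case True
    have "\<bar>w' (1 / \<iota>) - w' 0\<bar> \<le> (1 / \<iota>) powr d" using limit_modulus[of "1 / \<iota>" 0] assms by simp
    moreover have "(1 / \<iota>) powr d \<le> r0 powr d" using True assms d_pos by (intro powr_mono2) auto
    ultimately show ?thesis using r0_small limit_at_0 by linarith
  next
    case False
    have "eventually (\<lambda>n. r0 < \<rho> n) sequentially"
      using order_tendstoD(1)[OF radius_lim[OF assms(1)], of r0] False by simp
    then have "eventually (\<lambda>n. \<eta> * (\<alpha> n * (d * \<rho> n powr (d - c * \<theta>) * K)) \<le> w n (\<rho> n)) sequentially"
    proof eventually_elim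
      case (elim n)
      have "0 \<le> radial_mean c (h n) (\<rho> n)"
        using radial_mean_nonneg[OF c_pos, of "\<rho> n" "h n"] source_nonneg radius_pos[of n] by simp
      from mean_powr_eq_mass[OF this radius_pos]
      have eq: "d * \<rho> n powr d * radial_mean c (h n) (\<rho> n) powr \<theta>
          = d * \<rho> n powr (d - c * \<theta>) * mass c (h n) (\<rho> n) powr \<theta>"
        by (simp add: powr_add[symmetric])
      have "K \<le> mass c (h n) (\<rho> n) powr \<theta>"
        unfolding K_def using mass_lower[of "\<rho> n" n] elim source_lower theta_pos
        by (intro powr_mono2) auto
      then show ?case unfolding exit_value eq
        using eta_nonneg coefficient(1)[of n] d_pos by (intro mult_left_mono) auto
    qed
    moreover have "(\<lambda>n. \<eta> * (\<alpha> n * (d * \<rho> n powr (d - c * \<theta>) * K)))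
        \<longlonglongrightarrow> \<eta> * (\<alpha>' * (d * (1 / \<iota>) powr (d - c * \<theta>) * K))"
      using assms by (intro tendsto_intros coefficient_lim radius_lim) auto
    ultimately have "\<eta> * (\<alpha>' * (d * (1 / \<iota>) powr (d - c * \<theta>) * K)) \<le> w' (1 / \<iota>)"
      using lim tendsto_le[OF sequentially_bot] by blast
    moreover have "0 < \<eta> * (\<alpha>' * (d * (1 / \<iota>) powr (d - c * \<theta>) * K))"
      using assms K d_pos limit_coefficient_pos by simp
    ultimately show ?thesis by linarith
  qed
qed

text \<open>The radii of evaluation move with \<open>n\<close>. The means can be compared at nearby radii since the
  mass has the modulus of continuity of \<open>r\<^sup>c\<close>, independently of \<open>n\<close>.\<close>

lemma limit_exit_value:
  assumes i: "0 < \<iota>" and lim: "\<And>x. 0 \<le> x \<Longrightarrow> x \<le> 1 / \<iota> \<Longrightarrow> (\<lambda>n. h n x) \<longlonglongrightarrow> g x"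
  shows "w' (1 / \<iota>) = \<eta> * (\<alpha>' * (d * (1 / \<iota>) powr d * radial_mean c g (1 / \<iota>) powr \<theta>))"
proof -
  let ?R = "1 / \<iota>"
  have R: "0 < ?R" using i by simp
  have m1: "(\<lambda>n. mass c (h n) ?R) \<longlonglongrightarrow> mass c g ?R"
    unfolding mass_def using R lim
    by (intro tendsto_mult_left mean_tendsto source_cont source_nonneg source_le_1) auto
  have rc: "(\<lambda>n. \<rho> n powr c) \<longlonglongrightarrow> ?R powr c"
    using R by (intro tendsto_powr radius_lim i tendsto_const) auto
  then have null: "(\<lambda>n. \<bar>\<rho> n powr c - ?R powr c\<bar>) \<longlonglongrightarrow> 0"
    using tendsto_rabs_zero LIM_zero by blast
  have near: "norm (mass c (h n) (\<rho> n) - mass c (h n) ?R) \<le> \<bar>\<rho> n powr c - ?R powr c\<bar>" for n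
    unfolding real_norm_def
    using mass_increment[OF source_cont source_nonneg source_le_1, of ?R "\<rho> n" n]
      mass_increment[OF source_cont source_nonneg source_le_1, of "\<rho> n" ?R n] R radius_pos[of n]
    by (cases "?R \<le> \<rho> n") auto
  have "(\<lambda>n. mass c (h n) (\<rho> n) - mass c (h n) ?R) \<longlonglongrightarrow> 0"
    by (rule Lim_null_comparison[OF always_eventually null]) (rule allI, rule near)
  from tendsto_add[OF this m1] have "(\<lambda>n. mass c (h n) (\<rho> n)) \<longlonglongrightarrow> mass c g ?R" by simp
  then have "(\<lambda>n. mass c (h n) (\<rho> n) / \<rho> n powr c) \<longlonglongrightarrow> mass c g ?R / ?R powr c"
    using R by (intro tendsto_divide rc) auto
  moreover have "mass c (h n) (\<rho> n) / \<rho> n powr c = radial_mean c (h n) (\<rho> n)" for n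
    using radius_pos[of n] by (simp add: mass_def)
  moreover have "mass c g ?R / ?R powr c = radial_mean c g ?R" using R by (simp add: mass_def)
  ultimately have mean: "(\<lambda>n. radial_mean c (h n) (\<rho> n)) \<longlonglongrightarrow> radial_mean c g ?R" by simp
  have "0 \<le> radial_mean c (h n) (\<rho> n)" for n
    using radial_mean_nonneg[OF c_pos, of "\<rho> n" "h n"] source_nonneg radius_pos[of n] by simp
  then have mp: "(\<lambda>n. radial_mean c (h n) (\<rho> n) powr \<theta>) \<longlonglongrightarrow> radial_mean c g ?R powr \<theta>"
    using theta_pos by (intro tendsto_powr'[OF mean tendsto_const]) auto
  have rd: "(\<lambda>n. \<rho> n powr d) \<longlonglongrightarrow> ?R powr d"
    using R by (intro tendsto_powr radius_lim i tendsto_const) auto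
  have "(\<lambda>n. w n (\<rho> n)) \<longlonglongrightarrow> \<eta> * (\<alpha>' * (d * ?R powr d * radial_mean c g ?R powr \<theta>))"
    unfolding exit_value
    by (intro tendsto_mult[OF tendsto_const] tendsto_mult[OF coefficient_lim] tendsto_mult[OF _ mp] rd)
  moreover have "(\<lambda>n. w n (\<rho> n)) \<longlonglongrightarrow> w' ?R"
    using i radius_pos less_imp_le by (intro moving_argument_tendsto radius_lim) auto
  ultimately show ?thesis using LIMSEQ_unique by blast
qed

end

lemma delayed_source_tendsto:
  assumes f: "(\<lambda>n. f n (max 0 (x - \<tau> n))) \<longlonglongrightarrow> F" and g: "(\<lambda>n. g n (max 0 (x - \<tau> n))) \<longlonglongrightarrow> G"
    and \<epsilon>: "\<epsilon> \<longlonglongrightarrow> 0" and pos: "0 < F" "0 < G"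
  shows "(\<lambda>n. delayed_source (\<epsilon> n) (\<tau> n) s \<delta> (f n) (g n) x) \<longlonglongrightarrow> F powr s * G powr \<delta>"
proof -
  have "(\<lambda>n. max (\<epsilon> n) (f n (max 0 (x - \<tau> n)))) \<longlonglongrightarrow> F"
    "(\<lambda>n. max (\<epsilon> n) (g n (max 0 (x - \<tau> n)))) \<longlonglongrightarrow> G"
    using tendsto_max[OF \<epsilon> f] tendsto_max[OF \<epsilon> g] pos by simp_all
  then show ?thesis
    unfolding delayed_source_def using pos
    by (intro tendsto_mult tendsto_powr tendsto_const) auto
qed

context radial_pair
begin

definition truncated_exit ::
  "real \<Rightarrow> real \<Rightarrow> real \<Rightarrow> real \<Rightarrow> real \<Rightarrow> real \<Rightarrow> (real \<Rightarrow> real) \<Rightarrow> (real \<Rightarrow> real) \<Rightarrow> bool" where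
  "truncated_exit \<eta> \<zeta> \<epsilon> \<tau> k \<rho> u v \<longleftrightarrow> 0 < k \<and> k < 1 \<and> 0 < \<rho> \<and>
     continuous_on {0..} u \<and> continuous_on {0..} v \<and> (\<forall>r\<ge>0. u r \<le> 1 \<and> v r \<le> 1) \<and>
     (\<forall>r\<ge>0. u r = 1 - (1 - k) * descent c1 d1 \<theta>1 (delayed_source \<epsilon> \<tau> s \<delta> u v) r) \<and>
     (\<forall>r\<ge>0. v r = 1 - k * descent c2 d2 \<theta>2 (delayed_source \<epsilon> \<tau> \<mu> m u v) r) \<and>
     (1 - k) * exit_function c1 d1 \<theta>1 \<eta> (delayed_source \<epsilon> \<tau> s \<delta> u v) \<rho> = 1 \<and>
     k * exit_function c2 d2 \<theta>2 \<zeta> (delayed_source \<epsilon> \<tau> \<mu> m u v) \<rho> = 1"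

lemma truncated_exit_exists:
  assumes "0 \<le> \<eta>" "\<eta> * (c1 * \<theta>1 - d1) \<le> 1" "0 \<le> \<zeta>" "\<zeta> * (c2 * \<theta>2 - d2) \<le> 1"
    "0 < \<epsilon>" "\<epsilon> \<le> 1" "0 < \<tau>"
  shows "\<exists>k \<rho> u v. truncated_exit \<eta> \<zeta> \<epsilon> \<tau> k \<rho> u v"
proof -
  interpret D: delayed_pair c1 d1 \<theta>1 c2 d2 \<theta>2 s m \<delta> \<mu> \<epsilon> \<tau>
    by unfold_locales (use assms in auto)
  show ?thesis
    by (rule D.simultaneous_exit[OF assms(1-4)]) (unfold truncated_exit_def, blast)
qed

text \<open>Solutions of the truncated and delayed systems subconverge to a pair that satisfies the exact
  equations as long as both components are positive. A vanishing \<open>\<iota>\<close> means that the common exit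
  radius has escaped to infinity, otherwise \<open>1 / \<iota>\<close> is the exit radius of the limit.\<close>

lemma limit_profile:
  assumes \<eta>: "0 \<le> \<eta>" "\<eta> * (c1 * \<theta>1 - d1) \<le> 1" and \<zeta>: "0 \<le> \<zeta>" "\<zeta> * (c2 * \<theta>2 - d2) \<le> 1"
  obtains \<alpha> \<beta> \<iota> u v where
    "0 \<le> \<alpha>" "0 \<le> \<beta>" "\<alpha> + \<beta> = 1" "0 \<le> \<iota>"
    "continuous_on {0..} u" "continuous_on {0..} v"
    "\<And>r. 0 \<le> r \<Longrightarrow> r * \<iota> < 1 \<Longrightarrow> 0 < u r \<and> 0 < v r"
    "\<And>r. 0 \<le> r \<Longrightarrow> (\<And>x. 0 \<le> x \<Longrightarrow> x \<le> r \<Longrightarrow> 0 < u x \<and> 0 < v x) \<Longrightarrow>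
      u r = 1 - \<alpha> * descent c1 d1 \<theta>1 (source s \<delta> u v) r \<and>
      v r = 1 - \<beta> * descent c2 d2 \<theta>2 (source \<mu> m u v) r"
    "0 < \<iota> \<Longrightarrow> 0 < \<alpha> \<and> 0 < \<beta>"
    "0 < \<iota> \<Longrightarrow> \<eta> = 0 \<Longrightarrow> u (1 / \<iota>) = 0" "0 < \<iota> \<Longrightarrow> \<zeta> = 0 \<Longrightarrow> v (1 / \<iota>) = 0"
    "0 < \<iota> \<Longrightarrow> 0 < \<eta> \<Longrightarrow> 0 < u (1 / \<iota>)" "0 < \<iota> \<Longrightarrow> 0 < \<zeta> \<Longrightarrow> 0 < v (1 / \<iota>)"
    "0 < \<iota> \<Longrightarrow> (\<And>x. 0 \<le> x \<Longrightarrow> x \<le> 1 / \<iota> \<Longrightarrow> 0 < u x \<and> 0 < v x) \<Longrightarrow>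
      u (1 / \<iota>) = \<eta> * (\<alpha> * (d1 * (1 / \<iota>) powr d1 *
        radial_mean c1 (source s \<delta> u v) (1 / \<iota>) powr \<theta>1)) \<and>
      v (1 / \<iota>) = \<zeta> * (\<beta> * (d2 * (1 / \<iota>) powr d2 *
        radial_mean c2 (source \<mu> m u v) (1 / \<iota>) powr \<theta>2))"
proof -
  let ?e = "\<lambda>n::nat. 1 / (real n + 1)"
  have "\<forall>n. \<exists>k \<rho> u v. truncated_exit \<eta> \<zeta> (?e n) (?e n) k \<rho> u v"
    by (intro allI truncated_exit_exists \<eta> \<zeta>) auto
  then obtain k \<rho> u v where tr: "\<And>n. truncated_exit \<eta> \<zeta> (?e n) (?e n) (k n) (\<rho> n) (u n) (v n)"
    by metis
  let ?hu = "\<lambda>n. delayed_source (?e n) (?e n) s \<delta> (u n) (v n)"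
  let ?hv = "\<lambda>n. delayed_source (?e n) (?e n) \<mu> m (u n) (v n)"
  have k: "0 < k n" "k n < 1" and rho: "0 < \<rho> n"
    and cu: "continuous_on {0..} (u n)" and cv: "continuous_on {0..} (v n)"
    and le1: "\<And>r. 0 \<le> r \<Longrightarrow> u n r \<le> 1" "\<And>r. 0 \<le> r \<Longrightarrow> v n r \<le> 1"
    and equ: "\<And>r. 0 \<le> r \<Longrightarrow> u n r = 1 - (1 - k n) * descent c1 d1 \<theta>1 (?hu n) r"
    and eqv: "\<And>r. 0 \<le> r \<Longrightarrow> v n r = 1 - k n * descent c2 d2 \<theta>2 (?hv n) r"
    and exu: "(1 - k n) * exit_function c1 d1 \<theta>1 \<eta> (?hu n) (\<rho> n) = 1"
    and exv: "k n * exit_function c2 d2 \<theta>2 \<zeta> (?hv n) (\<rho> n) = 1" for n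
    using tr[of n] unfolding truncated_exit_def by blast+
  have src: "continuous_on {0..} (delayed_source (?e n) (?e n) a b (u n) (v n))"
    "0 \<le> x \<Longrightarrow> 0 \<le> delayed_source (?e n) (?e n) a b (u n) (v n) x"
    "0 \<le> x \<Longrightarrow> delayed_source (?e n) (?e n) a b (u n) (v n) x \<le> 1"
    if "0 \<le> a" "0 \<le> b" for a b n x
  proof -
    interpret D: delayed_pair c1 d1 \<theta>1 c2 d2 \<theta>2 s m \<delta> \<mu> "?e n" "?e n"
      by unfold_locales auto
    show "continuous_on {0..} (delayed_source (?e n) (?e n) a b (u n) (v n))"
      by (rule D.source_continuous[OF cu cv])
    show "0 \<le> delayed_source (?e n) (?e n) a b (u n) (v n) x" by (rule D.source_nonneg)
    show "delayed_source (?e n) (?e n) a b (u n) (v n) x \<le> 1"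
      by (rule delayed_source_bounds(2)) (use that le1 in auto)
  qed
  note hu = src[OF exponents_nonneg(1,3)] and hv = src[OF exponents_nonneg(4,2)]
  have mod_u: "\<bar>u n x - u n y\<bar> \<le> \<bar>x powr d1 - y powr d1\<bar>" if "0 \<le> x" "0 \<le> y" for n x y
    using X.descent_modulus[OF hu, of "1 - k n" x y n] k[of n] that equ[of x n] equ[of y n] by simp
  have mod_v: "\<bar>v n x - v n y\<bar> \<le> \<bar>x powr d2 - y powr d2\<bar>" if "0 \<le> x" "0 \<le> y" for n x y
    using Y.descent_modulus[OF hv, of "k n" x y n] k[of n] that eqv[of x n] eqv[of y n] by simp
  have u0: "u n 0 = 1" and v0: "v n 0 = 1" for n
    using equ[of 0 n] eqv[of 0 n] by simp_all
  have bnd_u: "\<bar>u n x - 1\<bar> \<le> x powr d1" and bnd_v: "\<bar>v n x - 1\<bar> \<le> x powr d2" if "0 \<le> x" for n x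
    using mod_u[OF that, of 0 n] mod_v[OF that, of 0 n] u0 v0 by simp_all
  define C where "C = (1 + \<eta> * d1) powr (1 / d1)"
  have inv_rho: "0 < 1 / \<rho> n" "1 / \<rho> n \<le> C" for n
  proof -
    have "0 \<le> exit_function c1 d1 \<theta>1 \<eta> (?hu n) (\<rho> n)"
      by (rule order_trans[OF X.descent_nonneg X.exit_function_bounds(1)[OF hu \<eta>(1)]])
         (use rho[of n] in auto)
    then have "(1 - k n) * exit_function c1 d1 \<theta>1 \<eta> (?hu n) (\<rho> n) \<le> 1 * ((1 + \<eta> * d1) * \<rho> n powr d1)"
      using X.exit_function_bounds(2)[OF hu \<eta>(1), of "\<rho> n" n] rho[of n] k[of n]
      by (intro mult_mono) auto
    then have "1 \<le> (1 + \<eta> * d1) * \<rho> n powr d1" using exu[of n] by simp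
    then have "1 powr (1 / d1) \<le> ((1 + \<eta> * d1) * \<rho> n powr d1) powr (1 / d1)"
      using X.d_pos by (intro powr_mono2) auto
    also have "\<dots> = C * \<rho> n"
      using X.d_pos \<eta> rho[of n] by (simp add: C_def powr_mult powr_powr)
    finally show "1 / \<rho> n \<le> C" using rho[of n] by (simp add: field_simps)
    show "0 < 1 / \<rho> n" using rho[of n] by simp
  qed
  \<comment> \<open>One diagonal extraction serves all four sequences; the denominators make it uniformly bounded in
    \<open>x\<close>.\<close>
  let ?f = "\<lambda>n x. (u n x / (1 + x powr d1), v n x / (1 + x powr d2), k n, 1 / \<rho> n)"
  have Mbound: "norm (?f n x) \<le> 1 + (1 + (1 + C))" if "x \<in> \<rat> \<inter> {0..}" for n x
  proof -
    have x: "0 \<le> x" using that by simp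
    have "\<bar>u n x\<bar> \<le> 1 + x powr d1" "\<bar>v n x\<bar> \<le> 1 + x powr d2"
      using bnd_u[OF x, of n] bnd_v[OF x, of n] by linarith+
    moreover have "norm (a / b) \<le> 1" if "\<bar>a\<bar> \<le> b" "0 < b" for a b :: real
      using that by simp
    moreover have "0 < 1 + x powr d1" "0 < 1 + x powr d2"
      by (simp_all add: add_pos_nonneg)
    ultimately have "norm (u n x / (1 + x powr d1)) \<le> 1" "norm (v n x / (1 + x powr d2)) \<le> 1"
      by blast+
    moreover have "norm (k n) \<le> 1" "norm (1 / \<rho> n) \<le> C" using k[of n] inv_rho[of n] by auto
    ultimately show ?thesis
      by (meson norm_Pair_le add_mono order_trans)
  qed
  have "countable (\<rat> \<inter> {0..} :: real set)" using countable_rat by (rule countable_subset[rotated]) auto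
  then obtain \<phi> where phi: "strict_mono \<phi>"
    and conv: "\<And>x. x \<in> \<rat> \<inter> {0..} \<Longrightarrow> \<exists>l. (\<lambda>n. ?f (\<phi> n) x) \<longlonglongrightarrow> l"
    using function_convergent_subsequence[of "\<rat> \<inter> {0..}" ?f, OF _ Mbound] by blast
  obtain l where l: "(\<lambda>n. ?f (\<phi> n) 0) \<longlonglongrightarrow> l" using conv[of 0] by auto
  define \<beta> where "\<beta> = fst (snd (snd l))"
  define \<iota> where "\<iota> = snd (snd (snd l))"
  have beta: "(\<lambda>n. k (\<phi> n)) \<longlonglongrightarrow> \<beta>"
    using tendsto_fst[OF tendsto_snd[OF tendsto_snd[OF l]]] by (simp add: \<beta>_def)
  have iota: "(\<lambda>n. 1 / \<rho> (\<phi> n)) \<longlonglongrightarrow> \<iota>"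
    using tendsto_snd[OF tendsto_snd[OF tendsto_snd[OF l]]] by (simp add: \<iota>_def)
  have rat_u: "convergent (\<lambda>n. u (\<phi> n) q)" and rat_v: "convergent (\<lambda>n. v (\<phi> n) q)"
    if q: "q \<in> \<rat>" "0 \<le> q" for q
  proof -
    obtain l where l: "(\<lambda>n. ?f (\<phi> n) q) \<longlonglongrightarrow> l" using conv[of q] q by auto
    have "1 + q powr d1 \<noteq> 0" "1 + q powr d2 \<noteq> 0"
      by (metis add_pos_nonneg less_irrefl powr_ge_zero zero_less_one)+
    then have "(\<lambda>n. u (\<phi> n) q) \<longlonglongrightarrow> fst l * (1 + q powr d1)" "(\<lambda>n. v (\<phi> n) q) \<longlonglongrightarrow> fst (snd l) * (1 + q powr d2)"
      using tendsto_mult_right[OF tendsto_fst[OF l], of "1 + q powr d1"]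
        tendsto_mult_right[OF tendsto_fst[OF tendsto_snd[OF l]], of "1 + q powr d2"] by simp_all
    then show "convergent (\<lambda>n. u (\<phi> n) q)" "convergent (\<lambda>n. v (\<phi> n) q)"
      by (auto simp: convergent_def)
  qed
  define u' where "u' = (\<lambda>x. lim (\<lambda>n. u (\<phi> n) x))"
  define v' where "v' = (\<lambda>x. lim (\<lambda>n. v (\<phi> n) x))"
  have lim_u: "(\<lambda>n. u (\<phi> n) x) \<longlonglongrightarrow> u' x" if "0 \<le> x" for x
    unfolding u'_def
    by (rule convergent_LIMSEQ_iff[THEN iffD1])
       (rule convergent_from_rationals[OF mod_u continuous_on_powr_const_exponent[OF X.d_pos continuous_on_id] rat_u that];
         simp)
  have lim_v: "(\<lambda>n. v (\<phi> n) x) \<longlonglongrightarrow> v' x" if "0 \<le> x" for x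
    unfolding v'_def
    by (rule convergent_LIMSEQ_iff[THEN iffD1])
       (rule convergent_from_rationals[OF mod_v continuous_on_powr_const_exponent[OF Y.d_pos continuous_on_id] rat_v that];
         simp)
  define r0 where "r0 = min ((1/2) powr (1 / d1)) ((1/2) powr (1 / d2))"
  have r0: "0 < r0" by (simp add: r0_def)
  have r0u: "r0 powr d1 \<le> 1 / 2" and r0v: "r0 powr d2 \<le> 1 / 2"
    using powr_mono2[of d1 r0 "(1/2) powr (1 / d1)"] powr_mono2[of d2 r0 "(1/2) powr (1 / d2)"]
      X.d_pos Y.d_pos r0 by (auto simp: r0_def powr_powr)
  have src_lower: "(1/2) powr a * (1/2) powr b \<le> delayed_source (?e n) (?e n) a b (u n) (v n) x"
    if ab: "0 \<le> a" "0 \<le> b" and x: "0 \<le> x" "x \<le> r0" for a b n x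
  proof -
    let ?y = "max 0 (x - ?e n)"
    have y: "0 \<le> ?y" "?y \<le> r0" using x r0 by (auto simp: algebra_simps intro: order_trans)
    have "?y powr d1 \<le> 1 / 2" "?y powr d2 \<le> 1 / 2"
      using powr_mono2[of d1 ?y r0] powr_mono2[of d2 ?y r0] y r0u r0v X.d_pos Y.d_pos by auto
    then have "1 / 2 \<le> u n ?y" "1 / 2 \<le> v n ?y"
      using bnd_u[OF y(1), of n] bnd_v[OF y(1), of n] by linarith+
    then show ?thesis
      unfolding delayed_source_def using ab by (intro mult_mono powr_mono2) auto
  qed
  have e0: "(\<lambda>n. ?e (\<phi> n)) \<longlonglongrightarrow> 0"
  proof -
    have "(\<lambda>n. ?e n) \<longlonglongrightarrow> 0"
      using LIMSEQ_inverse_real_of_nat by (simp add: inverse_eq_divide add.commute)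
    from LIMSEQ_subseq_LIMSEQ[OF this phi] show ?thesis by (simp add: o_def)
  qed
  interpret U: exit_sequence c1 d1 \<theta>1 "\<lambda>n. ?hu (\<phi> n)" "\<lambda>n. 1 - k (\<phi> n)" "\<lambda>n. \<rho> (\<phi> n)"
      "\<lambda>n. u (\<phi> n)" \<eta> r0 "(1/2) powr s * (1/2) powr \<delta>" "1 - \<beta>" \<iota> u'
    by unfold_locales (use hu k rho equ exu \<eta> r0 r0u src_lower[OF exponents_nonneg(1,3)] beta iota lim_u
        in \<open>auto intro!: tendsto_intros less_imp_le\<close>)
  interpret V: exit_sequence c2 d2 \<theta>2 "\<lambda>n. ?hv (\<phi> n)" "\<lambda>n. k (\<phi> n)" "\<lambda>n. \<rho> (\<phi> n)"
      "\<lambda>n. v (\<phi> n)" \<zeta> r0 "(1/2) powr \<mu> * (1/2) powr m" \<beta> \<iota> v'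
    by unfold_locales (use hv k rho eqv exv \<zeta> r0 r0v src_lower[OF exponents_nonneg(4,2)] beta iota lim_v
        in \<open>auto intro!: tendsto_intros less_imp_le\<close>)
  have src_lim: "(\<lambda>n. delayed_source (?e (\<phi> n)) (?e (\<phi> n)) a b (u (\<phi> n)) (v (\<phi> n)) x)
      \<longlonglongrightarrow> u' x powr a * v' x powr b" if "0 \<le> x" "0 < u' x \<and> 0 < v' x" for a b x
  proof -
    have "(\<lambda>n. max 0 (x - ?e (\<phi> n))) \<longlonglongrightarrow> max 0 (x - 0)"
      by (intro tendsto_max tendsto_diff tendsto_const e0)
    then have arg: "(\<lambda>n. max 0 (x - ?e (\<phi> n))) \<longlonglongrightarrow> x" using that by simp
    show ?thesis
      by (rule delayed_source_tendsto[where f = "\<lambda>n. u (\<phi> n)" and g = "\<lambda>n. v (\<phi> n)"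
            and \<tau> = "\<lambda>n. ?e (\<phi> n)" and x = x, OF U.moving_argument_tendsto[OF _ arg that(1)]
            V.moving_argument_tendsto[OF _ arg that(1)] e0]) (use that in auto)
  qed
  show thesis
  proof (rule that[of "1 - \<beta>" \<beta> \<iota> u' v'])
    show "0 < u' r \<and> 0 < v' r" if "0 \<le> r" "r * \<iota> < 1" for r
      using U.limit_pos[OF that] V.limit_pos[OF that] by simp
    show "u' r = 1 - (1 - \<beta>) * descent c1 d1 \<theta>1 (source s \<delta> u' v') r \<and>
        v' r = 1 - \<beta> * descent c2 d2 \<theta>2 (source \<mu> m u' v') r"
      if "0 \<le> r" "\<And>x. 0 \<le> x \<Longrightarrow> x \<le> r \<Longrightarrow> 0 < u' x \<and> 0 < v' x" for r
      using U.limit_equation[OF that(1) src_lim] V.limit_equation[OF that(1) src_lim] that by blast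
    show "u' (1 / \<iota>) = \<eta> * ((1 - \<beta>) * (d1 * (1 / \<iota>) powr d1 *
          radial_mean c1 (source s \<delta> u' v') (1 / \<iota>) powr \<theta>1)) \<and>
        v' (1 / \<iota>) = \<zeta> * (\<beta> * (d2 * (1 / \<iota>) powr d2 *
          radial_mean c2 (source \<mu> m u' v') (1 / \<iota>) powr \<theta>2))"
      if "0 < \<iota>" "\<And>x. 0 \<le> x \<Longrightarrow> x \<le> 1 / \<iota> \<Longrightarrow> 0 < u' x \<and> 0 < v' x"
      using U.limit_exit_value[OF that(1) src_lim] V.limit_exit_value[OF that(1) src_lim] that by blast
  qed (use U.limit_coefficient_nonneg V.limit_coefficient_nonneg U.inverse_limit_nonneg
      U.limit_continuous V.limit_continuous
      U.limit_coefficient_pos V.limit_coefficient_pos U.limit_vanishes_at_exit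
      V.limit_vanishes_at_exit U.limit_pos_at_exit V.limit_pos_at_exit in auto)
qed

end

section \<open>Flux form of the radial equation\<close>

text \<open>The equation \<open>-\<Delta>\<^sub>p u = g\<close> for decreasing \<open>u\<close> as a first-order system for \<open>u\<close> and \<open>F = r\<^sup>N\<^sup>-\<^sup>1 |u'|\<^sup>p\<^sup>-\<^sup>1\<close>.
  As \<open>F > 0\<close>, the power \<open>1/(p-1)\<close> is applied away from its singularity at \<open>0\<close>, and this gives the
  second derivative of \<open>u\<close> for every \<open>p > 1\<close>.\<close>

definition flux_form ::
  "nat \<Rightarrow> real \<Rightarrow> ereal \<Rightarrow> (real \<Rightarrow> real) \<Rightarrow> (real \<Rightarrow> real) \<Rightarrow> (real \<Rightarrow> real) \<Rightarrow> bool" where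
  "flux_form N p R u F g \<longleftrightarrow> (\<forall>r. 0 < r \<and> ereal r < R \<longrightarrow> 0 < F r \<and>
     (u has_real_derivative - ((r powr (1 - real N) * F r) powr (1 / (p - 1)))) (at r) \<and>
     (F has_real_derivative r powr (real N - 1) * g r) (at r))"

lemma open_open_range: "open (open_range R)"
proof (cases R)
  case (real x)
  then have "open_range R = {0<..<x}" by (auto simp: open_range_def)
  then show ?thesis by simp
next
  case PInf
  then have "open_range R = {0<..}" by (auto simp: open_range_def)
  then show ?thesis by simp
next
  case MInf
  then have "open_range R = {}" by (auto simp: open_range_def)
  then show ?thesis by simp
qed

lemma flux_form_deriv:
  assumes "flux_form N p R u F g" "r \<in> open_range R"
  shows "deriv u r = - ((r powr (1 - real N) * F r) powr (1 / (p - 1)))"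
  using assms by (auto simp: flux_form_def open_range_def intro!: DERIV_imp_deriv)

lemma flux_form_radial_flux:
  assumes ff: "flux_form N p R u F g" and p: "1 < p" and N: "1 \<le> N" and r: "r \<in> open_range R"
  shows "radial_flux N p u r = - F r"
proof -
  have r0: "0 < r" using r by (simp add: open_range_def)
  have F: "0 < F r" using ff r by (simp add: flux_form_def open_range_def)
  let ?w = "r powr (1 - real N) * F r"
  have w: "0 < ?w" using r0 F by simp
  have "(?w powr (1 / (p - 1))) powr (p - 2) * ?w powr (1 / (p - 1)) = ?w powr ((p - 2) / (p - 1) + 1 / (p - 1))"
    by (simp add: powr_powr powr_add)
  also have "(p - 2) / (p - 1) + 1 / (p - 1) = 1" using p by (simp add: field_simps)
  finally have "(?w powr (1 / (p - 1))) powr (p - 2) * ?w powr (1 / (p - 1)) = ?w" using w by simp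
  moreover have "r ^ (N - 1) = r powr (real N - 1)" using r0 N by (simp add: powr_realpow[symmetric] of_nat_diff)
  moreover have "r powr (real N - 1) * ?w = F r"
    using r0 by (simp add: powr_add[symmetric] mult.assoc[symmetric])
  ultimately show ?thesis
    using flux_form_deriv[OF ff r] by (simp add: radial_flux_def)
qed

lemma flux_form_solves:
  assumes ff: "flux_form N p R u F g" and p: "1 < p" and N: "1 \<le> N" and r: "r \<in> open_range R"
  shows "radial_flux N p u differentiable (at r)" "- radial_p_Laplacian N p u r = g r"
proof -
  have r0: "0 < r" using r by (simp add: open_range_def)
  have "((\<lambda>r. - F r) has_real_derivative - (r powr (real N - 1) * g r)) (at r)"
    using ff r by (intro DERIV_minus) (simp add: flux_form_def open_range_def)
  then have D: "(radial_flux N p u has_real_derivative - (r powr (real N - 1) * g r)) (at r)"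
    by (rule has_field_derivative_transform_within_open[OF _ open_open_range r])
       (simp add: flux_form_radial_flux[OF ff p N])
  then show "radial_flux N p u differentiable (at r)" using real_differentiable_def by blast
  have "deriv (radial_flux N p u) r = - (r powr (real N - 1) * g r)" using D by (rule DERIV_imp_deriv)
  then show "- radial_p_Laplacian N p u r = g r"
    using r0 by (simp add: radial_p_Laplacian_def powr_add[symmetric] mult.assoc[symmetric])
qed

lemma flux_form_C2:
  assumes ff: "flux_form N p R u F g" and p: "1 < p" and g: "continuous_on (open_range R) g"
  shows "C2_on (open_range R) u"
proof -
  let ?\<theta> = "1 / (p - 1)"
  let ?w = "\<lambda>r. r powr (1 - real N) * F r"
  let ?w' = "\<lambda>r. (1 - real N) * r powr (1 - real N - 1) * F r + r powr (real N - 1) * g r * r powr (1 - real N)"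
  let ?u'' = "\<lambda>r. - (?\<theta> * ?w r powr (?\<theta> - 1) * ?w' r)"
  have D1: "(u has_real_derivative - (?w r powr ?\<theta>)) (at r)" if "r \<in> open_range R" for r
    using ff that by (simp add: flux_form_def open_range_def)
  have D2: "(deriv u has_real_derivative ?u'' r) (at r)" if r: "r \<in> open_range R" for r
  proof -
    have r0: "0 < r" using r by (simp add: open_range_def)
    have F: "0 < F r" and DF: "(F has_real_derivative r powr (real N - 1) * g r) (at r)"
      using ff r by (simp_all add: flux_form_def open_range_def)
    have Dw: "(?w has_real_derivative ?w' r) (at r)"
      by (intro DERIV_mult has_real_derivative_powr r0 DF)
    have w0: "0 < ?w r" using r0 F by simp
    have "((\<lambda>r. ?w r powr ?\<theta>) has_real_derivative (?\<theta> * ?w r powr (?\<theta> - 1)) * ?w' r) (at r)"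
      by (rule DERIV_chain2[where f = "\<lambda>z. z powr ?\<theta>", OF has_real_derivative_powr[OF w0] Dw])
    then have "((\<lambda>r. - (?w r powr ?\<theta>)) has_real_derivative ?u'' r) (at r)" by (rule DERIV_minus)
    then show ?thesis
      by (rule has_field_derivative_transform_within_open[OF _ open_open_range r])
         (simp add: flux_form_deriv[OF ff])
  qed
  have cF: "continuous_on (open_range R) F"
    using ff by (intro continuous_at_imp_continuous_on ballI)
      (auto simp: flux_form_def open_range_def intro: DERIV_isCont)
  have "continuous_on (open_range R) ?u''"
  proof -
    have pw: "continuous_on (open_range R) (\<lambda>r. r powr e)" for e :: real
      by (intro continuous_on_powr continuous_on_id continuous_on_const) (auto simp: open_range_def)
    have "continuous_on (open_range R) (\<lambda>r. ?w r powr (?\<theta> - 1))"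
      using ff by (intro continuous_on_powr continuous_on_mult pw cF continuous_on_const)
        (auto simp: flux_form_def open_range_def)
    then show ?thesis
      by (intro continuous_on_minus continuous_on_mult continuous_on_add pw cF g continuous_on_const)
  qed
  then have "continuous_on (open_range R) (deriv (deriv u))"
    by (rule continuous_on_eq) (use D2 DERIV_imp_deriv in fastforce)
  then show ?thesis
    unfolding C2_on_def using D1 D2 real_differentiable_def by blast
qed

lemma flux_form_rescale:
  assumes ff: "flux_form N p R u F g" and p: "1 < p" and x: "0 < x" and l: "0 < \<kappa>"
    and R: "\<And>r. 0 < r \<Longrightarrow> ereal r < R' \<Longrightarrow> ereal (r / \<kappa>) < R"
  shows "flux_form N p R' (\<lambda>r. x * u (r / \<kappa>)) (\<lambda>r. x powr (p - 1) * \<kappa> powr (real N - p) * F (r / \<kappa>))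
    (\<lambda>r. x powr (p - 1) * \<kappa> powr (- p) * g (r / \<kappa>))"
  unfolding flux_form_def
proof (intro allI impI conjI)
  fix r assume r: "0 < r \<and> ereal r < R'"
  then have q: "0 < r / \<kappa>" "ereal (r / \<kappa>) < R" using l R by auto
  let ?q = "r / \<kappa>" and ?\<theta> = "1 / (p - 1)"
  have F: "0 < F ?q" and Du: "(u has_real_derivative - ((?q powr (1 - real N) * F ?q) powr ?\<theta>)) (at ?q)"
    and DF: "(F has_real_derivative ?q powr (real N - 1) * g ?q) (at ?q)"
    using ff q by (auto simp: flux_form_def)
  show "0 < x powr (p - 1) * \<kappa> powr (real N - p) * F ?q" using x l F by simp
  have Dq: "((\<lambda>r. r / \<kappa>) has_real_derivative 1 / \<kappa>) (at r)"
    using DERIV_cdivide[OF DERIV_ident, of \<kappa>] by simp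
  have "((\<lambda>r. x * u (r / \<kappa>)) has_real_derivative
     x * (- ((?q powr (1 - real N) * F ?q) powr ?\<theta>) * (1 / \<kappa>))) (at r)"
    by (rule DERIV_cmult[OF DERIV_chain2[OF Du Dq]])
  moreover have "(r powr (1 - real N) * (x powr (p - 1) * \<kappa> powr (real N - p) * F ?q)) powr ?\<theta>
      = x / \<kappa> * (?q powr (1 - real N) * F ?q) powr ?\<theta>"
  proof -
    have "r powr (1 - real N) = \<kappa> powr (1 - real N) * ?q powr (1 - real N)"
      using r l by (simp add: powr_mult[symmetric])
    then have "r powr (1 - real N) * (x powr (p - 1) * \<kappa> powr (real N - p) * F ?q)
        = x powr (p - 1) * \<kappa> powr (1 - p) * (?q powr (1 - real N) * F ?q)"
      by (simp add: powr_add[symmetric] mult_ac)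
    also have "\<dots> powr ?\<theta> = x / \<kappa> * (?q powr (1 - real N) * F ?q) powr ?\<theta>"
    proof -
      have "(1 - p) * ?\<theta> = - 1" "(p - 1) * ?\<theta> = 1" using p by (simp_all add: field_simps)
      then show ?thesis
        using x l F by (simp add: powr_mult powr_powr powr_minus_divide)
    qed
    finally show ?thesis .
  qed
  ultimately show "((\<lambda>r. x * u (r / \<kappa>)) has_real_derivative
      - ((r powr (1 - real N) * (x powr (p - 1) * \<kappa> powr (real N - p) * F ?q)) powr ?\<theta>)) (at r)"
    by simp
  have "((\<lambda>r. x powr (p - 1) * \<kappa> powr (real N - p) * F (r / \<kappa>)) has_real_derivative
     x powr (p - 1) * \<kappa> powr (real N - p) * (?q powr (real N - 1) * g ?q * (1 / \<kappa>))) (at r)"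
    by (rule DERIV_cmult[OF DERIV_chain2[OF DF Dq]])
  moreover have "x powr (p - 1) * \<kappa> powr (real N - p) * (?q powr (real N - 1) * g ?q * (1 / \<kappa>))
     = r powr (real N - 1) * (x powr (p - 1) * \<kappa> powr (- p) * g ?q)"
  proof -
    have "r powr (real N - 1) = \<kappa> powr (real N - 1) * ?q powr (real N - 1)"
      using r l by (simp add: powr_mult[symmetric])
    moreover have "\<kappa> powr (real N - p) = \<kappa> * (\<kappa> powr (real N - 1) * \<kappa> powr (- p))"
      using l powr_one[of \<kappa>] by (smt (verit) powr_add)
    ultimately show ?thesis using l by (simp add: mult_ac)
  qed
  ultimately show "((\<lambda>r. x powr (p - 1) * \<kappa> powr (real N - p) * F (r / \<kappa>)) has_real_derivative
     r powr (real N - 1) * (x powr (p - 1) * \<kappa> powr (- p) * g (r / \<kappa>))) (at r)" by simp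
qed

lemma ereal_between:
  assumes "ereal r < R" obtains r' where "r < r'" "ereal r' < R"
  using assms ereal_dense2[of "ereal r" R] by (cases R) auto

lemma (in radial_exponents) slope_eq_flux:
  assumes p: "1 < p" and cc: "c = real N + a" and dd: "d = (p + a) / (p - 1)" and tt: "\<theta> = 1 / (p - 1)"
    and \<alpha>: "0 < \<alpha>" and r0: "0 < r" and mean: "0 \<le> radial_mean c h r"
  shows "\<alpha> * (d * r powr (d - 1) * radial_mean c h r powr \<theta>)
      = (r powr (1 - real N) * ((\<alpha> * d) powr (p - 1) * mass c h r)) powr (1 / (p - 1))"
proof -
  have e1: "(p - 1) * \<theta> = 1" using p tt by simp
  have e2: "(1 - real N) * \<theta> = d - 1 - c * \<theta>"
  proof -
    have "d * (p - 1) = p + a" "\<theta> * (p - 1) = 1" using p by (simp_all add: dd tt)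
    then have "((1 - real N) * \<theta>) * (p - 1) = (d - 1 - c * \<theta>) * (p - 1)"
      by (simp add: cc left_diff_distrib mult.assoc)
    then show ?thesis using p by simp
  qed
  have "0 \<le> mass c h r" using mean by (simp add: mass_def)
  then have "(r powr (1 - real N) * ((\<alpha> * d) powr (p - 1) * mass c h r)) powr \<theta>
      = r powr ((1 - real N) * \<theta>) * ((\<alpha> * d) * mass c h r powr \<theta>)"
    using e1 r0 \<alpha> d_pos by (simp add: powr_mult powr_powr)
  also have "\<dots> = \<alpha> * (d * r powr (d - 1) * radial_mean c h r powr \<theta>)"
    unfolding e2 mean_powr_eq_mass[OF mean r0]
    using powr_add[of r "d - 1" "- (c * \<theta>)"] by simp
  finally show ?thesis by (simp add: tt)
qed

lemma (in radial_exponents) radius_times_slope: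
  assumes "1 < p" "c = real N + a" "d = (p + a) / (p - 1)" "\<theta> = 1 / (p - 1)" "0 < \<alpha>" "0 < r"
    "0 \<le> radial_mean c h r"
  shows "\<alpha> * (d * r powr d * radial_mean c h r powr \<theta>)
      = r * (r powr (1 - real N) * ((\<alpha> * d) powr (p - 1) * mass c h r)) powr (1 / (p - 1))"
proof -
  have "r powr d = r * r powr (d - 1)" using powr_mult_base[of r "d - 1"] assms(6) by simp
  then show ?thesis unfolding slope_eq_flux[OF assms, symmetric] by (simp only: mult_ac)
qed

lemma (in radial_exponents) descent_flux_form:
  assumes p: "1 < p" and cc: "c = real N + a" and dd: "d = (p + a) / (p - 1)" and tt: "\<theta> = 1 / (p - 1)"
    and \<alpha>: "0 < \<alpha>" and h: "continuous_on (half_open_range R) h"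
    and hpos: "\<And>x. x \<in> half_open_range R \<Longrightarrow> 0 < h x" and h1: "\<And>x. x \<in> half_open_range R \<Longrightarrow> h x \<le> 1"
    and u: "\<And>r. r \<in> half_open_range R \<Longrightarrow> u r = 1 - \<alpha> * descent c d \<theta> h r"
  shows "flux_form N p R u (\<lambda>r. (\<alpha> * d) powr (p - 1) * mass c h r)
     (\<lambda>r. (\<alpha> * d) powr (p - 1) * c * r powr a * h r)"
  unfolding flux_form_def
proof (intro allI impI)
  fix r assume r: "0 < r \<and> ereal r < R"
  then have r0: "0 < r" by simp
  obtain R0 where R0: "r < R0" "ereal R0 < R" using r ereal_between by blast
  have inR: "x \<in> half_open_range R" if "0 \<le> x" "x \<le> R0" for x
  proof -
    have "ereal x < R" using that R0(2) by (meson ereal_less_eq(3) le_less_trans)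
    then show ?thesis using that by (simp add: half_open_range_def)
  qed
  \<comment> \<open>Freezing \<open>h\<close> beyond \<open>R0\<close> changes nothing before \<open>R0\<close> and gives a source on the whole
    half-line.\<close>
  define k where "k = (\<lambda>x. h (min x R0))"
  have k: "continuous_on {0..} k" "\<And>x. 0 \<le> x \<Longrightarrow> 0 < k x" "\<And>x. 0 \<le> x \<Longrightarrow> k x \<le> 1"
    unfolding k_def
    by (rule continuous_on_compose2[OF h], auto intro!: continuous_intros inR hpos h1)
       (use R0 r0 in auto)
  have k0: "0 \<le> k x" if "0 \<le> x" for x using k(2)[OF that] by simp
  have kh: "k x = h x" if "x \<le> R0" for x using that by (simp add: k_def)
  have mass_eq: "mass c h x = mass c k x" if "0 < x" "x < R0" for x
    unfolding mass_def using radial_mean_cong[OF c_pos, of x h k] kh that by auto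
  have u_eq: "u x = 1 - \<alpha> * descent c d \<theta> k x" if "0 < x" "x < R0" for x
    using u[OF inR, of x] descent_cong[of x h k] kh that by auto
  have mk: "0 < mass c k r"
  proof -
    have "0 \<le> radial_mean c k r" by (rule radial_mean_nonneg) (use c_pos r0 k0 in auto)
    obtain lo where lo: "\<And>x. x \<in> {0..r} \<Longrightarrow> lo \<le> k x" "0 < lo"
    proof -
      have "compact {0..r}" "{0..r} \<noteq> {}" using r0 by auto
      from continuous_attains_inf[OF this continuous_on_subset[OF k(1)]]
      obtain x where "x \<in> {0..r}" "\<forall>y\<in>{0..r}. k x \<le> k y" by auto
      then show thesis using that[of "k x"] k(2)[of x] by auto
    qed
    then have "lo \<le> radial_mean c k r"
      by (intro mean_bounds(1)[OF k(1)]) (use r0 k(3) in auto)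
    then show ?thesis using lo(2) r0 by (simp add: mass_def)
  qed
  have nb: "open {0<..<R0}" "r \<in> {0<..<R0}" using r0 R0 by auto
  have pos: "0 < (\<alpha> * d) powr (p - 1) * mass c h r" using mk mass_eq[of r] r0 R0 \<alpha> d_pos by simp
  have "((\<lambda>r. 1 - \<alpha> * descent c d \<theta> k r) has_real_derivative
      0 - \<alpha> * (d * r powr (d - 1) * radial_mean c k r powr \<theta>)) (at r)"
    by (intro DERIV_diff DERIV_const DERIV_cmult has_real_derivative_descent k k0 r0)
  then have "(u has_real_derivative 0 - \<alpha> * (d * r powr (d - 1) * radial_mean c k r powr \<theta>)) (at r)"
    by (rule has_field_derivative_transform_within_open[OF _ nb]) (simp add: u_eq)
  moreover have "0 \<le> radial_mean c k r" by (rule radial_mean_nonneg) (use c_pos r0 k0 in auto)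
  from slope_eq_flux[OF p cc dd tt \<alpha> r0 this]
  have "\<alpha> * (d * r powr (d - 1) * radial_mean c k r powr \<theta>)
      = (r powr (1 - real N) * ((\<alpha> * d) powr (p - 1) * mass c h r)) powr (1 / (p - 1))"
    using mass_eq[of r] r0 R0 by simp
  ultimately have Du: "(u has_real_derivative
      - ((r powr (1 - real N) * ((\<alpha> * d) powr (p - 1) * mass c h r)) powr (1 / (p - 1)))) (at r)" by simp
  have "((\<lambda>r. (\<alpha> * d) powr (p - 1) * mass c k r) has_real_derivative
      (\<alpha> * d) powr (p - 1) * (c * r powr (c - 1) * k r)) (at r)"
    by (intro DERIV_cmult has_real_derivative_mass k r0)
  then have "((\<lambda>r. (\<alpha> * d) powr (p - 1) * mass c h r) has_real_derivative
      (\<alpha> * d) powr (p - 1) * (c * r powr (c - 1) * k r)) (at r)"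
    by (rule has_field_derivative_transform_within_open[OF _ nb]) (simp add: mass_eq)
  moreover have "r powr (c - 1) = r powr (real N - 1) * r powr a"
    by (simp add: powr_add[symmetric] cc algebra_simps)
  moreover have "k r = h r" using kh[of r] R0 by simp
  ultimately have DF: "((\<lambda>r. (\<alpha> * d) powr (p - 1) * mass c h r) has_real_derivative
      r powr (real N - 1) * ((\<alpha> * d) powr (p - 1) * c * r powr a * h r)) (at r)"
    by (simp add: mult_ac)
  show "0 < (\<alpha> * d) powr (p - 1) * mass c h r \<and>
      (u has_real_derivative
       - ((r powr (1 - real N) * ((\<alpha> * d) powr (p - 1) * mass c h r)) powr (1 / (p - 1)))) (at r) \<and>
      ((\<lambda>r. (\<alpha> * d) powr (p - 1) * mass c h r) has_real_derivative
       r powr (real N - 1) * ((\<alpha> * d) powr (p - 1) * c * r powr a * h r)) (at r)"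
    using pos Du DF by blast
qed

section \<open>The scalar subcritical equation\<close>

lemma nonneg_of_vanishing_lower_bound:
  fixes K c r y :: real
  assumes "0 < c" "0 < r" "\<And>x. 0 < x \<Longrightarrow> x < r \<Longrightarrow> - (K * x powr c) \<le> y"
  shows "0 \<le> y"
proof -
  have "((\<lambda>x. x powr c) \<longlongrightarrow> 0) (at_right 0)"
    using assms(1) by (intro tendsto_zero_powrI[where b = c]) (auto simp: eventually_at_filter intro: tendsto_ident_at)
  then have "((\<lambda>x. - (K * x powr c)) \<longlongrightarrow> - (K * 0)) (at_right 0)"
    by (intro tendsto_intros)
  moreover have "eventually (\<lambda>x. - (K * x powr c) \<le> y) (at_right 0)"
    using eventually_at_right_less[of 0] eventually_at_right_field[of _ 0] assms(2,3)
    by (auto simp: eventually_at_right_field)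
  ultimately show ?thesis
    using tendsto_upperbound[of "\<lambda>x. - (K * x powr c)"] by fastforce
qed

lemma powr_neg_at_top:
  fixes e :: real assumes "e < 0"
  shows "((\<lambda>x::real. x powr e) \<longlongrightarrow> 0) at_top"
  using tendsto_neg_powr[OF assms filterlim_ident] .

text \<open>An entire positive solution of \<open>-\<Delta>\<^sub>p u = C r\<^sup>a u\<^sup>s\<close>. The bound on \<open>F\<close> expresses regularity at the
  origin.\<close>

locale scalar_flux =
  fixes N :: nat and p a s C K :: real and u F :: "real \<Rightarrow> real"
  assumes p: "1 < p" "p < real N" and pa: "0 < p + a" and s: "0 \<le> s" and C: "0 < C"
    and ff: "flux_form N p \<infinity> u F (\<lambda>r. C * r powr a * u r powr s)"
    and u_pos: "\<And>r. 0 < r \<Longrightarrow> 0 < u r" and u_le: "\<And>r. 0 < r \<Longrightarrow> u r \<le> 1"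
    and F_le: "\<And>r. 0 < r \<Longrightarrow> F r \<le> K * r powr (real N + a)"
begin

definition "A = (real N - p) / (p - 1)"
definition "\<theta> = 1 / (p - 1)"
definition "c = real N + a"

lemma A_pos: "0 < A" and theta_pos: "0 < \<theta>" and c_pos: "0 < c"
  using p pa by (auto simp: A_def \<theta>_def c_def)

lemma A_eq: "(1 - real N) * \<theta> = - A - 1"
  using p by (simp add: A_def \<theta>_def field_simps)

lemma F_pos: "0 < r \<Longrightarrow> 0 < F r"
  and DF: "0 < r \<Longrightarrow> (F has_real_derivative C * r powr (c - 1) * u r powr s) (at r)"
  and Du: "0 < r \<Longrightarrow> (u has_real_derivative - (r powr (- A - 1) * F r powr \<theta>)) (at r)"
proof -
  assume r: "0 < r"
  show F: "0 < F r" using ff r by (simp add: flux_form_def)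
  have "real N - 1 + a = c - 1" by (simp add: c_def)
  then have "r powr (c - 1) = r powr (real N - 1) * r powr a" by (metis powr_add)
  moreover have "(F has_real_derivative r powr (real N - 1) * (C * r powr a * u r powr s)) (at r)"
    using ff r by (simp add: flux_form_def)
  ultimately show "(F has_real_derivative C * r powr (c - 1) * u r powr s) (at r)"
    by (simp only: mult_ac)
  have "(r powr (1 - real N) * F r) powr \<theta> = r powr (- A - 1) * F r powr \<theta>"
    using r F by (simp add: powr_mult powr_powr A_eq)
  moreover have "(u has_real_derivative - ((r powr (1 - real N) * F r) powr \<theta>)) (at r)"
    using ff r by (simp add: flux_form_def \<theta>_def)
  ultimately show "(u has_real_derivative - (r powr (- A - 1) * F r powr \<theta>)) (at r)"
    by (simp only:)
qed

lemma F_mono: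
  assumes "0 < r" "r \<le> r'"
  shows "F r \<le> F r'"
proof (rule DERIV_nonneg_imp_nondecreasing[where f = F, OF assms(2)])
  fix x assume "r \<le> x"
  then have "0 < x" using assms by simp
  from DF[OF this] C \<open>0 < x\<close> show "\<exists>y. (F has_real_derivative y) (at x) \<and> 0 \<le> y"
    by (intro exI conjI) auto
qed

lemma u_antimono:
  assumes "0 < r" "r \<le> r'"
  shows "u r' \<le> u r"
proof (rule DERIV_nonpos_imp_nonincreasing[where f = u, OF assms(2)])
  fix x assume "r \<le> x"
  then have "0 < x" using assms by simp
  from Du[OF this] show "\<exists>y. (u has_real_derivative y) (at x) \<and> y \<le> 0"
    by (intro exI conjI) auto
qed

text \<open>An entire positive solution lies above the \<open>p\<close>-harmonic function that has its flux at \<open>r\<close> and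
  vanishes at infinity; this is \<open>X \<le> A\<close>.\<close>

lemma slope_bound:
  assumes r: "0 < r"
  shows "r powr (- A) * F r powr \<theta> \<le> A * u r"
proof -
  let ?K = "F r powr \<theta>"
  have K: "0 < ?K" using F_pos[OF r] by simp
  have ge: "- (?K / A * x powr (- A)) \<le> u r - ?K / A * r powr (- A)" if x: "r \<le> x" for x
  proof -
    have "u x - ?K / A * x powr (- A) \<le> u r - ?K / A * r powr (- A)"
    proof (rule DERIV_nonpos_imp_nonincreasing[OF x])
      fix y assume y: "r \<le> y" "y \<le> x"
      have y0: "0 < y" using y r by simp
      have "((\<lambda>x. u x - ?K / A * x powr (- A)) has_real_derivative
          - (y powr (- A - 1) * F y powr \<theta>) - ?K / A * (- A * y powr (- A - 1))) (at y)"
        by (intro DERIV_diff Du[OF y0] DERIV_cmult has_real_derivative_powr y0)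
      moreover have "?K / A * (- A * y powr (- A - 1)) = - (y powr (- A - 1) * ?K)"
        using A_pos by simp
      moreover have "y powr (- A - 1) * ?K \<le> y powr (- A - 1) * F y powr \<theta>"
        using F_mono[OF r y(1)] F_pos[OF r] theta_pos by (intro mult_left_mono powr_mono2) auto
      ultimately show "\<exists>z. ((\<lambda>x. u x - ?K / A * x powr (- A)) has_real_derivative z) (at y) \<and> z \<le> 0"
        by (intro exI conjI) (assumption, linarith)
    qed
    then show ?thesis using u_pos[of x] x r by linarith
  qed
  have "((\<lambda>x. - (?K / A * x powr (- A))) \<longlongrightarrow> - (?K / A * 0)) at_top"
    using A_pos by (intro tendsto_minus tendsto_mult tendsto_const powr_neg_at_top) simp
  moreover have "eventually (\<lambda>x. - (?K / A * x powr (- A)) \<le> u r - ?K / A * r powr (- A)) at_top"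
    using eventually_ge_at_top[of r] by eventually_elim (rule ge)
  ultimately have "- (?K / A * 0) \<le> u r - ?K / A * r powr (- A)"
    by (rule tendsto_upperbound) simp
  then show ?thesis using A_pos by (simp add: field_simps)
qed

text \<open>The flux is the integral of the source, in which \<open>u\<close> may be replaced by its smallest value
  \<open>u(r)\<close>.\<close>

lemma flux_lower:
  assumes r: "0 < r"
  shows "C * u r powr s * r powr c / c \<le> F r"
proof -
  let ?q = "C * u r powr s / c"
  have "- (?q * x powr c) \<le> F r - ?q * r powr c" if x: "0 < x" "x < r" for x
  proof -
    have "F x - ?q * x powr c \<le> F r - ?q * r powr c"
    proof (rule DERIV_nonneg_imp_nondecreasing[where f = "\<lambda>x. F x - ?q * x powr c", OF less_imp_le[OF x(2)]])
      fix y assume y: "x \<le> y" "y \<le> r"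
      have y0: "0 < y" using y x by simp
      have "((\<lambda>x. F x - ?q * x powr c) has_real_derivative
          C * y powr (c - 1) * u y powr s - ?q * (c * y powr (c - 1))) (at y)"
        by (intro DERIV_diff DF[OF y0] DERIV_cmult has_real_derivative_powr y0)
      moreover have "?q * (c * y powr (c - 1)) = C * y powr (c - 1) * u r powr s"
        using c_pos by simp
      moreover have "C * y powr (c - 1) * u r powr s \<le> C * y powr (c - 1) * u y powr s"
        using u_antimono[OF y0 y(2)] u_pos[OF r] s C by (intro mult_left_mono powr_mono2) auto
      ultimately show "\<exists>z. ((\<lambda>x. F x - ?q * x powr c) has_real_derivative z) (at y) \<and> 0 \<le> z"
        by (intro exI conjI) (assumption, linarith)
    qed
    then show ?thesis using F_pos[OF x(1)] by linarith
  qed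
  from nonneg_of_vanishing_lower_bound[OF c_pos r this] show ?thesis by simp
qed

lemma flux_upper:
  assumes r: "0 < r"
  shows "F r \<le> A powr (p - 1) * r powr (real N - p) * u r powr (p - 1)"
proof -
  have "(r powr (- A) * F r powr \<theta>) powr (p - 1) \<le> (A * u r) powr (p - 1)"
    using slope_bound[OF r] p by (intro powr_mono2) auto
  moreover have "(r powr (- A) * F r powr \<theta>) powr (p - 1) = r powr (p - real N) * F r"
    using F_pos[OF r] r p by (simp add: powr_mult powr_powr A_def \<theta>_def)
  ultimately have "r powr (real N - p) * (r powr (p - real N) * F r)
      \<le> r powr (real N - p) * (A powr (p - 1) * u r powr (p - 1))"
    using A_pos u_pos[OF r] by (intro mult_left_mono) (simp_all add: powr_mult)
  moreover have "r powr (real N - p) * (r powr (p - real N) * F r) = F r"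
    using powr_add[of r "real N - p" "p - real N"] r by (simp add: mult.assoc[symmetric])
  ultimately show ?thesis by (simp only: mult_ac)
qed

definition "B = c * A powr (p - 1) / C"

lemma B_pos: "0 < B" using c_pos A_pos C by (simp add: B_def)

text \<open>The lower bound of the flux by the source against its upper bound by \<open>u\<close>.\<close>

lemma decay:
  assumes r: "0 < r"
  shows "u r powr (s - (p - 1)) \<le> B * r powr (- (p + a))"
proof -
  have "C * u r powr s * r powr c / c \<le> A powr (p - 1) * r powr (real N - p) * u r powr (p - 1)"
    using flux_lower[OF r] flux_upper[OF r] by simp
  then have "u r powr s * r powr c \<le> B * r powr (real N - p) * u r powr (p - 1)"
    using C c_pos by (simp add: B_def field_simps)
  then have "(u r powr s * r powr c) * (u r powr (- (p - 1)) * r powr (- c))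
      \<le> (B * r powr (real N - p) * u r powr (p - 1)) * (u r powr (- (p - 1)) * r powr (- c))"
    by (rule mult_right_mono) simp
  moreover have "(u r powr s * r powr c) * (u r powr (- (p - 1)) * r powr (- c)) = u r powr (s - (p - 1))"
  proof -
    have "(u r powr s * r powr c) * (u r powr (- (p - 1)) * r powr (- c))
       = (u r powr s * u r powr (- (p - 1))) * (r powr c * r powr (- c))" by (simp only: mult_ac)
    moreover have "u r powr s * u r powr (- (p - 1)) = u r powr (s - (p - 1))"
      unfolding powr_add[symmetric] by (simp only: add_uminus_conv_diff)
    ultimately show ?thesis using r by (simp add: powr_add[symmetric])
  qed
  moreover have "(B * r powr (real N - p) * u r powr (p - 1)) * (u r powr (- (p - 1)) * r powr (- c))
      = B * r powr (- (p + a))"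
  proof -
    have "(B * r powr (real N - p) * u r powr (p - 1)) * (u r powr (- (p - 1)) * r powr (- c))
      = B * (r powr (real N - p) * r powr (- c)) * (u r powr (p - 1) * u r powr (- (p - 1)))"
      by (simp only: mult_ac)
    moreover have "r powr (real N - p) * r powr (- c) = r powr (- (p + a))"
      unfolding powr_add[symmetric] by (simp add: c_def)
    moreover have "u r powr (p - 1) * u r powr (- (p - 1)) = 1"
      unfolding powr_add[symmetric] using u_pos[OF r] by simp
    ultimately show ?thesis by (simp only: mult_1_right)
  qed
  ultimately show ?thesis by (simp only:)
qed

text \<open>For \<open>s \<le> p - 1\<close> the left-hand side of the decay estimate is at least \<open>1\<close>, whereas the right-hand
  side tends to \<open>0\<close>.\<close>

lemma source_superlinear: "p - 1 < s"
proof (rule ccontr)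
  assume "\<not> p - 1 < s"
  then have "1 \<le> B * r powr (- (p + a))" if "0 < r" for r
  proof -
    have "1 = 1 powr (s - (p - 1))" by simp
    also have "\<dots> \<le> u r powr (s - (p - 1))"
      using \<open>\<not> p - 1 < s\<close> u_pos[OF that] u_le[OF that] by (intro powr_mono2') auto
    finally show ?thesis using decay[OF that] by linarith
  qed
  then have "eventually (\<lambda>r. 1 \<le> B * r powr (- (p + a))) at_top"
    by (rule eventually_mono[OF eventually_gt_at_top[of 0]])
  moreover have "((\<lambda>r. B * r powr (- (p + a))) \<longlongrightarrow> B * 0) at_top"
    using pa by (intro tendsto_mult tendsto_const powr_neg_at_top) simp
  ultimately have "1 \<le> B * 0" by (intro tendsto_lowerbound) auto
  then show False by simp
qed

text \<open>The Pohozaev functional \<open>r\<^sup>N ((p-1)/p |u'|\<^sup>p + C r\<^sup>a u\<^sup>s\<^sup>+\<^sup>1/(s+1)) + (N-p)/p r\<^sup>N\<^sup>-\<^sup>1 |u'|\<^sup>p\<^sup>-\<^sup>2 u' u\<close>, expressed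
  through the flux.\<close>

definition energy :: "real \<Rightarrow> real" where
  "energy r = (p - 1) / p * (r powr (- A) * F r powr (1 + \<theta>))
     + C / (s + 1) * (r powr c * u r powr (s + 1)) - (real N - p) / p * (F r * u r)"

lemma energy_derivative:
  assumes r: "0 < r"
  shows "(energy has_real_derivative
    C * (c / (s + 1) - (real N - p) / p) * r powr (c - 1) * u r powr (s + 1)) (at r)"
proof -
  have u0: "0 < u r" and F0: "0 < F r" using u_pos F_pos r by auto
  let ?F' = "C * r powr (c - 1) * u r powr s" and ?u' = "- (r powr (- A - 1) * F r powr \<theta>)"
  have DFp: "((\<lambda>r. F r powr (1 + \<theta>)) has_real_derivative ((1 + \<theta>) * F r powr (1 + \<theta> - 1)) * ?F') (at r)"
    by (rule DERIV_chain2[where f = "\<lambda>z. z powr (1 + \<theta>)", OF has_real_derivative_powr[OF F0] DF[OF r]])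
  have Dup: "((\<lambda>r. u r powr (s + 1)) has_real_derivative ((s + 1) * u r powr (s + 1 - 1)) * ?u') (at r)"
    by (rule DERIV_chain2[where f = "\<lambda>z. z powr (s + 1)", OF has_real_derivative_powr[OF u0] Du[OF r]])
  have "(energy has_real_derivative
      (p - 1) / p * ((- A * r powr (- A - 1)) * F r powr (1 + \<theta>)
          + ((1 + \<theta>) * F r powr (1 + \<theta> - 1)) * ?F' * r powr (- A))
      + C / (s + 1) * ((c * r powr (c - 1)) * u r powr (s + 1)
          + ((s + 1) * u r powr (s + 1 - 1)) * ?u' * r powr c)
      - (real N - p) / p * (?F' * u r + ?u' * F r)) (at r)"
    unfolding energy_def[abs_def]
    by (intro DERIV_diff DERIV_add DERIV_cmult DERIV_mult has_real_derivative_powr r DFp Dup DF Du)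
  moreover have "(p - 1) / p * ((- A * r powr (- A - 1)) * F r powr (1 + \<theta>)
          + ((1 + \<theta>) * F r powr (1 + \<theta> - 1)) * ?F' * r powr (- A))
      + C / (s + 1) * ((c * r powr (c - 1)) * u r powr (s + 1)
          + ((s + 1) * u r powr (s + 1 - 1)) * ?u' * r powr c)
      - (real N - p) / p * (?F' * u r + ?u' * F r)
    = C * (c / (s + 1) - (real N - p) / p) * r powr (c - 1) * u r powr (s + 1)"
  proof -
    define X where "X = r powr (- A - 1)"
    define Y where "Y = r powr (c - 1)"
    define P where "P = F r powr \<theta>"
    define Q where "Q = u r powr s"
    have e: "r powr (- A) = X * r" "r powr c = Y * r" "F r powr (1 + \<theta>) = F r * P"
      "u r powr (s + 1) = u r * Q"
      using r u0 F0 powr_mult_base[of r "- A - 1"] powr_mult_base[of r "c - 1"]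
      by (simp_all add: X_def Y_def P_def Q_def powr_add mult_ac)
    have k: "(p - 1) / p * A = (real N - p) / p" "(p - 1) / p * (1 + \<theta>) = 1"
      using p by (simp_all add: A_def \<theta>_def field_simps)
    have s1: "s + 1 \<noteq> 0" using s by simp
    have "q * ((- A * X) * (F r * P) + ((1 + \<theta>) * P) * (C * Y * Q) * (X * r))
        = - (q * A) * (X * (F r * P)) + (q * (1 + \<theta>)) * (P * (C * Y * Q) * (X * r))" for q
      by (simp add: algebra_simps)
    from this[of "(p - 1) / p"]
    have "(p - 1) / p * ((- A * X) * (F r * P) + ((1 + \<theta>) * P) * (C * Y * Q) * (X * r))
        = - ((p - 1) / p * A) * (X * (F r * P)) + ((p - 1) / p * (1 + \<theta>)) * (P * (C * Y * Q) * (X * r))" .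
    also have "\<dots> = - ((real N - p) / p) * (X * (F r * P)) + P * (C * Y * Q) * (X * r)"
      unfolding k by simp
    finally have t1: "(p - 1) / p * ((- A * X) * (F r * P) + ((1 + \<theta>) * P) * (C * Y * Q) * (X * r))
        = - ((real N - p) / p) * (X * (F r * P)) + P * (C * Y * Q) * (X * r)" .
    have t2: "C / (s + 1) * ((c * Y) * (u r * Q) + ((s + 1) * Q) * (- (X * P)) * (Y * r))
        = C * (c / (s + 1)) * Y * (u r * Q) - C * Q * X * P * Y * r"
      using s1 by (simp add: field_simps)
    have "- n * (X * (F r * P)) + P * (C * Y * Q) * (X * r)
        + (C * w * Y * (u r * Q) - C * Q * X * P * Y * r) - n * (C * Y * Q * u r + - (X * P) * F r)
      = C * (w - n) * Y * (u r * Q)" for n w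
      by (simp add: algebra_simps)
    from this[of "(real N - p) / p" "c / (s + 1)"]
    have "- ((real N - p) / p) * (X * (F r * P)) + P * (C * Y * Q) * (X * r)
        + (C * (c / (s + 1)) * Y * (u r * Q) - C * Q * X * P * Y * r)
        - (real N - p) / p * (C * Y * Q * u r + - (X * P) * F r)
      = C * (c / (s + 1) - (real N - p) / p) * Y * (u r * Q)"
      .
    then show ?thesis
      using t1 t2 by (simp add: e X_def[symmetric] Y_def[symmetric] P_def[symmetric] Q_def[symmetric])
  qed
  ultimately show ?thesis by simp
qed

lemma energy_strict_mono:
  assumes sub: "s < (real N * (p - 1) + p + p * a) / (real N - p)" and xy: "0 < x" "x < y"
  shows "energy x < energy y"
proof (rule DERIV_pos_imp_increasing[where f = energy, OF xy(2)])
  have "s * (real N - p) < real N * (p - 1) + p + p * a"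
    using sub p by (simp add: pos_less_divide_eq)
  then have "(real N - p) * (s + 1) < c * p" by (simp add: c_def algebra_simps)
  then have "(real N - p) / p < c / (s + 1)"
    using p s by (simp add: pos_less_divide_eq pos_divide_less_eq mult.commute)
  then have coef: "0 < c / (s + 1) - (real N - p) / p" by simp
  fix z assume "x \<le> z" "z \<le> y"
  then have z: "0 < z" using xy by simp
  have "0 < C * (c / (s + 1) - (real N - p) / p) * z powr (c - 1) * u z powr (s + 1)"
    using coef C u_pos[OF z] z by (intro mult_pos_pos) auto
  with energy_derivative[OF z] show "\<exists>d. (energy has_real_derivative d) (at z) \<and> 0 < d"
    by blast
qed

lemma energy_mono:
  assumes "s < (real N * (p - 1) + p + p * a) / (real N - p)" "0 < x" "x \<le> y"
  shows "energy x \<le> energy y"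
  using energy_strict_mono[OF assms(1,2), of y] assms(3) by (cases "x = y") auto

lemma energy_2_pos:
  assumes sub: "s < (real N * (p - 1) + p + p * a) / (real N - p)"
  shows "0 < energy 2"
proof -
  have low: "- ((real N - p) / p * K * x powr c) \<le> energy x" if x: "0 < x" for x
  proof -
    have "(real N - p) / p * (F x * u x) \<le> (real N - p) / p * ((K * x powr c) * 1)"
      using p F_le[OF x] u_le[OF x] u_pos[OF x] F_pos[OF x]
      by (intro mult_left_mono mult_mono) (auto simp: c_def)
    moreover have "0 \<le> (p - 1) / p * (x powr (- A) * F x powr (1 + \<theta>))"
      "0 \<le> C / (s + 1) * (x powr c * u x powr (s + 1))"
      using p C s by auto
    ultimately show ?thesis unfolding energy_def by simp
  qed
  have "0 \<le> energy 1"
  proof (rule nonneg_of_vanishing_lower_bound[OF c_pos zero_less_one])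
    show "- ((real N - p) / p * K * x powr c) \<le> energy 1" if "0 < x" "x < 1" for x
      using low[OF that(1)] energy_mono[OF sub that(1), of 1] that by simp
  qed
  then show ?thesis using energy_strict_mono[OF sub, of 1 2] by simp
qed

lemma energy_upper:
  assumes r: "0 < r"
  shows "energy r \<le> (A powr p + c * A powr (p - 1)) * (r powr (real N - p) * u r powr p)"
proof -
  have u0: "0 < u r" and F0: "0 < F r" using u_pos F_pos r by auto
  have pw: "u r powr p = u r powr (p - 1) * u r" "A powr p = A powr (p - 1) * A"
    using powr_mult_base[of "u r" "p - 1"] powr_mult_base[of A "p - 1"] u0 A_pos by (simp_all add: mult.commute)
  have "r powr (- A) * F r powr (1 + \<theta>) = (r powr (- A) * F r powr \<theta>) * F r"
    using F0 by (simp add: powr_add)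
  also have "\<dots> \<le> (A * u r) * (A powr (p - 1) * r powr (real N - p) * u r powr (p - 1))"
    by (rule mult_mono[OF slope_bound[OF r] flux_upper[OF r]]) (use A_pos u0 F0 in auto)
  finally have 1: "r powr (- A) * F r powr (1 + \<theta>) \<le> A powr p * (r powr (real N - p) * u r powr p)"
    by (simp add: pw mult_ac)
  have "(p - 1) / p * (r powr (- A) * F r powr (1 + \<theta>)) \<le> 1 * (r powr (- A) * F r powr (1 + \<theta>))"
    using p by (intro mult_right_mono) auto
  moreover have "C / (s + 1) * (r powr c * u r powr (s + 1)) \<le> C * (r powr c * u r powr (s + 1))"
    using C s by (intro mult_right_mono) (auto simp: divide_le_eq)
  moreover have "C * (r powr c * u r powr (s + 1)) \<le> c * A powr (p - 1) * (r powr (real N - p) * u r powr p)"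
  proof -
    have "C * u r powr s * r powr c \<le> c * (A powr (p - 1) * r powr (real N - p) * u r powr (p - 1))"
      using order_trans[OF flux_lower[OF r] flux_upper[OF r]] c_pos by (simp add: pos_divide_le_eq mult.commute)
    then have "C * u r powr s * r powr c * u r
        \<le> c * (A powr (p - 1) * r powr (real N - p) * u r powr (p - 1)) * u r"
      using u0 by (intro mult_right_mono) auto
    then show ?thesis using u0 by (simp add: pw powr_add mult_ac)
  qed
  moreover have "0 \<le> (real N - p) / p * (F r * u r)" using p F0 u0 by simp
  ultimately show ?thesis using 1 unfolding energy_def by (simp add: distrib_right)
qed

text \<open>In the subcritical range the energy increases from its value \<open>0\<close> at the origin. On the other
  hand it is at most a multiple of \<open>r\<^sup>N\<^sup>-\<^sup>p u\<^sup>p\<close>, and the decay estimate turns this into a power of \<open>r\<close>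
  whose exponent \<open>e\<close> is negative exactly in the subcritical range.\<close>

lemma not_subcritical: "\<not> s < (real N * (p - 1) + p + p * a) / (real N - p)"
proof
  assume sub: "s < (real N * (p - 1) + p + p * a) / (real N - p)"
  define \<sigma> where "\<sigma> = s - (p - 1)"
  have sigma: "0 < \<sigma>" using source_superlinear by (simp add: \<sigma>_def)
  define M where "M = A powr p + c * A powr (p - 1)"
  have M: "0 < M" unfolding M_def using A_pos c_pos by (simp add: add_pos_pos)
  define e where "e = real N - p - (p + a) * (p / \<sigma>)"
  have "s * (real N - p) < real N * (p - 1) + p + p * a"
    using sub p by (simp add: pos_less_divide_eq)
  then have "(real N - p) * \<sigma> < (p + a) * p" by (simp add: \<sigma>_def algebra_simps)
  then have e: "e < 0" using sigma by (simp add: e_def field_simps)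
  have bound: "energy r \<le> M * B powr (p / \<sigma>) * r powr e" if r: "0 < r" for r
  proof -
    have "u r powr p = (u r powr \<sigma>) powr (p / \<sigma>)" using sigma by (simp add: powr_powr)
    also have "\<dots> \<le> (B * r powr (- (p + a))) powr (p / \<sigma>)"
      using decay[OF r] sigma p by (intro powr_mono2) (auto simp: \<sigma>_def)
    also have "\<dots> = B powr (p / \<sigma>) * r powr (- ((p + a) * (p / \<sigma>)))"
      using B_pos r by (simp add: powr_mult powr_powr minus_mult_left[symmetric] del: minus_add_distrib)
    finally have "r powr (real N - p) * u r powr p
        \<le> r powr (real N - p) * (B powr (p / \<sigma>) * r powr (- ((p + a) * (p / \<sigma>))))"
      by (intro mult_left_mono) auto
    also have "\<dots> = B powr (p / \<sigma>) * r powr e"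
      using powr_add[of r "real N - p" "- ((p + a) * (p / \<sigma>))"] by (simp add: e_def)
    finally have "M * (r powr (real N - p) * u r powr p) \<le> M * (B powr (p / \<sigma>) * r powr e)"
      using M by (intro mult_left_mono) auto
    with energy_upper[OF r] show ?thesis by (simp add: M_def mult.assoc)
  qed
  have "energy 2 \<le> energy r" if "2 \<le> r" for r
    using energy_mono[OF sub, of 2 r] that by simp
  then have "eventually (\<lambda>r. energy 2 \<le> M * B powr (p / \<sigma>) * r powr e) at_top"
    by (intro eventually_mono[OF eventually_ge_at_top[of 2]] order_trans[OF _ bound]) auto
  moreover have "((\<lambda>r. M * B powr (p / \<sigma>) * r powr e) \<longlongrightarrow> M * B powr (p / \<sigma>) * 0) at_top"
    by (intro tendsto_mult tendsto_const powr_neg_at_top e)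
  ultimately have "energy 2 \<le> M * B powr (p / \<sigma>) * 0" by (intro tendsto_lowerbound) auto
  then show False using energy_2_pos[OF sub] by simp
qed

end

section \<open>Rescaling and assembly\<close>

lemma flux_form_cong:
  assumes "flux_form N p R u F g" "\<And>r. r \<in> open_range R \<Longrightarrow> g r = g' r"
  shows "flux_form N p R u F g'"
  using assms by (simp add: flux_form_def open_range_def)

lemma flux_form_regular_solution:
  assumes p: "1 < p" and q: "1 < q" and N: "1 \<le> N" and R: "0 < R"
    and fu: "flux_form N p R u F (\<lambda>r. r powr a * u r powr s * v r powr \<delta>)"
    and fv: "flux_form N q R v G (\<lambda>r. r powr b * u r powr \<mu> * v r powr m)"
    and pos: "\<And>r. r \<in> open_range R \<Longrightarrow> 0 < u r \<and> 0 < v r"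
    and cont: "continuous_on (half_open_range R) u" "continuous_on (half_open_range R) v"
  shows "regular_radial_solution N p q a b s m \<delta> \<mu> R u v"
proof -
  have sub: "open_range R \<subseteq> half_open_range R" by (auto simp: open_range_def half_open_range_def)
  have cu: "continuous_on (open_range R) u" and cv: "continuous_on (open_range R) v"
    using cont continuous_on_subset sub by blast+
  have src: "continuous_on (open_range R) (\<lambda>r. r powr a' * u r powr s' * v r powr \<delta>')" for a' s' \<delta>'
    using pos by (intro continuous_on_mult continuous_on_powr cu cv continuous_on_id continuous_on_const)
      (force simp: open_range_def)+
  show ?thesis
    unfolding regular_radial_solution_def solves_radial_system_def
    using R pos cont flux_form_solves[OF fu p N] flux_form_solves[OF fv q N]
      flux_form_C2[OF fu p src] flux_form_C2[OF fv q src] by blast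
qed

text \<open>In logarithms this is a linear system with determinant \<open>P Q - \<delta> \<mu>\<close>, solved by Cramer's rule.\<close>

lemma normalising_factors:
  fixes P Q \<delta> \<mu> K1 K2 :: real
  assumes "\<delta> * \<mu> - P * Q \<noteq> 0" "0 < K1" "0 < K2"
  obtains x y where "0 < x" "0 < y" "x powr P * y powr (- \<delta>) * K1 = 1" "x powr (- \<mu>) * y powr Q * K2 = 1"
proof -
  define D where "D = \<delta> * \<mu> - P * Q"
  have D: "D \<noteq> 0" using assms by (simp add: D_def)
  define \<xi> where "\<xi> = (Q * ln K1 + \<delta> * ln K2) / D"
  define \<omega> where "\<omega> = (P * ln K2 + \<mu> * ln K1) / D"
  have "P * \<xi> - \<delta> * \<omega> = (P * (Q * ln K1 + \<delta> * ln K2) - \<delta> * (P * ln K2 + \<mu> * ln K1)) / D"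
    by (simp add: \<xi>_def \<omega>_def diff_divide_distrib)
  also have "P * (Q * ln K1 + \<delta> * ln K2) - \<delta> * (P * ln K2 + \<mu> * ln K1) = - ln K1 * D"
    by (simp add: D_def algebra_simps)
  finally have 1: "P * \<xi> - \<delta> * \<omega> = - ln K1" using D by simp
  have "Q * \<omega> - \<mu> * \<xi> = (Q * (P * ln K2 + \<mu> * ln K1) - \<mu> * (Q * ln K1 + \<delta> * ln K2)) / D"
    by (simp add: \<xi>_def \<omega>_def diff_divide_distrib)
  also have "Q * (P * ln K2 + \<mu> * ln K1) - \<mu> * (Q * ln K1 + \<delta> * ln K2) = - ln K2 * D"
    by (simp add: D_def algebra_simps)
  finally have 2: "Q * \<omega> - \<mu> * \<xi> = - ln K2" using D by simp
  have "exp \<xi> powr P * exp \<omega> powr (- \<delta>) * K1 = exp (P * \<xi> - \<delta> * \<omega>) * exp (ln K1)"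
    using assms by (simp add: powr_def exp_diff exp_minus field_simps)
  then have "exp \<xi> powr P * exp \<omega> powr (- \<delta>) * K1 = 1"
    unfolding 1 by (simp add: exp_minus)
  moreover have "exp \<xi> powr (- \<mu>) * exp \<omega> powr Q * K2 = exp (Q * \<omega> - \<mu> * \<xi>) * exp (ln K2)"
    using assms by (simp add: powr_def exp_diff exp_minus field_simps)
  then have "exp \<xi> powr (- \<mu>) * exp \<omega> powr Q * K2 = 1"
    unfolding 2 by (simp add: exp_minus)
  ultimately show thesis by (intro that[of "exp \<xi>" "exp \<omega>"]) auto
qed

lemma rescaled_source:
  fixes x y \<kappa> r :: real
  assumes pos: "0 < x" "0 < y" "0 < \<kappa>" "0 < r" "0 < U" "0 < V"
    and norm: "x powr (p - 1 - s) * y powr (- \<delta>) * (\<kappa> powr (- p - a) * C) = 1"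
  shows "x powr (p - 1) * \<kappa> powr (- p) * (C * (r / \<kappa>) powr a * (U powr s * V powr \<delta>))
      = r powr a * (x * U) powr s * (y * V) powr \<delta>"
proof -
  have e: "x powr (p - 1) = x powr (p - 1 - s) * x powr s" "y powr \<delta> * y powr (- \<delta>) = 1"
    "(r / \<kappa>) powr a = r powr a * \<kappa> powr (- a)"
    using pos by (simp_all add: powr_add[symmetric] powr_divide powr_minus_divide)
  have f: "\<kappa> powr (- p - a) = \<kappa> powr (- p) * \<kappa> powr (- a)"
    unfolding powr_add[symmetric] by simp
  have "x powr (p - 1) * \<kappa> powr (- p) * (C * (r / \<kappa>) powr a * (U powr s * V powr \<delta>))
    = x powr (p - 1) * \<kappa> powr (- p) * (C * (r / \<kappa>) powr a * (U powr s * V powr \<delta>))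
      * (y powr \<delta> * y powr (- \<delta>))"
    using e(2) by simp
  also have "\<dots> = (x powr (p - 1 - s) * y powr (- \<delta>) * (\<kappa> powr (- p - a) * C))
      * (r powr a * (x powr s * U powr s) * (y powr \<delta> * V powr \<delta>))"
    unfolding e(1,3) f by (simp only: mult_ac)
  also have "\<dots> = r powr a * (x * U) powr s * (y * V) powr \<delta>"
    unfolding norm using pos by (simp add: powr_mult)
  finally show ?thesis .
qed

lemma rescaled_regular_solution:
  fixes C1 C2 \<kappa> :: real
  assumes p: "1 < p" and q: "1 < q" and N: "1 \<le> N" and D: "\<delta> * \<mu> - (p - 1 - s) * (q - 1 - m) \<noteq> 0"
    and C: "0 < C1" "0 < C2" and k: "0 < \<kappa>" and R': "0 < R'"
    and R: "\<And>r. 0 \<le> r \<Longrightarrow> ereal r < R' \<Longrightarrow> ereal (r / \<kappa>) < R"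
    and fu: "flux_form N p R u F (\<lambda>r. C1 * r powr a * (u r powr s * v r powr \<delta>))"
    and fv: "flux_form N q R v G (\<lambda>r. C2 * r powr b * (u r powr \<mu> * v r powr m))"
    and pos: "\<And>r. r \<in> half_open_range R \<Longrightarrow> 0 < u r \<and> 0 < v r"
    and cont: "continuous_on (half_open_range R) u" "continuous_on (half_open_range R) v"
  obtains x y where "0 < x" "0 < y"
    "regular_radial_solution N p q a b s m \<delta> \<mu> R' (\<lambda>r. x * u (r / \<kappa>)) (\<lambda>r. y * v (r / \<kappa>))"
proof -
  have "0 < \<kappa> powr (- p - a) * C1" "0 < \<kappa> powr (- q - b) * C2" using C k by auto
  from normalising_factors[OF D this] obtain x y where xy: "0 < x" "0 < y"
    and n1: "x powr (p - 1 - s) * y powr (- \<delta>) * (\<kappa> powr (- p - a) * C1) = 1"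
    and n2: "x powr (- \<mu>) * y powr (q - 1 - m) * (\<kappa> powr (- q - b) * C2) = 1" by metis
  have RR: "r / \<kappa> \<in> half_open_range R" if "0 \<le> r" "ereal r < R'" for r
    using R that k by (simp add: half_open_range_def)
  have scaled: "x powr (p - 1) * \<kappa> powr (- p) * (C1 * (r / \<kappa>) powr a * (u (r / \<kappa>) powr s * v (r / \<kappa>) powr \<delta>))
      = r powr a * (x * u (r / \<kappa>)) powr s * (y * v (r / \<kappa>)) powr \<delta>"
    "y powr (q - 1) * \<kappa> powr (- q) * (C2 * (r / \<kappa>) powr b * (u (r / \<kappa>) powr \<mu> * v (r / \<kappa>) powr m))
      = r powr b * (x * u (r / \<kappa>)) powr \<mu> * (y * v (r / \<kappa>)) powr m" if r: "r \<in> open_range R'" for r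
  proof -
    have r0: "0 < r" "0 < u (r / \<kappa>)" "0 < v (r / \<kappa>)"
      using r RR[of r] pos by (auto simp: open_range_def)
    show "x powr (p - 1) * \<kappa> powr (- p) * (C1 * (r / \<kappa>) powr a * (u (r / \<kappa>) powr s * v (r / \<kappa>) powr \<delta>))
      = r powr a * (x * u (r / \<kappa>)) powr s * (y * v (r / \<kappa>)) powr \<delta>"
      by (rule rescaled_source[OF xy k r0 n1])
    have "y powr (q - 1 - m) * x powr (- \<mu>) * (\<kappa> powr (- q - b) * C2) = 1"
      using n2 by (simp only: mult_ac)
    from rescaled_source[OF xy(2,1) k r0(1,3,2) this]
    show "y powr (q - 1) * \<kappa> powr (- q) * (C2 * (r / \<kappa>) powr b * (u (r / \<kappa>) powr \<mu> * v (r / \<kappa>) powr m))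
      = r powr b * (x * u (r / \<kappa>)) powr \<mu> * (y * v (r / \<kappa>)) powr m"
      by (simp only: mult_ac)
  qed
  have cont': "continuous_on (half_open_range R') (\<lambda>r. z * f (r / \<kappa>))"
    if f: "continuous_on (half_open_range R) f" for f :: "real \<Rightarrow> real" and z
  proof -
    have "continuous_on (half_open_range R') (\<lambda>r. f (r / \<kappa>))"
      by (rule continuous_on_compose2[OF f])
         (use k RR in \<open>auto simp: half_open_range_def intro!: continuous_intros\<close>)
    then show ?thesis by (intro continuous_intros)
  qed
  have "regular_radial_solution N p q a b s m \<delta> \<mu> R' (\<lambda>r. x * u (r / \<kappa>)) (\<lambda>r. y * v (r / \<kappa>))"
  proof (rule flux_form_regular_solution[OF p q N R'])
    show "flux_form N p R' (\<lambda>r. x * u (r / \<kappa>)) (\<lambda>r. x powr (p - 1) * \<kappa> powr (real N - p) * F (r / \<kappa>))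
        (\<lambda>r. r powr a * (x * u (r / \<kappa>)) powr s * (y * v (r / \<kappa>)) powr \<delta>)"
      by (rule flux_form_cong[OF flux_form_rescale[OF fu p xy(1) k]]) (use R scaled in auto)
    show "flux_form N q R' (\<lambda>r. y * v (r / \<kappa>)) (\<lambda>r. y powr (q - 1) * \<kappa> powr (real N - q) * G (r / \<kappa>))
        (\<lambda>r. r powr b * (x * u (r / \<kappa>)) powr \<mu> * (y * v (r / \<kappa>)) powr m)"
      by (rule flux_form_cong[OF flux_form_rescale[OF fv q xy(2) k]]) (use R scaled in auto)
    show "0 < x * u (r / \<kappa>) \<and> 0 < y * v (r / \<kappa>)" if "r \<in> open_range R'" for r
      using that RR[of r] pos xy by (auto simp: open_range_def)
  qed (intro cont' cont)+
  with that xy show thesis by blast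
qed

lemma log_slope_rescaled:
  assumes "(w has_real_derivative W) (at (exp t / \<kappa>))" "0 < \<kappa>" "0 < x"
  shows "log_slope (\<lambda>r. x * w (r / \<kappa>)) t = - (exp t / \<kappa> * W) / w (exp t / \<kappa>)"
proof -
  have "((\<lambda>r. x * w (r / \<kappa>)) has_real_derivative x * (W * (1 / \<kappa>))) (at (exp t))"
    by (rule DERIV_cmult[OF DERIV_chain2[where g = "\<lambda>r. r / \<kappa>" and x = "exp t", OF assms(1)]])
       (use DERIV_cdivide[OF DERIV_ident, of \<kappa>] in simp)
  then have "deriv (\<lambda>r. x * w (r / \<kappa>)) (exp t) = x * (W * (1 / \<kappa>))" by (rule DERIV_imp_deriv)
  then have "log_slope (\<lambda>r. x * w (r / \<kappa>)) t
      = - (exp t * (x * (W * (1 / \<kappa>)))) / (x * w (exp t / \<kappa>))"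
    by (simp only: log_slope_def)
  then show ?thesis using assms(3) by simp
qed

text \<open>The function \<open>A u - r |u'|\<close> is strictly decreasing, its derivative being \<open>- r\<^sup>-\<^sup>A\<close> times that of a
  power of the flux, and it vanishes at \<open>\<rho>\<close>.\<close>

lemma flux_form_slope_below:
  assumes ff: "flux_form N p R u F g" and p: "1 < p" "p < real N"
    and r: "0 < r" "r < \<rho>" "ereal \<rho> < R" and g: "\<And>x. x \<in> open_range R \<Longrightarrow> 0 < g x"
    and exit: "\<rho> * (\<rho> powr (1 - real N) * F \<rho>) powr (1 / (p - 1)) = (real N - p) / (p - 1) * u \<rho>"
  shows "r * (r powr (1 - real N) * F r) powr (1 / (p - 1)) < (real N - p) / (p - 1) * u r"
proof -
  define A where "A = (real N - p) / (p - 1)"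
  define \<theta> where "\<theta> = 1 / (p - 1)"
  have A: "0 < A" and \<theta>: "0 < \<theta>" using p by (auto simp: A_def \<theta>_def)
  have A_eq: "(1 - real N) * \<theta> = - A - 1" using p by (simp add: A_def \<theta>_def field_simps)
  have inR: "x \<in> open_range R" "0 < x" "0 < F x" if "r \<le> x" "x \<le> \<rho>" for x
  proof -
    show "0 < x" using that r by simp
    have "ereal x < R" using that r(3) by (meson ereal_less_eq(3) le_less_trans)
    then show "x \<in> open_range R" using \<open>0 < x\<close> by (simp add: open_range_def)
    show "0 < F x" using ff \<open>ereal x < R\<close> \<open>0 < x\<close> by (simp add: flux_form_def)
  qed
  have slope: "(x powr (1 - real N) * F x) powr \<theta> = x powr (- A - 1) * F x powr \<theta>"
    if "r \<le> x" "x \<le> \<rho>" for x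
    using inR[OF that] by (simp add: powr_mult powr_powr A_eq)
  let ?f = "\<lambda>x. A * u x - x powr (- A) * F x powr \<theta>"
  have f: "?f x = A * u x - x * (x powr (1 - real N) * F x) powr \<theta>" if "r \<le> x" "x \<le> \<rho>" for x
    unfolding slope[OF that] using inR(2)[OF that] powr_mult_base[of x "- A - 1"]
    by (simp add: mult.assoc[symmetric])
  have "?f \<rho> < ?f r"
  proof (rule DERIV_neg_imp_decreasing[where f = ?f, OF r(2)])
    fix x assume x: "r \<le> x" "x \<le> \<rho>"
    note x0 = inR[OF x]
    have Du: "(u has_real_derivative - (x powr (- A - 1) * F x powr \<theta>)) (at x)"
      using ff x0 slope[OF x] unfolding flux_form_def open_range_def \<theta>_def by auto
    have DF: "(F has_real_derivative x powr (real N - 1) * g x) (at x)"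
      using ff x0 unfolding flux_form_def open_range_def by auto
    have DFp: "((\<lambda>x. F x powr \<theta>) has_real_derivative (\<theta> * F x powr (\<theta> - 1)) * (x powr (real N - 1) * g x)) (at x)"
      by (rule DERIV_chain2[where f = "\<lambda>z. z powr \<theta>", OF has_real_derivative_powr[OF x0(3)] DF])
    have "(?f has_real_derivative A * (- (x powr (- A - 1) * F x powr \<theta>))
       - ((- A * x powr (- A - 1)) * F x powr \<theta>
          + ((\<theta> * F x powr (\<theta> - 1)) * (x powr (real N - 1) * g x)) * x powr (- A))) (at x)"
      by (intro DERIV_diff DERIV_cmult Du DERIV_mult has_real_derivative_powr x0(2) DFp)
    moreover have "A * (- (x powr (- A - 1) * F x powr \<theta>))
       - ((- A * x powr (- A - 1)) * F x powr \<theta>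
          + ((\<theta> * F x powr (\<theta> - 1)) * (x powr (real N - 1) * g x)) * x powr (- A))
      = - (((\<theta> * F x powr (\<theta> - 1)) * (x powr (real N - 1) * g x)) * x powr (- A))" by simp
    moreover have "0 < ((\<theta> * F x powr (\<theta> - 1)) * (x powr (real N - 1) * g x)) * x powr (- A)"
      using x0 g[OF x0(1)] \<theta> by simp
    ultimately show "\<exists>y. (?f has_real_derivative y) (at x) \<and> y < 0"
      by (intro exI conjI) (assumption, linarith)
  qed
  then have "A * u \<rho> - \<rho> * (\<rho> powr (1 - real N) * F \<rho>) powr \<theta> < A * u r - r * (r powr (1 - real N) * F r) powr \<theta>"
    using f[of \<rho>] f[of r] r by simp
  then show ?thesis using exit by (simp add: A_def \<theta>_def)
qed

lemma (in radial_exponents) profile_flux: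
  assumes pars: "1 < p" "c = real N + a" "d = (p + a) / (p - 1)" "\<theta> = 1 / (p - 1)" "0 < \<alpha>"
    and exps: "0 \<le> s" "0 \<le> \<delta>"
    and cont: "continuous_on {0..} u" "continuous_on {0..} v"
    and pos: "\<And>r. r \<in> half_open_range R \<Longrightarrow> 0 < u r \<and> 0 < v r"
    and le1: "\<And>r. r \<in> half_open_range R \<Longrightarrow> u r \<le> 1 \<and> v r \<le> 1"
    and eq: "\<And>r. r \<in> half_open_range R \<Longrightarrow> w r = 1 - \<alpha> * descent c d \<theta> (source s \<delta> u v) r"
  shows "flux_form N p R w (\<lambda>r. (\<alpha> * d) powr (p - 1) * mass c (source s \<delta> u v) r)
     (\<lambda>r. (\<alpha> * d) powr (p - 1) * c * r powr a * (u r powr s * v r powr \<delta>))"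
proof (rule descent_flux_form[OF pars])
  have sub: "half_open_range R \<subseteq> {0..}" by (auto simp: half_open_range_def)
  show "continuous_on (half_open_range R) (source s \<delta> u v)"
    using pos by (intro continuous_on_mult continuous_on_powr continuous_on_const
      continuous_on_subset[OF cont(1) sub] continuous_on_subset[OF cont(2) sub]) force+
  show "0 < u x powr s * v x powr \<delta>" if "x \<in> half_open_range R" for x using pos[OF that] by simp
  show "u x powr s * v x powr \<delta> \<le> 1" if "x \<in> half_open_range R" for x
  proof -
    have "u x powr s * v x powr \<delta> \<le> 1 powr s * 1 powr \<delta>"
      using pos[OF that] le1[OF that] exps by (intro mult_mono powr_mono2) auto
    then show ?thesis by simp
  qed
qed (use eq in auto)

text \<open>The scalar equation appears as a pair with second component \<open>1\<close>.\<close>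

lemma no_entire_scalar_profile:
  assumes p: "1 < p" "p < real N" and pa: "0 < p + a" and s: "0 \<le> s"
    and sub: "s < (real N * (p - 1) + p + p * a) / (real N - p)"
    and cont: "continuous_on {0..} u"
    and pos: "\<And>r. 0 \<le> r \<Longrightarrow> 0 < u r"
    and eq: "\<And>r. 0 \<le> r \<Longrightarrow> u r = 1 - descent (real N + a) ((p + a) / (p - 1)) (1 / (p - 1)) (\<lambda>x. u x powr s) r"
  shows False
proof -
  interpret X: radial_exponents "real N + a" "(p + a) / (p - 1)" "1 / (p - 1)"
  proof unfold_locales
    show "(p + a) / (p - 1) < (real N + a) * (1 / (p - 1))"
      using p by (simp add: divide_strict_right_mono)
  qed (use p pa in auto)
  have le1: "u r \<le> 1" if "0 \<le> r" for r using eq[OF that] X.descent_nonneg[OF that] by simp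
  define C where "C = ((p + a) / (p - 1)) powr (p - 1)"
  define M where "M = mass (real N + a) (\<lambda>x. u x powr s)"
  have C: "0 < C" using p pa by (simp add: C_def)
  have "flux_form N p \<infinity> u (\<lambda>r. (1 * ((p + a) / (p - 1))) powr (p - 1)
        * mass (real N + a) (\<lambda>x. u x powr s * (\<lambda>_. 1) x powr 0) r)
     (\<lambda>r. (1 * ((p + a) / (p - 1))) powr (p - 1) * (real N + a) * r powr a * (u r powr s * (\<lambda>_. 1) r powr 0))"
    by (rule X.profile_flux) (use p s cont pos le1 eq in \<open>auto simp: half_open_range_def\<close>)
  then have ff: "flux_form N p \<infinity> u (\<lambda>r. C * M r) (\<lambda>r. C * (real N + a) * r powr a * u r powr s)"
    by (simp add: C_def M_def)
  have cs: "continuous_on {0..} (\<lambda>x. u x powr s)"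
    by (intro continuous_on_powr cont continuous_on_const) (use pos in force)
  have F: "C * M r \<le> C * r powr (real N + a)" if r: "0 < r" for r
  proof -
    have "u x powr s \<le> 1" if "0 \<le> x" for x
      using powr_mono2[of s "u x" 1] s pos[OF that] le1[OF that] by simp
    then have "radial_mean (real N + a) (\<lambda>x. u x powr s) r \<le> 1"
      by (intro X.mean_bounds(2)[OF cs, of r 0]) (use r in auto)
    then show ?thesis using C by (simp add: M_def mass_def mult_left_le)
  qed
  interpret scalar_flux N p a s "C * (real N + a)" C u "\<lambda>r. C * M r"
    by unfold_locales (use p pa s ff pos le1 C F X.c_pos in \<open>auto\<close>)
  show False using not_subcritical sub by blast
qed

text \<open>The hypotheses rule out that the exit radius escapes to infinity: a limit with both multipliers
  positive is a ground state after rescaling, and if one multiplier vanishes, its component is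
  the constant \<open>1\<close> and the other component is an entire solution of a subcritical scalar equation.
  What remains is a pair with finite common exit radius \<open>\<rho>\<close>.\<close>

lemma simultaneous_exit_profile:
  fixes N :: nat and p q a b s m \<delta> \<mu> \<eta> \<zeta> :: real
  defines "c1 \<equiv> real N + a" and "d1 \<equiv> (p + a) / (p - 1)" and "\<theta>1 \<equiv> 1 / (p - 1)"
    and "c2 \<equiv> real N + b" and "d2 \<equiv> (q + b) / (q - 1)" and "\<theta>2 \<equiv> 1 / (q - 1)"
  assumes p: "1 < p" "p < real N" and q: "1 < q" "q < real N"
    and pa: "0 < p + a" and qb: "0 < q + b"
    and ex: "0 \<le> s" "0 \<le> m" "0 < \<delta>" "0 < \<mu>"
    and D: "\<delta> * \<mu> - (p - 1 - s) * (q - 1 - m) > 0"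
    and sub_s: "s < (real N * (p - 1) + p + p * a) / (real N - p)"
    and sub_m: "m < (real N * (q - 1) + q + q * b) / (real N - q)"
    and no_gs: "\<not> (\<exists>u v. ground_state N p q a b s m \<delta> \<mu> u v)"
    and eta: "0 \<le> \<eta>" "\<eta> * ((real N - p) / (p - 1)) \<le> 1"
    and zeta: "0 \<le> \<zeta>" "\<zeta> * ((real N - q) / (q - 1)) \<le> 1"
  obtains \<alpha> \<beta> \<rho> u v where "0 < \<alpha>" "0 < \<beta>" "0 < \<rho>"
    "continuous_on {0..} u" "continuous_on {0..} v"
    "\<And>r. 0 \<le> r \<Longrightarrow> r < \<rho> \<Longrightarrow> 0 < u r \<and> 0 < v r"
    "\<And>R. (\<And>x. x \<in> half_open_range R \<Longrightarrow> 0 < u x \<and> 0 < v x) \<Longrightarrow>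
       flux_form N p R u (\<lambda>r. (\<alpha> * d1) powr (p - 1) * mass c1 (source s \<delta> u v) r)
         (\<lambda>r. (\<alpha> * d1) powr (p - 1) * c1 * r powr a * (u r powr s * v r powr \<delta>)) \<and>
       flux_form N q R v (\<lambda>r. (\<beta> * d2) powr (q - 1) * mass c2 (source \<mu> m u v) r)
         (\<lambda>r. (\<beta> * d2) powr (q - 1) * c2 * r powr b * (u r powr \<mu> * v r powr m))"
    "\<eta> = 0 \<Longrightarrow> u \<rho> = 0" "\<zeta> = 0 \<Longrightarrow> v \<rho> = 0"
    "0 < \<eta> \<Longrightarrow> 0 < u \<rho>" "0 < \<zeta> \<Longrightarrow> 0 < v \<rho>"
    "(\<And>x. 0 \<le> x \<Longrightarrow> x \<le> \<rho> \<Longrightarrow> 0 < u x \<and> 0 < v x) \<Longrightarrow>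
      u \<rho> = \<eta> * (\<rho> * (\<rho> powr (1 - real N) * ((\<alpha> * d1) powr (p - 1)
        * mass c1 (source s \<delta> u v) \<rho>)) powr (1 / (p - 1))) \<and>
      v \<rho> = \<zeta> * (\<rho> * (\<rho> powr (1 - real N) * ((\<beta> * d2) powr (q - 1)
        * mass c2 (source \<mu> m u v) \<rho>)) powr (1 / (q - 1)))"
proof -
  note defs = c1_def[THEN meta_eq_to_obj_eq] d1_def[THEN meta_eq_to_obj_eq] \<theta>1_def[THEN meta_eq_to_obj_eq]
    c2_def[THEN meta_eq_to_obj_eq] d2_def[THEN meta_eq_to_obj_eq] \<theta>2_def[THEN meta_eq_to_obj_eq]
  have A1: "c1 * \<theta>1 - d1 = (real N - p) / (p - 1)" and A2: "c2 * \<theta>2 - d2 = (real N - q) / (q - 1)"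
    unfolding c1_def d1_def \<theta>1_def c2_def d2_def \<theta>2_def by (simp_all add: diff_divide_distrib[symmetric])
  have A_pos: "0 < (real N - p) / (p - 1)" "0 < (real N - q) / (q - 1)" using p q by auto
  have N1: "1 \<le> N" using p by linarith
  interpret radial_pair c1 d1 \<theta>1 c2 d2 \<theta>2 s m \<delta> \<mu>
  proof unfold_locales
    show "d1 < c1 * \<theta>1" "d2 < c2 * \<theta>2" using A1 A2 A_pos by linarith+
  qed (use p q pa qb ex in \<open>auto simp: c1_def d1_def \<theta>1_def c2_def d2_def \<theta>2_def\<close>)
  have "\<eta> * (c1 * \<theta>1 - d1) \<le> 1" "\<zeta> * (c2 * \<theta>2 - d2) \<le> 1" using eta zeta A1 A2 by simp_all
  note ez = this
  show thesis
  proof (rule limit_profile[OF eta(1) ez(1) zeta(1) ez(2)])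
    fix \<alpha> \<beta> \<iota> u v
    assume ab: "0 \<le> \<alpha>" "0 \<le> \<beta>" "\<alpha> + \<beta> = 1" and iota: "0 \<le> \<iota>"
      and cont: "continuous_on {0..} u" "continuous_on {0..} v"
      and pos: "\<And>r. 0 \<le> r \<Longrightarrow> r * \<iota> < 1 \<Longrightarrow> 0 < u r \<and> 0 < v r"
      and eqs: "\<And>r. 0 \<le> r \<Longrightarrow> (\<And>x. 0 \<le> x \<Longrightarrow> x \<le> r \<Longrightarrow> 0 < u x \<and> 0 < v x) \<Longrightarrow>
        u r = 1 - \<alpha> * descent c1 d1 \<theta>1 (source s \<delta> u v) r \<and>
        v r = 1 - \<beta> * descent c2 d2 \<theta>2 (source \<mu> m u v) r"
      and ab_pos: "0 < \<iota> \<Longrightarrow> 0 < \<alpha> \<and> 0 < \<beta>"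
      and van: "0 < \<iota> \<Longrightarrow> \<eta> = 0 \<Longrightarrow> u (1 / \<iota>) = 0" "0 < \<iota> \<Longrightarrow> \<zeta> = 0 \<Longrightarrow> v (1 / \<iota>) = 0"
      and ep: "0 < \<iota> \<Longrightarrow> 0 < \<eta> \<Longrightarrow> 0 < u (1 / \<iota>)" "0 < \<iota> \<Longrightarrow> 0 < \<zeta> \<Longrightarrow> 0 < v (1 / \<iota>)"
      and ev: "0 < \<iota> \<Longrightarrow> (\<And>x. 0 \<le> x \<Longrightarrow> x \<le> 1 / \<iota> \<Longrightarrow> 0 < u x \<and> 0 < v x) \<Longrightarrow>
        u (1 / \<iota>) = \<eta> * (\<alpha> * (d1 * (1 / \<iota>) powr d1 *
          radial_mean c1 (source s \<delta> u v) (1 / \<iota>) powr \<theta>1)) \<and>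
        v (1 / \<iota>) = \<zeta> * (\<beta> * (d2 * (1 / \<iota>) powr d2 *
          radial_mean c2 (source \<mu> m u v) (1 / \<iota>) powr \<theta>2))"
    have eqR: "u r = 1 - \<alpha> * descent c1 d1 \<theta>1 (source s \<delta> u v) r \<and>
        v r = 1 - \<beta> * descent c2 d2 \<theta>2 (source \<mu> m u v) r"
      if R: "\<And>x. x \<in> half_open_range R \<Longrightarrow> 0 < u x \<and> 0 < v x" and r: "r \<in> half_open_range R" for R r
    proof (rule eqs)
      show "0 \<le> r" using r by (simp add: half_open_range_def)
      show "0 < u x \<and> 0 < v x" if "0 \<le> x" "x \<le> r" for x
      proof (rule R)
        have "ereal x < R" using that r unfolding half_open_range_def
          by (metis (no_types, lifting) ereal_less_eq(3) le_less_trans mem_Collect_eq)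
        then show "x \<in> half_open_range R" using that by (simp add: half_open_range_def)
      qed
    qed
    have le1: "u r \<le> 1 \<and> v r \<le> 1"
      if R: "\<And>x. x \<in> half_open_range R \<Longrightarrow> 0 < u x \<and> 0 < v x" and r: "r \<in> half_open_range R" for R r
    proof -
      have "0 \<le> r" using r by (simp add: half_open_range_def)
      then show ?thesis
        using eqR[OF R r] X.descent_nonneg[of r] Y.descent_nonneg[of r] ab by simp
    qed
    have flux: "flux_form N p R u (\<lambda>r. (\<alpha> * d1) powr (p - 1) * mass c1 (source s \<delta> u v) r)
           (\<lambda>r. (\<alpha> * d1) powr (p - 1) * c1 * r powr a * (u r powr s * v r powr \<delta>)) \<and>
         flux_form N q R v (\<lambda>r. (\<beta> * d2) powr (q - 1) * mass c2 (source \<mu> m u v) r)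
           (\<lambda>r. (\<beta> * d2) powr (q - 1) * c2 * r powr b * (u r powr \<mu> * v r powr m))"
      if "0 < \<alpha>" "0 < \<beta>" and R: "\<And>x. x \<in> half_open_range R \<Longrightarrow> 0 < u x \<and> 0 < v x" for R
      using X.profile_flux[OF p(1) defs(1-3) that(1), of s \<delta> u v R u]
        Y.profile_flux[OF q(1) defs(4-6) that(2), of \<mu> m u v R v]
        cont R le1[OF R] eqR[OF R] ex by auto
    have "\<iota> \<noteq> 0"
    proof
      assume i0: "\<iota> = 0"
      have allpos: "0 < u x \<and> 0 < v x" if "0 \<le> x" for x using pos[OF that] i0 by simp
      then have allpos': "0 < u x \<and> 0 < v x" if "x \<in> half_open_range \<infinity>" for x
        using that by (simp add: half_open_range_def)
      have eqall: "u r = 1 - \<alpha> * descent c1 d1 \<theta>1 (source s \<delta> u v) r"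
        "v r = 1 - \<beta> * descent c2 d2 \<theta>2 (source \<mu> m u v) r" if "0 \<le> r" for r
        using eqs[OF that] allpos by auto
      consider "\<alpha> = 0" | "\<beta> = 0" | "0 < \<alpha>" "0 < \<beta>" using ab by fastforce
      then show False
      proof cases
        case 1
        then have u1: "u x = 1" if "0 \<le> x" for x using eqall(1)[OF that] by simp
        have "\<beta> = 1" using 1 ab by simp
        then have "v r = 1 - descent c2 d2 \<theta>2 (\<lambda>x. v x powr m) r" if "0 \<le> r" for r
          using eqall(2)[OF that] Y.descent_cong[OF that, of "\<lambda>x. u x powr \<mu> * v x powr m" "\<lambda>x. v x powr m"] u1
          by simp
        then show False
          using no_entire_scalar_profile[OF q qb ex(2) sub_m cont(2)] allpos
          unfolding c2_def d2_def \<theta>2_def by blast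
      next
        case 2
        then have v1: "v x = 1" if "0 \<le> x" for x using eqall(2)[OF that] by simp
        have "\<alpha> = 1" using 2 ab by simp
        then have "u r = 1 - descent c1 d1 \<theta>1 (\<lambda>x. u x powr s) r" if "0 \<le> r" for r
          using eqall(1)[OF that] X.descent_cong[OF that, of "\<lambda>x. u x powr s * v x powr \<delta>" "\<lambda>x. u x powr s"] v1
          by simp
        then show False
          using no_entire_scalar_profile[OF p pa ex(1) sub_s cont(1)] allpos
          unfolding c1_def d1_def \<theta>1_def by blast
      next
        case 3
        have "half_open_range \<infinity> = {0..}" by (auto simp: half_open_range_def)
        then have cont': "continuous_on (half_open_range \<infinity>) u" "continuous_on (half_open_range \<infinity>) v"
          using cont by simp_all
        have "0 < (\<alpha> * d1) powr (p - 1) * c1" "0 < (\<beta> * d2) powr (q - 1) * c2"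
          using 3 X.d_pos Y.d_pos X.c_pos Y.c_pos by simp_all
        from rescaled_regular_solution[OF p(1) q(1) N1 less_imp_neq[OF D, symmetric] this zero_less_one _ _
            conjunct1[OF flux[OF 3 allpos']] conjunct2[OF flux[OF 3 allpos']] allpos' cont', of \<infinity>]
        show False using no_gs unfolding ground_state_def by auto
      qed
    qed
    then have i: "0 < \<iota>" using iota by simp
    have abp: "0 < \<alpha>" "0 < \<beta>" using ab_pos[OF i] by auto
    have mean0: "0 \<le> radial_mean c1 (source s \<delta> u v) (1 / \<iota>)"
      "0 \<le> radial_mean c2 (source \<mu> m u v) (1 / \<iota>)"
      using i by (auto intro!: radial_mean_nonneg X.c_pos Y.c_pos)
    have r0: "0 < 1 / \<iota>" using i by simp
    note slope = X.radius_times_slope[OF p(1) defs(1-3) abp(1) r0 mean0(1)]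
      Y.radius_times_slope[OF q(1) defs(4-6) abp(2) r0 mean0(2)]
    show thesis
    proof (rule that[OF abp r0 cont _ flux[OF abp] van(1)[OF i] van(2)[OF i] ep(1)[OF i] ep(2)[OF i]])
      show "0 < u r \<and> 0 < v r" if "0 \<le> r" "r < 1 / \<iota>" for r
        using pos[OF that(1)] that(2) i by (simp add: field_simps)
      show "u (1 / \<iota>) = \<eta> * (1 / \<iota> * ((1 / \<iota>) powr (1 - real N) * ((\<alpha> * d1) powr (p - 1)
          * mass c1 (source s \<delta> u v) (1 / \<iota>))) powr (1 / (p - 1))) \<and>
        v (1 / \<iota>) = \<zeta> * (1 / \<iota> * ((1 / \<iota>) powr (1 - real N) * ((\<beta> * d2) powr (q - 1)
          * mass c2 (source \<mu> m u v) (1 / \<iota>))) powr (1 / (q - 1)))"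
        if "\<And>x. 0 \<le> x \<Longrightarrow> x \<le> 1 / \<iota> \<Longrightarrow> 0 < u x \<and> 0 < v x"
        using ev[OF i that] unfolding slope by blast
    qed
  qed
qed

theorem theorem1p1:
  fixes N :: nat and p q a b s m \<delta> \<mu> :: real
  assumes "1 < p" "p < real N" "1 < q" "q < real N"
    and "min (p + a) (q + b) > 0"
    and "s \<ge> 0" "m \<ge> 0" "\<delta> > 0" "\<mu> > 0"
    and "\<delta> * \<mu> - (p - 1 - s) * (q - 1 - m) > 0"
    and "s < (N * (p - 1) + p + p * a) / (N - p)"
    and "m < (N * (q - 1) + q + q * b) / (N - q)"
    and no_gs: "\<not> (\<exists>u v. ground_state N p q a b s m \<delta> \<mu> u v)"
  shows "(\<exists>R u v T. regular_radial_solution N p q a b s m \<delta> \<mu> R u v \<and>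
            T > 0 \<and> ereal (exp T) < R \<and>
            log_slope u T = (N - p) / (p - 1) \<and>
            log_slope v T = (N - q) / (q - 1) \<and>
            (\<forall>t<T. 0 < log_slope u t \<and> log_slope u t < (N - p) / (p - 1) \<and>
                   0 < log_slope v t \<and> log_slope v t < (N - q) / (q - 1)))
       \<and> (\<exists>R>0. \<exists>u v. radial_Dirichlet_solution N p q a b s m \<delta> \<mu> R u v)"
proof
  have pa: "0 < p + a" and qb: "0 < q + b" using assms(5) by simp_all
  have N1: "1 \<le> N" using assms by linarith
  note hyps = assms(1-4) pa qb assms(6-13)
  have D: "\<delta> * \<mu> - (p - 1 - s) * (q - 1 - m) \<noteq> 0" using assms(10) by simp
  let ?A = "(real N - p) / (p - 1)" and ?B = "(real N - q) / (q - 1)"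
  have A: "0 < ?A" "0 < ?B" using assms by simp_all
  let ?c1 = "real N + a" and ?d1 = "(p + a) / (p - 1)" and ?c2 = "real N + b" and ?d2 = "(q + b) / (q - 1)"
  have coef_pos: "0 < (\<alpha> * ?d1) powr (p - 1) * ?c1" "0 < (\<beta> * ?d2) powr (q - 1) * ?c2"
    if "0 < \<alpha>" "0 < \<beta>" for \<alpha> \<beta> using that assms pa qb by simp_all
  show "\<exists>R>0. \<exists>u v. radial_Dirichlet_solution N p q a b s m \<delta> \<mu> R u v"
  proof (rule simultaneous_exit_profile[OF hyps, of 0 0])
    fix \<alpha> \<beta> \<rho> :: real and u v :: "real \<Rightarrow> real"
    let ?hu = "\<lambda>x. u x powr s * v x powr \<delta>" and ?hv = "\<lambda>x. u x powr \<mu> * v x powr m"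
    assume ab: "0 < \<alpha>" "0 < \<beta>" and rho: "0 < \<rho>"
      and cont: "continuous_on {0..} u" "continuous_on {0..} v"
      and pos: "\<And>r. 0 \<le> r \<Longrightarrow> r < \<rho> \<Longrightarrow> 0 < u r \<and> 0 < v r"
      and flux: "\<And>R. (\<And>x. x \<in> half_open_range R \<Longrightarrow> 0 < u x \<and> 0 < v x) \<Longrightarrow>
       flux_form N p R u (\<lambda>r. (\<alpha> * ?d1) powr (p - 1) * mass ?c1 ?hu r)
         (\<lambda>r. (\<alpha> * ?d1) powr (p - 1) * ?c1 * r powr a * ?hu r) \<and>
       flux_form N q R v (\<lambda>r. (\<beta> * ?d2) powr (q - 1) * mass ?c2 ?hv r)
         (\<lambda>r. (\<beta> * ?d2) powr (q - 1) * ?c2 * r powr b * ?hv r)"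
      and van: "(0::real) = 0 \<Longrightarrow> u \<rho> = 0" "(0::real) = 0 \<Longrightarrow> v \<rho> = 0"
    have pos': "0 < u x \<and> 0 < v x" if "x \<in> half_open_range (ereal \<rho>)" for x
      using that pos by (simp add: half_open_range_def)
    have cont': "continuous_on (half_open_range (ereal \<rho>)) u" "continuous_on (half_open_range (ereal \<rho>)) v"
      using cont by (auto intro: continuous_on_subset simp: half_open_range_def)
    obtain x y where xy: "0 < x" "0 < y"
      and reg: "regular_radial_solution N p q a b s m \<delta> \<mu> (ereal \<rho>) (\<lambda>r. x * u (r / 1)) (\<lambda>r. y * v (r / 1))"
      by (rule rescaled_regular_solution[OF assms(1,3) N1 D coef_pos[OF ab] zero_less_one, where R' = "ereal \<rho>",
            OF _ _ conjunct1[OF flux[OF pos']] conjunct2[OF flux[OF pos']] pos' cont'])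
         (use rho in auto)
    have "continuous_on {0..\<rho>} u" "continuous_on {0..\<rho>} v"
      using cont by (auto intro: continuous_on_subset)
    then have "radial_Dirichlet_solution N p q a b s m \<delta> \<mu> \<rho> (\<lambda>r. x * u r) (\<lambda>r. y * v r)"
      unfolding radial_Dirichlet_solution_def
      using reg pos xy van by (auto intro!: continuous_intros)
    then show ?thesis using rho by blast
  qed simp_all
  show "\<exists>R u v T. regular_radial_solution N p q a b s m \<delta> \<mu> R u v \<and>
            T > 0 \<and> ereal (exp T) < R \<and>
            log_slope u T = (N - p) / (p - 1) \<and>
            log_slope v T = (N - q) / (q - 1) \<and>
            (\<forall>t<T. 0 < log_slope u t \<and> log_slope u t < (N - p) / (p - 1) \<and>
                   0 < log_slope v t \<and> log_slope v t < (N - q) / (q - 1))"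
  proof (rule simultaneous_exit_profile[OF hyps, of "1 / ?A" "1 / ?B"])
    fix \<alpha> \<beta> \<rho> :: real and u v :: "real \<Rightarrow> real"
    let ?hu = "\<lambda>x. u x powr s * v x powr \<delta>" and ?hv = "\<lambda>x. u x powr \<mu> * v x powr m"
    let ?F = "\<lambda>r. (\<alpha> * ?d1) powr (p - 1) * mass ?c1 ?hu r"
    let ?G = "\<lambda>r. (\<beta> * ?d2) powr (q - 1) * mass ?c2 ?hv r"
    let ?U = "\<lambda>r. (r powr (1 - real N) * ?F r) powr (1 / (p - 1))"
    let ?V = "\<lambda>r. (r powr (1 - real N) * ?G r) powr (1 / (q - 1))"
    assume ab: "0 < \<alpha>" "0 < \<beta>" and rho: "0 < \<rho>"
      and cont: "continuous_on {0..} u" "continuous_on {0..} v"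
      and pos: "\<And>r. 0 \<le> r \<Longrightarrow> r < \<rho> \<Longrightarrow> 0 < u r \<and> 0 < v r"
      and flux: "\<And>R. (\<And>x. x \<in> half_open_range R \<Longrightarrow> 0 < u x \<and> 0 < v x) \<Longrightarrow>
       flux_form N p R u ?F (\<lambda>r. (\<alpha> * ?d1) powr (p - 1) * ?c1 * r powr a * ?hu r) \<and>
       flux_form N q R v ?G (\<lambda>r. (\<beta> * ?d2) powr (q - 1) * ?c2 * r powr b * ?hv r)"
      and end_pos: "0 < 1 / ?A \<Longrightarrow> 0 < u \<rho>" "0 < 1 / ?B \<Longrightarrow> 0 < v \<rho>"
      and exit: "(\<And>x. 0 \<le> x \<Longrightarrow> x \<le> \<rho> \<Longrightarrow> 0 < u x \<and> 0 < v x) \<Longrightarrow>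
        u \<rho> = 1 / ?A * (\<rho> * ?U \<rho>) \<and> v \<rho> = 1 / ?B * (\<rho> * ?V \<rho>)"
    have pos_rho: "0 < u \<rho>" "0 < v \<rho>" using end_pos assms(1-4) by simp_all
    have "isCont u \<rho>" "isCont v \<rho>"
      using continuous_on_interior[OF cont(1), of \<rho>] continuous_on_interior[OF cont(2), of \<rho>] rho
      by simp_all
    then have "eventually (\<lambda>x. 0 < u x \<and> 0 < v x) (at \<rho>)"
      using pos_rho by (intro eventually_conj) (auto simp: isCont_def intro: order_tendstoD)
    then obtain e where e: "0 < e" "\<And>x. x \<noteq> \<rho> \<Longrightarrow> dist x \<rho> < e \<Longrightarrow> 0 < u x \<and> 0 < v x"
      by (auto simp: eventually_at)
    \<comment> \<open>Both components are still positive at \<open>\<rho>\<close>, so the limit solves the system slightly beyond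
      \<open>\<rho>\<close>.\<close>
    define \<rho>' where "\<rho>' = \<rho> + e"
    have rho': "\<rho> < \<rho>'" using e by (simp add: \<rho>'_def)
    have pos'': "0 < u x \<and> 0 < v x" if "0 \<le> x" "x < \<rho>'" for x
      using pos[OF that(1)] e(2)[of x] pos_rho that(2)
      by (cases x \<rho> rule: linorder_cases) (auto simp: \<rho>'_def dist_real_def)
    have pos': "0 < u x \<and> 0 < v x" if "x \<in> half_open_range (ereal \<rho>')" for x
      using that pos'' by (simp add: half_open_range_def)
    have cont': "continuous_on (half_open_range (ereal \<rho>')) u" "continuous_on (half_open_range (ereal \<rho>')) v"
      using cont by (auto intro: continuous_on_subset simp: half_open_range_def)
    have fl: "flux_form N p (ereal \<rho>') u ?F (\<lambda>r. (\<alpha> * ?d1) powr (p - 1) * ?c1 * r powr a * ?hu r)"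
      "flux_form N q (ereal \<rho>') v ?G (\<lambda>r. (\<beta> * ?d2) powr (q - 1) * ?c2 * r powr b * ?hv r)"
      using flux[of "ereal \<rho>'"] pos' by blast+
    \<comment> \<open>Dilation of the radius moves the common exit time to \<open>T = 1\<close>.\<close>
    define \<kappa> where "\<kappa> = exp 1 / \<rho>"
    have k: "0 < \<kappa>" using rho by (simp add: \<kappa>_def)
    have "0 < ereal (\<kappa> * \<rho>')" using k rho rho' by simp
    moreover have "ereal (r / \<kappa>) < ereal \<rho>'" if "0 \<le> r" "ereal r < ereal (\<kappa> * \<rho>')" for r
      using that k by (simp add: field_simps)
    ultimately obtain x y where xy: "0 < x" "0 < y"
      and reg: "regular_radial_solution N p q a b s m \<delta> \<mu> (ereal (\<kappa> * \<rho>')) (\<lambda>r. x * u (r / \<kappa>)) (\<lambda>r. y * v (r / \<kappa>))"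
      by (rule rescaled_regular_solution[OF assms(1,3) N1 D coef_pos[OF ab] k, where R' = "ereal (\<kappa> * \<rho>')",
            OF _ _ fl pos' cont'])
    have at_rho: "\<rho> * ?U \<rho> = ?A * u \<rho>" "\<rho> * ?V \<rho> = ?B * v \<rho>"
      using exit pos'' rho' A by auto
    have Du: "(u has_real_derivative - ?U r) (at r)" "0 < ?U r" "(v has_real_derivative - ?V r) (at r)" "0 < ?V r"
      if "0 < r" "r < \<rho>'" for r
    proof -
      have FG: "0 < F r \<Longrightarrow> 0 < (r powr (1 - real N) * F r) powr e" for F e
        using that by simp
      have "0 < ?F r" "0 < ?G r" "(u has_real_derivative - ?U r) (at r)" "(v has_real_derivative - ?V r) (at r)"
        using fl(1)[unfolded flux_form_def, rule_format, of r] fl(2)[unfolded flux_form_def, rule_format, of r]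
          that by (metis less_ereal.simps(1))+
      then show "(u has_real_derivative - ?U r) (at r)" "0 < ?U r"
        "(v has_real_derivative - ?V r) (at r)" "0 < ?V r"
        using FG[of ?F] FG[of ?G] by blast+
    qed
    have slopes: "log_slope (\<lambda>r. x * u (r / \<kappa>)) t = r * ?U r / u r" "log_slope (\<lambda>r. y * v (r / \<kappa>)) t = r * ?V r / v r"
      if "r = exp t / \<kappa>" "r < \<rho>'" for r t
    proof -
      have r: "0 < r" using that k by simp
      show "log_slope (\<lambda>r. x * u (r / \<kappa>)) t = r * ?U r / u r"
        using log_slope_rescaled[OF Du(1)[OF r that(2), unfolded that(1)] k xy(1)] unfolding that(1) by simp
      show "log_slope (\<lambda>r. y * v (r / \<kappa>)) t = r * ?V r / v r"
        using log_slope_rescaled[OF Du(3)[OF r that(2), unfolded that(1)] k xy(2)] unfolding that(1) by simp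
    qed
    have "exp 1 / \<kappa> = \<rho>" using rho by (simp add: \<kappa>_def)
    then have at_T: "log_slope (\<lambda>r. x * u (r / \<kappa>)) 1 = ?A" "log_slope (\<lambda>r. y * v (r / \<kappa>)) 1 = ?B"
      using slopes[of \<rho> 1] rho' at_rho pos_rho by simp_all
    have before: "0 < log_slope (\<lambda>r. x * u (r / \<kappa>)) t \<and> log_slope (\<lambda>r. x * u (r / \<kappa>)) t < ?A \<and>
        0 < log_slope (\<lambda>r. y * v (r / \<kappa>)) t \<and> log_slope (\<lambda>r. y * v (r / \<kappa>)) t < ?B" if t: "t < 1" for t
    proof -
      define r where "r = exp t / \<kappa>"
      have r: "0 < r" "r < \<rho>"
        using t k rho by (auto simp: r_def \<kappa>_def field_simps)
      have uv: "0 < u r" "0 < v r" using pos[of r] r by auto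
      have gpos: "0 < (\<alpha> * ?d1) powr (p - 1) * ?c1 * z powr a * ?hu z"
        "0 < (\<beta> * ?d2) powr (q - 1) * ?c2 * z powr b * ?hv z" if "z \<in> open_range (ereal \<rho>')" for z
        using that pos''[of z] coef_pos[OF ab] by (simp_all add: open_range_def)
      have "ereal \<rho> < ereal \<rho>'" using rho' by simp
      then have "r * ?U r < ?A * u r" "r * ?V r < ?B * v r"
        using flux_form_slope_below[OF fl(1) assms(1,2) r _ gpos(1) at_rho(1)]
          flux_form_slope_below[OF fl(2) assms(3,4) r _ gpos(2) at_rho(2)] by blast+
      moreover have "0 < r * ?U r" "0 < r * ?V r" using r Du[of r] rho' by simp_all
      ultimately show ?thesis
        using slopes[OF r_def] r rho' uv by (simp add: pos_divide_less_eq)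
    qed
    have "\<kappa> * \<rho> = exp 1" using rho by (simp add: \<kappa>_def)
    then have "exp 1 < \<kappa> * \<rho>'" using mult_strict_left_mono[OF rho' k] by simp
    then show ?thesis
      using reg at_T before by (intro exI[of _ "ereal (\<kappa> * \<rho>')"] exI[of _ "\<lambda>r. x * u (r / \<kappa>)"]
          exI[of _ "\<lambda>r. y * v (r / \<kappa>)"] exI[of _ "1::real"]) simp
  qed (use A assms(1-4) in simp_all)
qed

end
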